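(* Let $D\subset\mathbb{C}^n$ be a bounded $\alpha$-regular domain, let $K\subset D$ be a compact set and let $\psi\in C(K)$ with $\psi<0$ on $K$, such that $\psi$ admits a negative $\alpha$-subharmonic extension to $D$ (some $\widetilde\psi\in\alpha\text{-}sh(D)$ with $\widetilde\psi<0$ on $D$ and $\widetilde\psi|_K=\psi$). Then: (1) a point $z_0\in K$ is locally $(\alpha,\psi)$-regular if and only if it is locally $\alpha$-regular, i.e. for every neighborhood $B\subset D$ of $z_0$ one has $\omega^*_\alpha(z_0,K\cap\overline B,D)=-1$; (2) if moreover $\psi$ admits an extension $\widetilde\psi$ which is strictly $\alpha$-subharmonic in a neighborhood $D^+$ of $\overline D$ and satisfies $\widetilde\psi|_K=\psi|_K$ and $\widetilde\psi<0$ on $D$, then a point $z_0\in K$ is locally $(\alpha,\psi)$-regular if and only if it is $(\alpha,\psi)$-regular.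
   Context: Fix a closed, strictly positive differential form $\alpha$ of bidegree $(n-1,n-1)$ on an open subset of $\mathbb{C}^n$ containing all sets considered, with $C^1$ coefficients. Let $d=\partial+\bar\partial$, $d^c=(\bar\partial-\partial)/(4i)$. For an open set $\Omega$, $u\in L^1_{loc}(\Omega)$ is $\alpha$-subharmonic ($u\in\alpha\text{-}sh(\Omega)$) if it is strongly upper semicontinuous (upper semicontinuous, and for every $z^0\in\Omega$ and every set $A$ of full Lebesgue measure near $z^0$, $\limsup_{z\to z^0,z\in A}u(z)=u(z^0)$) and $\int u\,\alpha\wedge dd^c\omega\ge0$ for every nonnegative test function $\omega$; $u\equiv-\infty$ is also allowed. $u$ is strictly $\alpha$-subharmonic in $\Omega$ if for every relatively compact subdomain $G\Subset\Omega$ there is $\varepsilon>0$ with $u-\varepsilon|z|^2\in\alpha\text{-}sh(G)$. A bounded domain $D$ is $\alpha$-regular if there is $\rho\in\alpha\text{-}sh(D)$ with $\rho<0$ on $D$ and $\rho\to0$ at $\partial D$. For $E\subset D$ and bounded $\psi$ on $E$ with $\sup_E\psi<0$, $\mathcal U(E,D,\psi)$ is the class of $u\in\alpha\text{-}sh(D)$ with $u<0$ on $D$, $u\le\psi$ on $E$; $\omega_\alpha(z,E,D,\psi)=\sup\{u(z):u\in\mathcal U(E,D,\psi)\}$, $\omega^*_\alpha(z,E,D,\psi)=\limsup_{w\to z}\omega_\alpha(w,E,D,\psi)$; for $\psi\equiv-1$ write $\omega^*_\alpha(z,E,D)$. A point $z_0\in K$ is $(\alpha,\psi)$-regular if $\omega^*_\alpha(z_0,K,D,\psi)=\psi(z_0)$,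 and locally $(\alpha,\psi)$-regular if $\omega^*_\alpha(z_0,K\cap\overline B,D,\psi)=\psi(z_0)$ for every neighborhood $B\subset\mathbb{C}^n$ of $z_0$. *)

theory Defs
  imports "HOL-Analysis.Analysis" "HOL-Library.Liminf_Limsup"
begin

text \<open>Points of C^n are modelled as vectors of type complex^'n.
 The closed strictly positive (n-1,n-1)-form alpha is modelled, in coordinates, by its
 coefficient matrix a z j k (a Hermitian positive definite matrix depending C^1 on z),
 so that alpha wedge dd^c omega is (a positive constant times)
 sum_{j,k} a_{jk} d^2 omega/(dz_j dzbar_k) dV.\<close>

definition real_pderiv :: "(complex^'n \<Rightarrow> 'b::real_normed_vector) \<Rightarrow> complex^'n \<Rightarrow> complex^'n \<Rightarrow> 'b" where
  "real_pderiv f z v = frechet_derivative f (at z) v"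

definition wirt_dz :: "'n \<Rightarrow> (complex^'n \<Rightarrow> complex) \<Rightarrow> complex^'n \<Rightarrow> complex" where
  "wirt_dz j f z = (real_pderiv f z (axis j 1) - \<i> * real_pderiv f z (axis j \<i>)) / 2"

definition wirt_dzbar :: "'n \<Rightarrow> (complex^'n \<Rightarrow> complex) \<Rightarrow> complex^'n \<Rightarrow> complex" where
  "wirt_dzbar j f z = (real_pderiv f z (axis j 1) + \<i> * real_pderiv f z (axis j \<i>)) / 2"

fun Ck_on :: "nat \<Rightarrow> (complex^'n) set \<Rightarrow> (complex^'n \<Rightarrow> 'b::real_normed_vector) \<Rightarrow> bool" where
  "Ck_on 0 S f = continuous_on S f"
| "Ck_on (Suc k) S f = (f differentiable_on S \<and> continuous_on S f \<and>
      (\<forall>v. Ck_on k S (\<lambda>z. real_pderiv f z v)))"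

definition smooth_on :: "(complex^'n) set \<Rightarrow> (complex^'n \<Rightarrow> 'b::real_normed_vector) \<Rightarrow> bool" where
  "smooth_on S f = (\<forall>k. Ck_on k S f)"

definition nonneg_test_fun :: "(complex^'n) set \<Rightarrow> (complex^'n \<Rightarrow> real) \<Rightarrow> bool" where
  "nonneg_test_fun \<Omega> \<omega> = (smooth_on UNIV \<omega> \<and> (\<forall>z. \<omega> z \<ge> 0) \<and>
      compact (closure {z. \<omega> z \<noteq> 0}) \<and> closure {z. \<omega> z \<noteq> 0} \<subseteq> \<Omega>)"

text \<open>The data (U, a) represent a closed strictly positive (n-1,n-1)-form with C^1
  coefficients on the open set U.\<close>
definition admissible_form :: "(complex^'n) set \<Rightarrow> (complex^'n \<Rightarrow> 'n \<Rightarrow> 'n \<Rightarrow> complex) \<Rightarrow> bool" where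
  "admissible_form U a = (open U \<and>
     (\<forall>j k. Ck_on 1 U (\<lambda>z. a z j k)) \<and>
     (\<forall>z\<in>U. \<forall>j k. a z k j = cnj (a z j k)) \<and>
     (\<forall>z\<in>U. \<forall>\<xi>::complex^'n. \<xi> \<noteq> 0 \<longrightarrow>
         Re (\<Sum>j\<in>UNIV. \<Sum>k\<in>UNIV. a z j k * \<xi>$j * cnj (\<xi>$k)) > 0) \<and>
     (\<forall>z\<in>U. \<forall>k. (\<Sum>j\<in>UNIV. wirt_dz j (\<lambda>w. a w j k) z) = 0))"

text \<open>The density of alpha wedge dd^c omega (up to a positive normalising constant).\<close>
definition alpha_ddc :: "(complex^'n \<Rightarrow> 'n \<Rightarrow> 'n \<Rightarrow> complex) \<Rightarrow> (complex^'n \<Rightarrow> real) \<Rightarrow> complex^'n \<Rightarrow> real" where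
  "alpha_ddc a \<omega> z = Re (\<Sum>j\<in>UNIV. \<Sum>k\<in>UNIV.
      a z j k * wirt_dz j (wirt_dzbar k (\<lambda>w. complex_of_real (\<omega> w))) z)"

definition L1_loc :: "(complex^'n) set \<Rightarrow> (complex^'n \<Rightarrow> ereal) \<Rightarrow> bool" where
  "L1_loc \<Omega> u = (\<forall>C. compact C \<and> C \<subseteq> \<Omega> \<longrightarrow>
      (AE z in lborel. z \<in> C \<longrightarrow> \<bar>u z\<bar> \<noteq> \<infinity>) \<and>
      set_integrable lborel C (\<lambda>z. real_of_ereal (u z)))"

definition strongly_usc :: "(complex^'n) set \<Rightarrow> (complex^'n \<Rightarrow> ereal) \<Rightarrow> bool" where
  "strongly_usc \<Omega> u = (\<forall>z0\<in>\<Omega>. u z0 < \<infinity> \<and> Limsup (at z0) u \<le> u z0 \<and>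
      (\<forall>A. (\<exists>r>0. ball z0 r - A \<in> null_sets lborel) \<longrightarrow> Limsup (at z0 within A) u = u z0))"

definition alpha_sh :: "(complex^'n \<Rightarrow> 'n \<Rightarrow> 'n \<Rightarrow> complex) \<Rightarrow> (complex^'n) set \<Rightarrow> (complex^'n \<Rightarrow> ereal) \<Rightarrow> bool" where
  "alpha_sh a \<Omega> u = ((\<forall>z\<in>\<Omega>. u z = -\<infinity>) \<or>
      (L1_loc \<Omega> u \<and> strongly_usc \<Omega> u \<and>
       (\<forall>\<omega>. nonneg_test_fun \<Omega> \<omega> \<longrightarrow>
          integral\<^sup>L lborel (\<lambda>z. real_of_ereal (u z) * alpha_ddc a \<omega> z) \<ge> 0)))"

definition strictly_alpha_sh :: "(complex^'n \<Rightarrow> 'n \<Rightarrow> 'n \<Rightarrow> complex) \<Rightarrow> (complex^'n) set \<Rightarrow> (complex^'n \<Rightarrow> ereal) \<Rightarrow> bool" where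
  "strictly_alpha_sh a \<Omega> u = (\<forall>G. open G \<and> connected G \<and> G \<noteq> {} \<and> compact (closure G) \<and> closure G \<subseteq> \<Omega> \<longrightarrow>
      (\<exists>\<epsilon>>0. alpha_sh a G (\<lambda>z. u z - ereal (\<epsilon> * (norm z)\<^sup>2))))"

definition alpha_regular_domain :: "(complex^'n \<Rightarrow> 'n \<Rightarrow> 'n \<Rightarrow> complex) \<Rightarrow> (complex^'n) set \<Rightarrow> bool" where
  "alpha_regular_domain a D = (bounded D \<and> open D \<and> connected D \<and> D \<noteq> {} \<and>
     (\<exists>\<rho>. alpha_sh a D \<rho> \<and> (\<forall>z\<in>D. \<rho> z < 0) \<and>
        (\<forall>\<zeta>\<in>frontier D. (\<rho> \<longlongrightarrow> 0) (at \<zeta> within D))))"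

definition U_class :: "(complex^'n \<Rightarrow> 'n \<Rightarrow> 'n \<Rightarrow> complex) \<Rightarrow> (complex^'n) set \<Rightarrow> (complex^'n) set \<Rightarrow> (complex^'n \<Rightarrow> real) \<Rightarrow> (complex^'n \<Rightarrow> ereal) set" where
  "U_class a E D \<psi> = {u. alpha_sh a D u \<and> (\<forall>z\<in>D. u z < 0) \<and> (\<forall>z\<in>E. u z \<le> ereal (\<psi> z))}"

definition omega_alpha :: "(complex^'n \<Rightarrow> 'n \<Rightarrow> 'n \<Rightarrow> complex) \<Rightarrow> complex^'n \<Rightarrow> (complex^'n) set \<Rightarrow> (complex^'n) set \<Rightarrow> (complex^'n \<Rightarrow> real) \<Rightarrow> ereal" where
  "omega_alpha a z E D \<psi> = (SUP u\<in>U_class a E D \<psi>. u z)"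

definition omega_alpha_star :: "(complex^'n \<Rightarrow> 'n \<Rightarrow> 'n \<Rightarrow> complex) \<Rightarrow> complex^'n \<Rightarrow> (complex^'n) set \<Rightarrow> (complex^'n) set \<Rightarrow> (complex^'n \<Rightarrow> real) \<Rightarrow> ereal" where
  "omega_alpha_star a z E D \<psi> = Limsup (nhds z) (\<lambda>w. omega_alpha a w E D \<psi>)"

definition psi_regular_point :: "(complex^'n \<Rightarrow> 'n \<Rightarrow> 'n \<Rightarrow> complex) \<Rightarrow> complex^'n \<Rightarrow> (complex^'n) set \<Rightarrow> (complex^'n) set \<Rightarrow> (complex^'n \<Rightarrow> real) \<Rightarrow> bool" where
  "psi_regular_point a z0 K D \<psi> = (omega_alpha_star a z0 K D \<psi> = ereal (\<psi> z0))"

definition loc_psi_regular_point :: "(complex^'n \<Rightarrow> 'n \<Rightarrow> 'n \<Rightarrow> complex) \<Rightarrow> complex^'n \<Rightarrow> (complex^'n) set \<Rightarrow> (complex^'n) set \<Rightarrow> (complex^'n \<Rightarrow> real) \<Rightarrow> bool" where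
  "loc_psi_regular_point a z0 K D \<psi> = (\<forall>B. z0 \<in> interior B \<longrightarrow>
      omega_alpha_star a z0 (K \<inter> closure B) D \<psi> = ereal (\<psi> z0))"

definition loc_alpha_regular_point :: "(complex^'n \<Rightarrow> 'n \<Rightarrow> 'n \<Rightarrow> complex) \<Rightarrow> complex^'n \<Rightarrow> (complex^'n) set \<Rightarrow> (complex^'n) set \<Rightarrow> bool" where
  "loc_alpha_regular_point a z0 K D = (\<forall>B. z0 \<in> interior B \<and> B \<subseteq> D \<longrightarrow>
      omega_alpha_star a z0 (K \<inter> closure B) D (\<lambda>_. -1) = -1)"

end

theory Submission
  imports Defs "HOL-Computational_Algebra.Polynomial"
begin

text \<open>Part (1) only rescales: near \<open>z0\<close> the values of \<open>\<psi>\<close> are almost the constant \<open>\<psi> z0\<close>, so a positive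
  multiple of a competitor for one extremal function is a competitor for the other.

  For part (2), \<open>w = \<psi>' - \<epsilon> |z - z0|\<^sup>2\<close> is \<open>\<alpha>\<close>-subharmonic and lies strictly below \<open>\<psi>\<close> on the part of \<open>K\<close>
  away from \<open>z0\<close>. Hence for small \<open>\<eta>\<close> and every competitor \<open>u\<close> for the compact set near \<open>z0\<close>, the function
  \<open>(w + \<eta> u) / (1 + \<eta>)\<close>, regularised by its essential limsup, is a competitor for all of \<open>K\<close>, and regularity
  bounds it near \<open>z0\<close> almost everywhere by \<open>\<psi> z0 + \<delta>'\<close>. As \<open>w\<close> is only upper semicontinuous, this
  does not bound \<open>u\<close> pointwise; it does after averaging. A negative \<open>\<alpha>\<close>-subharmonic function is at most its
  mean against a bounded kernel that depends continuously on the centre and has total mass close to one at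
  small scales. Applying this to \<open>u\<close> at points tending to \<open>z0\<close>, and to \<open>w\<close> at \<open>z0\<close>, where
  \<open>w z0 = \<psi> z0\<close>, gives the bound for \<open>u\<close>.

  The mean value inequality comes from a Levi parametrix: test functions built from truncated fundamental
  solutions of the operator with coefficients frozen at the centre, corrected so that the error has the
  favourable sign away from the centre, where it can be discarded because the function is negative. Letting the
  inner truncation shrink gives the inequality at Lebesgue points.\<close>

subsection \<open>Smooth functions of one real variable\<close>

text \<open>The obstacle in part (2) is uniformity. The competitor \<open>u\<close> changes with the
  point tending to \<open>z0\<close>, so radii and constants are fixed before \<open>u\<close> is
  chosen and no limit is taken in an integral of \<open>u\<close>. This is why \<open>w\<close> and
  \<open>u\<close> are measured with the same kernel and the same factor: their integrals add up to
  one of \<open>w + \<eta> * u\<close>, which regularity bounds by a constant times the kernel mass.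
  What remains is the integral of \<open>w\<close> and the mass, both free of \<open>u\<close> and
  continuous in the centre, and these pass to the limit. The factor is not 1 but tends to 1 with the
  radius, which costs arbitrarily little. The mean inequalities hold only almost everywhere. Strong
  upper semicontinuity makes up for it: a level exceeded at a point is also exceeded at nearby
  points outside any null set. The constraint on \<open>K\<close> is pointwise and \<open>K\<close>
  may be null, so the regularised function has to lie below the sum at every point of
  \<open>D\<close>. Replacing \<open>|z|^2\<close> by \<open>|z - z0|^2\<close> adds an affine
  function, and affine functions are annihilated because the form is closed.\<close>

fun Ck_real :: "nat \<Rightarrow> real set \<Rightarrow> (real \<Rightarrow> real) \<Rightarrow> bool" where
  "Ck_real 0 S f = continuous_on S f"
| "Ck_real (Suc k) S f = ((\<forall>t\<in>S. f differentiable (at t)) \<and> Ck_real k S (deriv f))"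

lemma deriv_eq_on_open:
  fixes f g :: "real \<Rightarrow> real"
  assumes "open S" "t \<in> S" "\<And>t. t \<in> S \<Longrightarrow> f t = g t"
  shows "deriv f t = deriv g t"
proof (rule deriv_cong_ev)
  show "\<forall>\<^sub>F x in nhds t. f x = g x"
    using assms by (auto simp: eventually_nhds)
qed simp

lemma differentiable_eq_on_open:
  fixes f g :: "real \<Rightarrow> real"
  assumes "open S" "t \<in> S" "\<And>t. t \<in> S \<Longrightarrow> f t = g t" "f differentiable (at t)"
  shows "g differentiable (at t)"
proof -
  obtain D where "(f has_derivative D) (at t)" using assms by (auto simp: differentiable_def)
  then have "(g has_derivative D) (at t)"
    by (rule has_derivative_transform_within_open[OF _ assms(1,2)]) (use assms in auto)
  then show ?thesis by (auto simp: differentiable_def)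
qed

lemma Ck_real_cong:
  assumes "open S" "\<And>t. t \<in> S \<Longrightarrow> f t = g t" "Ck_real k S f"
  shows "Ck_real k S g"
  using assms(2,3)
proof (induction k arbitrary: f g)
  case 0
  then show ?case by (metis Ck_real.simps(1) continuous_on_cong)
next
  case (Suc k)
  have "g differentiable (at t)" if "t \<in> S" for t
    by (rule differentiable_eq_on_open[OF assms(1) that, of f]) (use Suc.prems that in auto)
  moreover have "Ck_real k S (deriv g)"
  proof (rule Suc.IH[of "deriv f"])
    show "deriv f t = deriv g t" if "t \<in> S" for t
      by (rule deriv_eq_on_open[OF assms(1) that]) (rule Suc.prems)
  qed (use Suc.prems in simp)
  ultimately show ?case by simp
qed

lemma Ck_real_imp_continuous: "Ck_real k S f \<Longrightarrow> continuous_on S f"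
  using continuous_at_imp_continuous_on[of S f] differentiable_imp_continuous_within[of f _ UNIV]
  by (cases k) auto

lemma Ck_real_Suc_D: "Ck_real (Suc k) S f \<Longrightarrow> Ck_real k S f"
proof (induction k arbitrary: f)
  case 0
  then show ?case using Ck_real_imp_continuous[OF 0] by simp
qed auto

lemma Ck_real_derivI:
  assumes "open S" "\<And>t. t \<in> S \<Longrightarrow> (f has_real_derivative f' t) (at t)" "Ck_real k S f'"
  shows "Ck_real (Suc k) S f"
proof -
  have "Ck_real k S (deriv f)"
    by (rule Ck_real_cong[OF assms(1) _ assms(3)]) (metis DERIV_imp_deriv assms(2))
  then show ?thesis using assms(2) real_differentiable_def by auto
qed

lemma Ck_real_Suc_has_deriv:
  assumes "Ck_real (Suc k) S f" "t \<in> S"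
  shows "(f has_real_derivative deriv f t) (at t)"
  using assms by (auto simp: DERIV_deriv_iff_real_differentiable)

lemma Ck_real_const [simp]: "Ck_real k S (\<lambda>_. c)"
  by (induction k arbitrary: c) (auto)

lemma Ck_real_ident: "open S \<Longrightarrow> Ck_real k S (\<lambda>t. t)"
  by (cases k) (auto intro: Ck_real_derivI[where f'="\<lambda>_. 1"] simp del: Ck_real.simps(2))

lemma Ck_real_add:
  assumes "open S" "Ck_real k S f" "Ck_real k S g"
  shows "Ck_real k S (\<lambda>t. f t + g t)"
  using assms(2,3)
proof (induction k arbitrary: f g)
  case (Suc k)
  show ?case
    by (rule Ck_real_derivI[OF assms(1), where f'="\<lambda>t. deriv f t + deriv g t"])
       (use Suc in \<open>auto intro!: DERIV_add simp: DERIV_deriv_iff_real_differentiable\<close>)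
qed (auto intro: continuous_on_add continuous_on_mult)

lemma Ck_real_mult:
  assumes "open S" "Ck_real k S f" "Ck_real k S g"
  shows "Ck_real k S (\<lambda>t. f t * g t)"
  using assms(2,3)
proof (induction k arbitrary: f g)
  case (Suc k)
  have "Ck_real k S (\<lambda>t. f t * deriv g t + deriv f t * g t)"
    using Suc Ck_real_Suc_D[OF Suc.prems(1)] Ck_real_Suc_D[OF Suc.prems(2)]
    by (intro Ck_real_add[OF assms(1)] Suc.IH) auto
  then show ?case
    by (rule Ck_real_derivI[OF assms(1), rotated])
       (use Suc.prems in \<open>auto intro!: DERIV_mult' simp: DERIV_deriv_iff_real_differentiable\<close>)
qed (auto intro: continuous_on_add continuous_on_mult)

lemma Ck_real_compose:
  assumes "open S" "open T" "Ck_real k S f" "Ck_real k T g" "\<And>t. t \<in> S \<Longrightarrow> f t \<in> T"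
  shows "Ck_real k S (\<lambda>t. g (f t))"
  using assms(3,4)
proof (induction k arbitrary: g)
  case 0
  then show ?case using continuous_on_compose2[of T g S f] assms(5) by auto
next
  case (Suc k)
  have f: "Ck_real k S f" using Ck_real_Suc_D[OF Suc.prems(1)] .
  have "Ck_real k S (\<lambda>t. deriv g (f t) * deriv f t)"
    by (intro Ck_real_mult[OF assms(1)] Suc.IH[OF f]) (use Suc.prems in simp_all)
  then show ?case
  proof (rule Ck_real_derivI[OF assms(1), rotated])
    fix t assume "t \<in> S"
    then show "((\<lambda>t. g (f t)) has_real_derivative deriv g (f t) * deriv f t) (at t)"
      using DERIV_chain2 Ck_real_Suc_has_deriv[OF Suc.prems(1)]
        Ck_real_Suc_has_deriv[OF Suc.prems(2)] assms(5) by blast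
  qed
qed

lemma Ck_real_Un:
  assumes "open S" "open T" "Ck_real k S f" "Ck_real k T f"
  shows "Ck_real k (S \<union> T) f"
  using assms(3,4)
  by (induction k arbitrary: f) (auto intro: continuous_on_open_Un assms)

lemma Ck_real_inverse: "0 \<notin> S \<Longrightarrow> open S \<Longrightarrow> Ck_real k S (\<lambda>t. inverse t)"
proof (induction k)
  case (Suc k)
  have "Ck_real k S (\<lambda>t. -1 * (inverse t * inverse t))"
    using Suc by (intro Ck_real_mult Ck_real_const) auto
  then show ?case
    by (rule Ck_real_derivI[OF Suc.prems(2), rotated])
       (use Suc.prems in \<open>auto intro!: derivative_eq_intros simp: power2_eq_square\<close>)
qed (auto intro!: continuous_on_inverse continuous_on_id continuous_on_real_sqrt)

lemma Ck_real_sqrt: "Ck_real k {0<..} sqrt"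
proof (induction k)
  case (Suc k)
  have "Ck_real k {0<..} (\<lambda>t. inverse 2 * inverse (sqrt t))"
    by (intro Ck_real_mult Ck_real_const Ck_real_compose[OF _ _ Suc Ck_real_inverse, where T="{0<..}"]) auto
  then show ?case
    by (rule Ck_real_derivI[OF open_greaterThan, rotated])
       (auto intro!: derivative_eq_intros simp: field_simps)
qed (auto intro!: continuous_on_inverse continuous_on_id continuous_on_real_sqrt)

lemma Ck_real_power: "open S \<Longrightarrow> Ck_real k S f \<Longrightarrow> Ck_real k S (\<lambda>t. f t ^ n)"
  by (induction n) (auto intro!: Ck_real_mult)

section \<open>Smooth cut-offs from the flat exponential\<close>

definition flat_exp :: "real poly \<Rightarrow> real \<Rightarrow> real" where
  "flat_exp p x = (if x > 0 then poly p (1/x) * exp (-1/x) else 0)"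

lemma poly_times_exp_minus_tendsto_0: "((\<lambda>s::real. poly p s * exp (-s)) \<longlongrightarrow> 0) at_top"
proof -
  have "((\<lambda>s::real. \<Sum>i\<le>degree p. coeff p i * (s ^ i / exp s)) \<longlongrightarrow> (\<Sum>i\<le>degree p. coeff p i * 0)) at_top"
    by (intro tendsto_sum tendsto_mult tendsto_const tendsto_power_div_exp_0)
  then show ?thesis
    by (simp add: poly_altdef sum_divide_distrib exp_minus divide_inverse sum_distrib_right mult.assoc)
qed

text \<open>Differentiating \<open>p(1/x) * exp(-1/x)\<close> gives
  \<open>x^(-2) * (p - p')(1/x) * exp(-1/x)\<close>, so the family indexed by polynomials is closed
  under differentiation; \<open>[:0,0,1:]\<close> is the factor \<open>x^(-2)\<close>. This closure
  turns smoothness into a plain induction.\<close>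

lemma flat_exp_deriv:
  "(flat_exp p has_real_derivative flat_exp ([:0,0,1:] * (p - pderiv p)) x) (at x)"
proof -
  consider "x > 0" | "x < 0" | "x = 0" by linarith
  then show ?thesis
  proof cases
    case 1
    have "((\<lambda>x. poly p (1/x) * exp (-1/x)) has_real_derivative
        flat_exp ([:0,0,1:] * (p - pderiv p)) x) (at x)"
      using 1 by (auto intro!: derivative_eq_intros poly_DERIV DERIV_chain2[OF poly_DERIV]
          simp: flat_exp_def field_simps power2_eq_square)
    then show ?thesis
      by (rule has_field_derivative_transform_within_open[where S="{0<..}"])
         (use 1 in \<open>auto simp: flat_exp_def\<close>)
  next
    case 2
    have "((\<lambda>x. 0) has_real_derivative flat_exp ([:0,0,1:] * (p - pderiv p)) x) (at x)"
      using 2 by (simp add: flat_exp_def)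
    then show ?thesis
      by (rule has_field_derivative_transform_within_open[where S="{..<0}"])
         (use 2 in \<open>auto simp: flat_exp_def\<close>)
  next
    case 3
    have "((\<lambda>h. flat_exp p h / h) \<longlongrightarrow> 0) (at 0)"
    proof (rule filterlim_split_at)
      have "((\<lambda>h::real. 0) \<longlongrightarrow> (0::real)) (at_left 0)" by simp
      then show "((\<lambda>h. flat_exp p h / h) \<longlongrightarrow> 0) (at_left 0)"
        by (rule Lim_transform_eventually) (auto simp: eventually_at_filter flat_exp_def)
      have "((\<lambda>h. poly ([:0,1:] * p) (inverse h) * exp (- inverse h)) \<longlongrightarrow> 0) (at_right 0)"
        using filterlim_compose[OF poly_times_exp_minus_tendsto_0 filterlim_inverse_at_top_right] .
      then show "((\<lambda>h. flat_exp p h / h) \<longlongrightarrow> 0) (at_right 0)"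
        by (rule Lim_transform_eventually)
           (auto simp: eventually_at_filter flat_exp_def field_simps)
    qed
    then show ?thesis using 3 by (simp add: DERIV_def flat_exp_def)
  qed
qed

lemma Ck_real_flat_exp: "Ck_real k UNIV (flat_exp p)"
proof (induction k arbitrary: p)
  case 0
  then show ?case by (auto intro!: DERIV_isCont flat_exp_deriv continuous_at_imp_continuous_on)
next
  case (Suc k)
  then show ?case by (intro Ck_real_derivI[OF _ flat_exp_deriv]) auto
qed

lemma continuous_has_antiderivative:
  fixes g :: "real \<Rightarrow> real"
  assumes "continuous_on UNIV g"
  obtains G where "\<And>t. (G has_real_derivative g t) (at t)"
proof -
  \<comment> \<open>For negative \<open>t\<close> the interval \<open>{0..t}\<close> is empty and
    its integral is 0, so that side needs its own signed formula.\<close>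
  define G where "G t = (if t \<ge> 0 then integral {0..t} g else - integral {t..0} g)" for t
  have int: "g integrable_on {a..b}" for a b
    using assms by (intro integrable_continuous_real) (auto intro: continuous_on_subset)
  have diff: "G t - G a = integral {a..t} g" if "a \<le> t" for a t
  proof -
    consider "0 \<le> a" | "a < 0" "0 \<le> t" | "t < 0" by linarith
    then show ?thesis
    proof cases
      case 1
      then show ?thesis using that Henstock_Kurzweil_Integration.integral_combine[of 0 a t g] int
        by (auto simp: G_def)
    next
      case 2
      then show ?thesis using that Henstock_Kurzweil_Integration.integral_combine[of a 0 t g] int
        by (auto simp: G_def)
    next
      case 3
      then show ?thesis using that Henstock_Kurzweil_Integration.integral_combine[of a t 0 g] int
        by (auto simp: G_def)
    qed
  qed
  have "(G has_real_derivative g t) (at t)" for t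
  proof -
    have "((\<lambda>u. integral {t-1..u} g) has_real_derivative g t) (at t within {t-1..t+1})"
      by (rule integral_has_real_derivative) (use assms in \<open>auto intro: continuous_on_subset\<close>)
    then have "((\<lambda>u. integral {t-1..u} g) has_real_derivative g t) (at t)"
      by (simp add: at_within_Icc_at)
    then have "((\<lambda>u. integral {t-1..u} g + G (t-1)) has_real_derivative g t) (at t)"
      by (auto intro!: derivative_eq_intros)
    then show ?thesis
    proof (rule has_field_derivative_transform_within_open[where S="{t-1<..}"])
      show "integral {t-1..u} g + G (t-1) = G u" if "u \<in> {t-1<..}" for u
        using diff[of "t-1" u] that by auto
    qed auto
  qed
  then show ?thesis using that by blast
qed

lemma smooth_step_exists:
  obtains S S' :: "real \<Rightarrow> real" and M where
    "\<And>k. Ck_real k UNIV S" "\<And>k. Ck_real k UNIV S'"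
    "\<And>t. (S has_real_derivative S' t) (at t)"
    "\<And>t. 0 \<le> S' t" "\<And>t. S' t \<le> M" "\<And>t. t \<le> 1 \<Longrightarrow> S' t = 0" "\<And>t. 2 \<le> t \<Longrightarrow> S' t = 0"
    "\<And>t. t \<le> 1 \<Longrightarrow> S t = 0" "\<And>t. 2 \<le> t \<Longrightarrow> S t = 1" "\<And>t. 0 \<le> S t" "\<And>t. S t \<le> 1"
    "0 < S' (3/2)" "0 < M"
proof -
  \<comment> \<open>A smooth bump, positive exactly between 1 and 2; \<open>S\<close> is its
    antiderivative normalised to rise from 0 to 1.\<close>
  define b where "b t = flat_exp 1 (t - 1) * flat_exp 1 (2 - t)" for t
  have aff: "Ck_real k UNIV (\<lambda>t. c * t + d)" for k c d
    by (intro Ck_real_add Ck_real_mult Ck_real_const Ck_real_ident) auto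
  have bs: "Ck_real k UNIV b" for k
  proof -
    have "Ck_real k UNIV (\<lambda>t. flat_exp 1 (1 * t + (-1)) * flat_exp 1 ((-1) * t + 2))"
      by (intro Ck_real_mult Ck_real_compose[OF _ _ aff Ck_real_flat_exp]) auto
    then show ?thesis by (simp add: b_def[abs_def])
  qed
  have bpos: "b t > 0" if "1 < t" "t < 2" for t using that by (simp add: b_def flat_exp_def)
  have b0: "b t = 0" if "t \<le> 1 \<or> 2 \<le> t" for t using that by (auto simp: b_def flat_exp_def)
  have bnn: "b t \<ge> 0" for t by (simp add: b_def flat_exp_def)
  have bc: "continuous_on UNIV b" using Ck_real_imp_continuous[OF bs[of 0]] .
  obtain G where G: "\<And>t. (G has_real_derivative b t) (at t)"
    using continuous_has_antiderivative[OF bc] by blast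
  have Gmono: "G s \<le> G t" if "s \<le> t" for s t
    using DERIV_nonneg_imp_nondecreasing[OF that, of G] G bnn by blast
  have contG: "continuous_on A G" for A
    using G by (auto intro!: continuous_at_imp_continuous_on DERIV_isCont)
  have "G 1 < G 2"
    by (rule DERIV_pos_imp_increasing_open) (use G bpos contG in auto)
  have G1: "G t = G 1" if "t \<le> 1" for t
  proof (cases "t < 1")
    case True
    show ?thesis
      by (rule DERIV_isconst_end[OF True contG, symmetric]) (use G b0 in \<open>metis less_imp_le\<close>)
  qed (use that in auto)
  have G2: "G t = G 2" if "2 \<le> t" for t
  proof (cases "2 < t")
    case True
    show ?thesis
      by (rule DERIV_isconst_end[OF True contG]) (use G b0 in \<open>metis less_imp_le\<close>)
  qed (use that in auto)
  define I where "I = G 2 - G 1"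
  have I: "I > 0" using \<open>G 1 < G 2\<close> by (simp add: I_def)
  define S where "S t = (G t - G 1) / I" for t
  define S' where "S' t = inverse I * b t" for t
  have S': "(S has_real_derivative S' t) (at t)" for t
    unfolding S_def S'_def using G[of t] I by (auto intro!: derivative_eq_intros simp: field_simps)
  have S's: "Ck_real k UNIV S'" for k
    unfolding S'_def by (intro Ck_real_mult Ck_real_const bs) auto
  have Ss: "Ck_real k UNIV S" for k
  proof (cases k)
    case 0
    then show ?thesis using S' by (auto intro!: continuous_at_imp_continuous_on DERIV_isCont)
  next
    case (Suc m)
    then show ?thesis using Ck_real_derivI[OF open_UNIV S' S's] by blast
  qed
  have "bounded (b ` {1..2})"
    by (intro compact_imp_bounded compact_continuous_image continuous_on_subset[OF bc]) auto
  then obtain M0 where M0: "\<forall>t\<in>{1..2}. \<bar>b t\<bar> \<le> M0" by (auto simp: bounded_iff)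
  have bM: "b t \<le> \<bar>M0\<bar>" for t
    using bspec[OF M0, of t] b0[of t] by (cases "t \<in> {1..2}") auto
  show ?thesis
  proof (rule that[of S S' "inverse I * (\<bar>M0\<bar> + 1)"])
    show "S' t \<le> inverse I * (\<bar>M0\<bar> + 1)" for t
      unfolding S'_def using I bM[of t] by (intro mult_left_mono) auto
    show "S t = 0" if "t \<le> 1" for t unfolding S_def G1[OF that] by simp
    show "S t = 1" if "2 \<le> t" for t unfolding S_def G2[OF that] using I by (simp add: I_def)
    show "0 \<le> S t" for t
      using Gmono[of 1 t] G1[of t] I by (cases "t \<le> 1") (simp_all add: S_def)
    show "S t \<le> 1" for t
      using Gmono[of t 2] G2[of t] I by (cases "t \<le> 2") (simp_all add: S_def I_def)
    show "0 < S' (3/2)" "0 < inverse I * (\<bar>M0\<bar> + 1)"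
      using bpos[of "3/2"] I by (simp_all add: S'_def)
    show "S' t = 0" if "t \<le> 1" for t using b0[of t] that by (simp add: S'_def)
    show "S' t = 0" if "2 \<le> t" for t using b0[of t] that by (simp add: S'_def)
    show "0 \<le> S' t" for t using bnn[of t] I by (simp add: S'_def)
  qed (use Ss S's S' in blast)+
qed

subsection \<open>Radial profiles\<close>

text \<open>One step function serves both scales: \<open>S (t / \<tau>\<^sup>2)\<close> switches the
  radial profile on and \<open>S (t / r\<^sup>2)\<close> switches it off. The derivative
  \<open>S'\<close> becomes the averaging kernel, which is why its bound \<open>M\<close>, its
  support and its positivity at one point are recorded.\<close>

locale smooth_step =
  fixes S S' :: "real \<Rightarrow> real" and M :: real
  assumes S_smooth: "\<And>k. Ck_real k UNIV S" and S'_smooth: "\<And>k. Ck_real k UNIV S'"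
    and S_deriv: "\<And>t. (S has_real_derivative S' t) (at t)"
    and S'_nonneg: "\<And>t. 0 \<le> S' t" and S'_le: "\<And>t. S' t \<le> M"
    and S'_0: "\<And>t. t \<le> 1 \<Longrightarrow> S' t = 0" and S'_2: "\<And>t. 2 \<le> t \<Longrightarrow> S' t = 0"
    and S_0: "\<And>t. t \<le> 1 \<Longrightarrow> S t = 0" and S_1: "\<And>t. 2 \<le> t \<Longrightarrow> S t = 1"
    and S_nonneg: "\<And>t. 0 \<le> S t" and S_le_1: "\<And>t. S t \<le> 1"
    and S'_pos: "0 < S' (3/2)" and M_pos: "0 < M"

lemma smooth_step_locale_exists: "\<exists>S S' M. smooth_step S S' M"
  by (rule smooth_step_exists, rule exI, rule exI, rule exI, unfold_locales) blast+

lemma outer_estimate: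
  fixes t \<alpha> \<beta> C1 C s s' E T r n :: real
  assumes t: "t > 0" and T: "T > 0" and C1: "C1 > 0" and n: "n \<ge> 0" and C: "C = 4 * (n + 1) * C1"
    and s: "0 \<le> s" "s \<le> 1" "0 \<le> s'" and E: "E = 1 - C * sqrt t"
    and r: "0 < r" "t \<le> 2 * r\<^sup>2" "C * sqrt 2 * r \<le> 1/2"
    and \<beta>: "\<bar>\<beta> - t\<bar> \<le> C1 * t * sqrt t" and \<alpha>: "\<bar>\<alpha> - n\<bar> \<le> C1 * sqrt t"
  shows "\<beta> * ((C / (2 * sqrt t) * (1 - s) + E * s') / T + n * E * (1 - s) / (T * t)) + \<alpha> * (- E * (1 - s) / T)
     \<ge> (1 - C1 * sqrt 2 * r) * (1 - C * sqrt 2 * r) * (s' * (t / T))"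
proof -
  define \<sigma> where "\<sigma> = sqrt t"
  have \<sigma>: "\<sigma> > 0" "t = \<sigma> * \<sigma>" using t by (auto simp: \<sigma>_def)
  have \<sigma>r: "\<sigma> \<le> sqrt 2 * r"
    unfolding \<sigma>_def using real_sqrt_le_mono[OF r(2)] r(1) by (simp add: real_sqrt_mult)
  have nC: "0 \<le> n * C1" using n C1 by simp
  have C0: "C > 0" "C1 \<le> C" using C C1 nC by (simp_all add: algebra_simps)
  have C\<sigma>: "C * \<sigma> \<le> C * sqrt 2 * r" using \<sigma>r C0 by simp
  have C1\<sigma>: "C1 * \<sigma> \<le> C1 * sqrt 2 * r" using \<sigma>r C1 by simp
  have "C1 * sqrt 2 * r \<le> C * sqrt 2 * r" using C0 r by simp
  then have half: "C * sqrt 2 * r \<le> 1/2" "C1 * sqrt 2 * r \<le> 1/2" "C * \<sigma> \<le> 1/2" "C1 * \<sigma> \<le> 1/2"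
    using r(3) C\<sigma> C1\<sigma> by linarith+
  have E01: "0 \<le> E" "E \<le> 1" "E \<ge> 1 - C * sqrt 2 * r"
    using E half C\<sigma> mult_pos_pos[OF C0(1) \<sigma>(1)] unfolding \<sigma>_def[symmetric] by linarith+
  have \<beta>1: "\<beta> \<ge> t * (1 - C1 * \<sigma>)" using \<beta> by (simp add: \<sigma>_def algebra_simps)
  have "\<bar>\<beta> / t - 1\<bar> \<le> C1 * \<sigma>"
  proof -
    have "\<beta> / t - 1 = (\<beta> - t) / t" using t by (simp add: field_simps)
    then have "\<bar>\<beta> / t - 1\<bar> = \<bar>\<beta> - t\<bar> / t" using t by (simp add: abs_divide)
    also have "\<dots> \<le> C1 * t * \<sigma> / t" using \<beta> t by (intro divide_right_mono) (auto simp: \<sigma>_def)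
    finally show ?thesis using t by simp
  qed
  then have "n * \<bar>\<beta> / t - 1\<bar> \<le> n * (C1 * \<sigma>)" using n by (rule mult_left_mono)
  moreover have "n * (\<beta> / t) - \<alpha> = n * (\<beta> / t - 1) + (n - \<alpha>)" by (simp add: algebra_simps)
  then have "\<bar>n * (\<beta> / t) - \<alpha>\<bar> \<le> \<bar>n * (\<beta> / t - 1)\<bar> + \<bar>n - \<alpha>\<bar>"
    using abs_triangle_ineq by metis
  moreover have "\<bar>n * (\<beta> / t - 1)\<bar> = n * \<bar>\<beta> / t - 1\<bar>" using n by (simp add: abs_mult)
  moreover have "\<bar>n - \<alpha>\<bar> \<le> C1 * \<sigma>" using \<alpha> by (simp add: \<sigma>_def abs_minus_commute)
  ultimately have "\<bar>n * (\<beta> / t) - \<alpha>\<bar> \<le> n * (C1 * \<sigma>) + C1 * \<sigma>"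
    by (metis add_mono order_trans)
  then have diff: "n * (\<beta> / t) - \<alpha> \<ge> - ((n + 1) * C1 * \<sigma>)" by (simp add: algebra_simps abs_le_iff)
  have d2: "(n * (\<beta> / t) - \<alpha>) * (E * (1 - s)) \<ge> - ((n + 1) * C1 * \<sigma>) * (1 - s)"
  proof -
    have "(n * (\<beta> / t) - \<alpha>) * (E * (1 - s)) \<ge> - ((n + 1) * C1 * \<sigma>) * (E * (1 - s))"
      using diff E01 s by (intro mult_right_mono) auto
    moreover have "((n + 1) * C1 * \<sigma>) * (E * (1 - s)) \<le> ((n + 1) * C1 * \<sigma>) * (1 * (1 - s))"
      using E01 s n C1 \<sigma> by (intro mult_left_mono mult_right_mono) auto
    ultimately show ?thesis unfolding mult_1_left mult_minus_left
      by (meson neg_le_iff_le order_trans)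
  qed
  have d1: "\<beta> * (C / (2 * \<sigma>) * (1 - s) + E * s') \<ge> t * (1 - C1 * \<sigma>) * (C / (2 * \<sigma>) * (1 - s) + E * s')"
    using \<beta>1 C0 \<sigma> s E01 by (intro mult_right_mono) auto
  \<comment> \<open>Here the 4 in \<open>C\<close> is used up: one factor 2 goes into the derivative
    of \<open>sqrt\<close>, the other into \<open>1 - C1 * \<sigma> \<ge> 1/2\<close>.\<close>
  have d3: "t * (1 - C1 * \<sigma>) * (C / (2 * \<sigma>) * (1 - s)) \<ge> (n + 1) * C1 * \<sigma> * (1 - s)"
  proof -
    have "t * (1 - C1 * \<sigma>) * (C / (2 * \<sigma>) * (1 - s)) = (1 - C1 * \<sigma>) * (\<sigma> * C / 2 * (1 - s))"
      using \<sigma> by (simp add: field_simps)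
    also have "\<dots> \<ge> (1/2) * (\<sigma> * C / 2 * (1 - s))"
      using half \<sigma> C0 s by (intro mult_right_mono) auto
    also have "(1/2) * (\<sigma> * C / 2 * (1 - s)) = (n + 1) * C1 * \<sigma> * (1 - s)" by (simp add: C field_simps)
    finally show ?thesis .
  qed
  have d4: "t * (1 - C1 * \<sigma>) * (E * s') \<ge> (1 - C1 * sqrt 2 * r) * (1 - C * sqrt 2 * r) * (s' * t)"
  proof -
    have "(1 - C1 * sqrt 2 * r) * (1 - C * sqrt 2 * r) \<le> (1 - C1 * \<sigma>) * E"
      using half E01 C1\<sigma> by (intro mult_mono) auto
    then have "(1 - C1 * sqrt 2 * r) * (1 - C * sqrt 2 * r) * (s' * t) \<le> (1 - C1 * \<sigma>) * E * (s' * t)"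
      using s t by (intro mult_right_mono) auto
    then show ?thesis by (simp add: algebra_simps)
  qed
  have "\<beta> * (C / (2 * \<sigma>) * (1 - s) + E * s') + (n * (\<beta> / t) - \<alpha>) * (E * (1 - s))
      \<ge> (1 - C1 * sqrt 2 * r) * (1 - C * sqrt 2 * r) * (s' * t)"
    using d1 d2 d3 d4 by (simp add: ring_distribs)
  then have "(\<beta> * (C / (2 * \<sigma>) * (1 - s) + E * s') + (n * (\<beta> / t) - \<alpha>) * (E * (1 - s))) / T
      \<ge> (1 - C1 * sqrt 2 * r) * (1 - C * sqrt 2 * r) * (s' * t) / T"
    using T by (intro divide_right_mono) auto
  moreover have "(\<beta> * (C / (2 * \<sigma>) * (1 - s) + E * s') + (n * (\<beta> / t) - \<alpha>) * (E * (1 - s))) / T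
     = \<beta> * ((C / (2 * sqrt t) * (1 - s) + E * s') / T + n * E * (1 - s) / (T * t)) + \<alpha> * (- E * (1 - s) / T)"
    unfolding \<sigma>_def using t T by (simp add: add_divide_distrib diff_divide_distrib ring_distribs mult_ac)
  ultimately show ?thesis by simp
qed

text \<open>Inside the inner truncation no sign is available, so the deviation from minus the small
  kernel is bounded in absolute value. Each of the three error terms carries one more factor
  \<open>sqrt t\<close> than the kernel itself, which makes the total error negligible when the
  truncation shrinks. The bound \<open>2 * M / t\<close> on \<open>s'\<close> expresses that the
  cut-off lives at scale \<open>t\<close>.\<close>

lemma core_estimate:
  fixes t \<alpha> \<beta> C1 C s s' E T \<tau> n M :: real
  assumes t: "t > 0" and T: "T > 0" and C1: "C1 > 0" and n: "n \<ge> 0" and C: "C = 4 * (n + 1) * C1"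
    and s: "0 \<le> s" "s \<le> 1" "0 \<le> s'" "s' \<le> 2 * M / t" and E: "E = 1 - C * sqrt t" and Ct: "C * sqrt t \<le> 1/2"
    and \<beta>: "\<bar>\<beta> - t\<bar> \<le> C1 * t * sqrt t" and \<alpha>: "\<bar>\<alpha> - n\<bar> \<le> C1 * sqrt t"
  shows "\<bar>\<beta> * ((C / (2 * sqrt t) * s - E * s') / T + n * E * s / (T * t)) + \<alpha> * (- E * s / T) + s' * (t / T)\<bar>
     \<le> (2 * M * (C1 + C) + 2 * C) * (sqrt t / T)"
proof -
  define \<sigma> where "\<sigma> = sqrt t"
  have \<sigma>: "\<sigma> > 0" "t = \<sigma> * \<sigma>" using t by (auto simp: \<sigma>_def)
  have nC: "0 \<le> n * C1" using n C1 by simp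
  have C0: "C > 0" "(n + 1) * C1 \<le> C" "C1 \<le> C" using C C1 nC by (simp_all add: algebra_simps)
  have "C1 * \<sigma> \<le> C * \<sigma>" using C0 \<sigma> by simp
  then have half: "C * \<sigma> \<le> 1/2" "C1 * \<sigma> \<le> 1/2" using Ct by (auto simp: \<sigma>_def)
  have E01: "0 \<le> E" "E \<le> 1" "\<bar>E - 1\<bar> \<le> C * \<sigma>"
    using E half mult_pos_pos[OF C0(1) \<sigma>(1)] unfolding \<sigma>_def[symmetric] by linarith+
  have bt: "\<bar>\<beta> / t - 1\<bar> \<le> C1 * \<sigma>"
  proof -
    have "\<beta> / t - 1 = (\<beta> - t) / t" using t by (simp add: field_simps)
    then have "\<bar>\<beta> / t - 1\<bar> = \<bar>\<beta> - t\<bar> / t" using t by (simp add: abs_divide)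
    also have "\<dots> \<le> C1 * t * \<sigma> / t" using \<beta> t by (intro divide_right_mono) (auto simp: \<sigma>_def)
    finally show ?thesis using t by simp
  qed
  then have "n * \<bar>\<beta> / t - 1\<bar> \<le> n * (C1 * \<sigma>)" using n by (rule mult_left_mono)
  moreover have "n * (\<beta> / t) - \<alpha> = n * (\<beta> / t - 1) + (n - \<alpha>)" by (simp add: algebra_simps)
  then have "\<bar>n * (\<beta> / t) - \<alpha>\<bar> \<le> \<bar>n * (\<beta> / t - 1)\<bar> + \<bar>n - \<alpha>\<bar>"
    using abs_triangle_ineq by metis
  moreover have "\<bar>n * (\<beta> / t - 1)\<bar> = n * \<bar>\<beta> / t - 1\<bar>" using n by (simp add: abs_mult)
  moreover have "\<bar>n - \<alpha>\<bar> \<le> C1 * \<sigma>" using \<alpha> by (simp add: \<sigma>_def abs_minus_commute)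
  ultimately have "\<bar>n * (\<beta> / t) - \<alpha>\<bar> \<le> n * (C1 * \<sigma>) + C1 * \<sigma>"
    by (metis add_mono order_trans)
  also have "\<dots> = (n + 1) * C1 * \<sigma>" by (simp add: algebra_simps)
  also have "\<dots> \<le> C * \<sigma>" using C0 \<sigma> by simp
  finally have diff: "\<bar>n * (\<beta> / t) - \<alpha>\<bar> \<le> C * \<sigma>" .
  have e1: "\<bar>(n * (\<beta> / t) - \<alpha>) * (E * s)\<bar> \<le> C * \<sigma>"
  proof -
    have "\<bar>(n * (\<beta> / t) - \<alpha>) * (E * s)\<bar> \<le> (C * \<sigma>) * (1 * 1)"
      unfolding abs_mult using diff E01 s by (intro mult_mono) auto
    then show ?thesis by simp
  qed
  have "(\<beta> / t) * E - 1 = (\<beta> / t - 1) * E + (E - 1)" by (simp add: algebra_simps)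
  moreover have "\<bar>(\<beta> / t - 1) * E\<bar> \<le> (C1 * \<sigma>) * 1"
    unfolding abs_mult using bt E01 C1 \<sigma> by (intro mult_mono) auto
  ultimately have "\<bar>(\<beta> / t) * E - 1\<bar> \<le> (C1 + C) * \<sigma>" using E01 by (simp add: algebra_simps)
  moreover have "\<bar>s' * t\<bar> \<le> 2 * M" using s t by (simp add: field_simps)
  ultimately have "\<bar>((\<beta> / t) * E - 1) * (s' * t)\<bar> \<le> ((C1 + C) * \<sigma>) * (2 * M)"
    unfolding abs_mult[of "(\<beta> / t) * E - 1"] using C1 C0 \<sigma> by (intro mult_mono) auto
  moreover have "s' * t - \<beta> * (E * s') = - (((\<beta> / t) * E - 1) * (s' * t))"
    using t by (simp add: field_simps)
  ultimately have e2: "\<bar>s' * t - \<beta> * (E * s')\<bar> \<le> 2 * M * (C1 + C) * \<sigma>"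
    by (simp only: abs_minus_cancel) (simp add: mult_ac)
  have e3: "\<bar>\<beta> * (C / (2 * \<sigma>) * s)\<bar> \<le> C * \<sigma>"
  proof -
    have "\<bar>\<beta> / t\<bar> \<le> 2" using bt half by linarith
    then have "\<bar>\<beta>\<bar> \<le> 2 * t" using t by (simp add: field_simps)
    then have "\<bar>\<beta> * (C / (2 * \<sigma>) * s)\<bar> \<le> (2 * t) * (C / (2 * \<sigma>) * 1)"
      unfolding abs_mult using s C0 \<sigma> by (intro mult_mono) auto
    also have "\<dots> = C * \<sigma>" using \<sigma> by (simp add: field_simps)
    finally show ?thesis .
  qed
  have "\<bar>\<beta> * (C / (2 * \<sigma>) * s) + (n * (\<beta> / t) - \<alpha>) * (E * s) + (s' * t - \<beta> * (E * s'))\<bar>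
      \<le> C * \<sigma> + C * \<sigma> + 2 * M * (C1 + C) * \<sigma>"
    by (rule order_trans[OF abs_triangle_ineq add_mono[OF order_trans[OF abs_triangle_ineq add_mono[OF e3 e1]] e2]])
  also have "\<dots> = (2 * M * (C1 + C) + 2 * C) * \<sigma>" by (simp add: algebra_simps)
  finally have "\<bar>\<beta> * (C / (2 * \<sigma>) * s) + (n * (\<beta> / t) - \<alpha>) * (E * s) + (s' * t - \<beta> * (E * s'))\<bar> / T
      \<le> (2 * M * (C1 + C) + 2 * C) * \<sigma> / T"
    using T by (intro divide_right_mono) auto
  moreover have "\<beta> * ((C / (2 * sqrt t) * s - E * s') / T + n * E * s / (T * t)) + \<alpha> * (- E * s / T) + s' * (t / T)
    = (\<beta> * (C / (2 * \<sigma>) * s) + (n * (\<beta> / t) - \<alpha>) * (E * s) + (s' * t - \<beta> * (E * s'))) / T"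
    unfolding \<sigma>_def using t T by (simp add: add_divide_distrib diff_divide_distrib ring_distribs mult_ac)
  ultimately show ?thesis using T by (simp add: \<sigma>_def)
qed

context smooth_step begin

definition radial_kernel :: "nat \<Rightarrow> real \<Rightarrow> real \<Rightarrow> real" where
  "radial_kernel n r t = S' (t / r\<^sup>2) / r\<^sup>2 * (t / t ^ n)"

text \<open>With \<open>t\<close> the value of the quadratic form, the operator with frozen coefficients acts on \<open>h(t)\<close> as
  \<open>t h'' + n h' = - t m' / t\<^sup>n\<close>, where \<open>h' = - m / t\<^sup>n\<close>. Unfreezing costs an error of relative size
  \<open>sqrt t\<close>, and the factor \<open>1 - C sqrt t\<close> in \<open>m\<close> makes \<open>m\<close> decrease fast enough to absorb it.\<close>

lemma radial_profile:
  fixes C1 \<tau> r :: real and n :: nat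
  assumes C1: "C1 > 0" and \<tau>: "0 < \<tau>" "2 * \<tau>\<^sup>2 \<le> r\<^sup>2" and r: "0 < r"
  defines "C \<equiv> 4 * (real n + 1) * C1"
  assumes Cr: "C * sqrt 2 * r \<le> 1/2"
  obtains h h' h'' :: "real \<Rightarrow> real" where
    "\<And>t. (h has_real_derivative h' t) (at t)" "\<And>t. (h' has_real_derivative h'' t) (at t)"
    "\<And>k. Ck_real k UNIV h" "\<And>t. 0 \<le> h t" "\<And>t. 2 * r\<^sup>2 \<le> t \<Longrightarrow> h t = 0"
    "\<And>t \<alpha> \<beta>. 2 * \<tau>\<^sup>2 \<le> t \<Longrightarrow> (t \<le> 2 * r\<^sup>2 \<longrightarrow> \<bar>\<beta> - t\<bar> \<le> C1 * t * sqrt t) \<Longrightarrow> (t \<le> 2 * r\<^sup>2 \<longrightarrow> \<bar>\<alpha> - real n\<bar> \<le> C1 * sqrt t) \<Longrightarrow>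
       \<beta> * h'' t + \<alpha> * h' t \<ge> (1 - C1 * sqrt 2 * r) * (1 - C * sqrt 2 * r) * radial_kernel n r t"
    "\<And>t \<alpha> \<beta>. t \<le> 2 * \<tau>\<^sup>2 \<Longrightarrow> \<bar>\<beta> - t\<bar> \<le> C1 * t * sqrt t \<Longrightarrow> \<bar>\<alpha> - real n\<bar> \<le> C1 * sqrt t \<Longrightarrow>
       \<bar>\<beta> * h'' t + \<alpha> * h' t + radial_kernel n \<tau> t\<bar> \<le> 2 * (2 * M * (C1 + C) + 2 * C) * (\<tau> / \<tau> ^ (2 * n))"
proof -
  define E where "E t = 1 - C * sqrt t" for t
  define s where "s t = S (t / r\<^sup>2)" for t
  define s' where "s' t = S' (t / r\<^sup>2) / r\<^sup>2" for t
  define \<theta> where "\<theta> t = S (t / \<tau>\<^sup>2)" for t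
  define \<theta>' where "\<theta>' t = S' (t / \<tau>\<^sup>2) / \<tau>\<^sup>2" for t
  define m where "m t = \<theta> t * (E t * (1 - s t))" for t
  define m' where "m' t = \<theta>' t * (E t * (1 - s t)) + \<theta> t * (- C / (2 * sqrt t) * (1 - s t) - E t * s' t)" for t
  define p where "p t = m t / t ^ n" for t
  define p' where "p' t = m' t / t ^ n - n * m t / (t ^ n * t)" for t
  have C0: "C > 0" using C1 by (simp add: C_def)
  have s_d: "(s has_real_derivative s' t) (at t)" for t
    unfolding s_def s'_def
    by (rule DERIV_cong[OF DERIV_chain2[OF S_deriv DERIV_cdivide[OF DERIV_ident]]]) simp
  have \<theta>_d: "(\<theta> has_real_derivative \<theta>' t) (at t)" for t
    unfolding \<theta>_def \<theta>'_def
    by (rule DERIV_cong[OF DERIV_chain2[OF S_deriv DERIV_cdivide[OF DERIV_ident]]]) simp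
  have E_d: "(E has_real_derivative - C / (2 * sqrt t)) (at t)" if "t > 0" for t
    unfolding E_def using that by (auto intro!: derivative_eq_intros simp: field_simps)
  have m_d: "(m has_real_derivative m' t) (at t)" if "t > 0" for t
    unfolding m_def m'_def
    by (rule derivative_eq_intros s_d \<theta>_d E_d[OF that] refl)+ (simp add: algebra_simps)
  have p_d: "(p has_real_derivative p' t) (at t)" if "t > 0" for t
  proof -
    have "((\<lambda>t. m t / t ^ n) has_real_derivative (m' t * t ^ n - m t * (real n * t ^ (n - 1))) / (t ^ n * t ^ n)) (at t)"
      using that by (intro DERIV_divide m_d) (auto intro!: derivative_eq_intros)
    moreover have "(m' t * t ^ n - m t * (real n * t ^ (n - 1))) / (t ^ n * t ^ n) = p' t"
      using that by (cases n) (auto simp: p'_def field_simps)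
    ultimately show ?thesis by (simp add: p_def[abs_def])
  qed
  have \<theta>0: "\<theta> t = 0" if "t \<le> \<tau>\<^sup>2" for t
    unfolding \<theta>_def using that \<tau> by (intro S_0) (simp add: field_simps)
  have \<theta>'0: "\<theta>' t = 0" if "t \<le> \<tau>\<^sup>2" for t
    unfolding \<theta>'_def using that \<tau> S'_0[of "t / \<tau>\<^sup>2"] by (simp add: field_simps)
  have p0: "p t = 0" if "t \<le> \<tau>\<^sup>2" for t using \<theta>0[OF that] by (simp add: p_def m_def)
  have p'0: "p' t = 0" if "t \<le> \<tau>\<^sup>2" for t using \<theta>0[OF that] \<theta>'0[OF that] by (simp add: p'_def m_def m'_def)
  have p_d': "(p has_real_derivative p' t) (at t)" for t
  proof (cases "t > 0")
    case False
    then have t: "t < \<tau>\<^sup>2" using \<tau> by (smt (verit) zero_less_power2)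
    have "((\<lambda>t. 0) has_real_derivative p' t) (at t)" using p'0 t by simp
    then show ?thesis
      by (rule has_field_derivative_transform_within_open[where S="{..<\<tau>\<^sup>2}"]) (use t p0 in auto)
  qed (rule p_d)
  \<comment> \<open>\<open>sqrt\<close> and the power of \<open>inverse t\<close> are smooth only
    for positive \<open>t\<close>, but below \<open>\<tau>\<^sup>2\<close> the cut-off
    \<open>\<theta>\<close> makes \<open>p\<close> vanish; the two overlapping open half-lines cover
    everything.\<close>
  have p_smooth: "Ck_real k UNIV p" for k
  proof -
    have lin: "Ck_real k {0<..} (\<lambda>t. t * c)" for c
      by (intro Ck_real_mult Ck_real_ident Ck_real_const) auto
    have Sc: "Ck_real k {0<..} (\<lambda>t. S (t * c))" for c
      by (rule Ck_real_compose[OF _ _ lin S_smooth]) auto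
    have "Ck_real k {0<..} (\<lambda>t. S (t * inverse (\<tau>\<^sup>2)) * ((1 + (- C) * sqrt t) * (1 + (-1) * S (t * inverse (r\<^sup>2)))) * inverse t ^ n)"
      by (intro Ck_real_mult Ck_real_add Ck_real_const Ck_real_sqrt Ck_real_power Ck_real_inverse Sc) auto
    then have "Ck_real k {0<..} p"
      by (rule Ck_real_cong[rotated 2])
         (auto simp: p_def m_def \<theta>_def s_def E_def field_simps)
    moreover have "Ck_real k {..<\<tau>\<^sup>2} p"
      by (rule Ck_real_cong[where f="\<lambda>_. 0"]) (auto simp: p0)
    ultimately have "Ck_real k ({0<..} \<union> {..<\<tau>\<^sup>2}) p" by (intro Ck_real_Un) auto
    moreover have "{0<..} \<union> {..<\<tau>\<^sup>2} = (UNIV :: real set)"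
      using \<tau> by (auto simp: not_less) (smt (verit) zero_less_power2)
    ultimately show ?thesis by simp
  qed
  have s1: "s t = 1" "s' t = 0" if "2 * r\<^sup>2 \<le> t" for t
    using that r S_1[of "t / r\<^sup>2"] S'_2[of "t / r\<^sup>2"] by (auto simp: s_def s'_def pos_le_divide_eq)
  have pr: "p t = 0" "p' t = 0" if "2 * r\<^sup>2 \<le> t" for t
    using s1[OF that] by (auto simp: p_def p'_def m_def m'_def)
  have sqrtr: "sqrt t \<le> sqrt 2 * r" if "t \<le> 2 * r\<^sup>2" for t
    using real_sqrt_le_mono[OF that] r by (simp add: real_sqrt_mult)
  have C\<sigma>: "C * sqrt t \<le> 1/2" if "t \<le> 2 * r\<^sup>2" for t
    using mult_left_mono[OF sqrtr[OF that] less_imp_le[OF C0]] Cr by (simp only: mult.assoc)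
  have p_nonneg: "p t \<ge> 0" for t
  proof -
    consider "t \<le> \<tau>\<^sup>2" | "2 * r\<^sup>2 \<le> t" | "\<tau>\<^sup>2 < t" "t < 2 * r\<^sup>2" by linarith
    then show ?thesis
    proof cases
      case 3
      moreover have "t > 0" using 3 \<tau> by (smt (verit) zero_less_power2)
      moreover have "E t \<ge> 0" using C\<sigma>[of t] 3 by (simp add: E_def)
      ultimately show ?thesis
        unfolding p_def m_def \<theta>_def s_def by (intro divide_nonneg_nonneg mult_nonneg_nonneg S_nonneg)
          (auto simp: S_le_1)
    qed (auto simp: p0 pr)
  qed
  obtain G where G: "\<And>t. (G has_real_derivative p t) (at t)"
    using continuous_has_antiderivative[OF Ck_real_imp_continuous[OF p_smooth[of 0]]] by blast
  have contG: "continuous_on A G" for A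
    using G by (auto intro!: continuous_at_imp_continuous_on DERIV_isCont)
  \<comment> \<open>The constant of integration is chosen so that \<open>h\<close> vanishes from
    \<open>2 * r\<^sup>2\<close> on. Below \<open>\<tau>\<^sup>2\<close> the profile is constant:
    this is the truncated fundamental solution.\<close>
  define h where "h t = G (2 * r\<^sup>2) - G t" for t
  have h_d: "(h has_real_derivative - p t) (at t)" for t
    unfolding h_def by (auto intro!: derivative_eq_intros G)
  have h0: "h t = 0" if "2 * r\<^sup>2 \<le> t" for t
  proof (cases "2 * r\<^sup>2 < t")
    case True
    have "G (2 * r\<^sup>2) = G t"
      by (rule DERIV_isconst_end[OF True contG, symmetric]) (metis G pr(1) less_imp_le)
    then show ?thesis by (simp add: h_def)
  qed (use that in \<open>simp add: h_def\<close>)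
  have h_smooth: "Ck_real k UNIV h" for k
  proof -
    have "Ck_real k UNIV (\<lambda>t. (-1) * p t)" by (intro Ck_real_mult Ck_real_const p_smooth) auto
    then have "Ck_real (Suc k) UNIV h"
      by (intro Ck_real_derivI[OF open_UNIV h_d]) simp
    then show ?thesis by (rule Ck_real_Suc_D)
  qed
  show ?thesis
  proof (rule that[of h "\<lambda>t. - p t" "\<lambda>t. - p' t"])
    show "((\<lambda>t. - p t) has_real_derivative - p' t) (at t)" for t
      by (auto intro!: derivative_eq_intros p_d')
    show "0 \<le> h t" for t
    proof (cases "t \<le> 2 * r\<^sup>2")
      case True
      then have "G t \<le> G (2 * r\<^sup>2)"
        using DERIV_nonneg_imp_nondecreasing[OF True, of G] G p_nonneg by blast
      then show ?thesis by (simp add: h_def)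
    qed (use h0 in simp)
  next
    fix t \<alpha> \<beta> :: real
    assume t: "2 * \<tau>\<^sup>2 \<le> t" and ab: "t \<le> 2 * r\<^sup>2 \<longrightarrow> \<bar>\<beta> - t\<bar> \<le> C1 * t * sqrt t" "t \<le> 2 * r\<^sup>2 \<longrightarrow> \<bar>\<alpha> - real n\<bar> \<le> C1 * sqrt t"
    show "(1 - C1 * sqrt 2 * r) * (1 - C * sqrt 2 * r) * radial_kernel n r t \<le> \<beta> * - p' t + \<alpha> * - p t"
    proof (cases "t \<le> 2 * r\<^sup>2")
      case False
      then have "radial_kernel n r t = 0" using s1(2)[of t] by (auto simp: radial_kernel_def s'_def)
      then show ?thesis using pr[of t] False by simp
    next
      case True
      have t0: "t > 0" using t \<tau> by (smt (verit) zero_less_power2)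
      have th: "\<theta> t = 1" "\<theta>' t = 0"
        using t \<tau> S_1[of "t / \<tau>\<^sup>2"] S'_2[of "t / \<tau>\<^sup>2"] by (auto simp: \<theta>_def \<theta>'_def pos_le_divide_eq)
      have s'n: "0 \<le> s' t" using S'_nonneg by (simp add: s'_def)
      have "\<beta> * ((C / (2 * sqrt t) * (1 - s t) + E t * s' t) / t ^ n + real n * E t * (1 - s t) / (t ^ n * t)) + \<alpha> * (- E t * (1 - s t) / t ^ n)
        \<ge> (1 - C1 * sqrt 2 * r) * (1 - C * sqrt 2 * r) * (s' t * (t / t ^ n))"
        by (rule outer_estimate[OF t0 _ C1 _ meta_eq_to_obj_eq[OF C_def] _ _ s'n E_def r True Cr mp[OF ab(1) True] mp[OF ab(2) True]])
           (use t0 True S_nonneg S_le_1 in \<open>auto simp: s_def E_def\<close>)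
      moreover have "s' t * (t / t ^ n) = radial_kernel n r t" by (simp add: radial_kernel_def s'_def)
      moreover have "(C / (2 * sqrt t) * (1 - s t) + E t * s' t) / t ^ n + real n * E t * (1 - s t) / (t ^ n * t) = - p' t"
        "- E t * (1 - s t) / t ^ n = - p t"
        using t0 by (simp_all add: p'_def p_def m_def m'_def th field_simps)
      ultimately show ?thesis by metis
    qed
  next
    fix t \<alpha> \<beta> :: real
    assume t: "t \<le> 2 * \<tau>\<^sup>2" and ab: "\<bar>\<beta> - t\<bar> \<le> C1 * t * sqrt t" "\<bar>\<alpha> - real n\<bar> \<le> C1 * sqrt t"
    let ?K = "2 * M * (C1 + C) + 2 * C"
    have K: "?K \<ge> 0" using M_pos C0 C1 by simp
    show "\<bar>\<beta> * - p' t + \<alpha> * - p t + radial_kernel n \<tau> t\<bar> \<le> 2 * ?K * (\<tau> / \<tau> ^ (2 * n))"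
    proof (cases "t \<le> \<tau>\<^sup>2")
      case True
      then have "radial_kernel n \<tau> t = 0" using \<theta>'0[of t] by (auto simp: radial_kernel_def \<theta>'_def)
      then show ?thesis using p0[of t] p'0[of t] True K \<tau> by simp
    next
      case False
      then have t0: "t > 0" using \<tau> by (smt (verit) zero_less_power2)
      \<comment> \<open>The two cut-offs act on disjoint ranges:
        \<open>t \<le> 2 * \<tau>\<^sup>2 \<le> r\<^sup>2\<close>, where the outer one has not
        started.\<close>
      have st: "s t = 0" "s' t = 0"
        using t \<tau> r S_0[of "t / r\<^sup>2"] S'_0[of "t / r\<^sup>2"] by (auto simp: s_def s'_def pos_divide_le_eq)
      have tr: "t \<le> 2 * r\<^sup>2" using t \<tau> by (smt (verit) zero_le_power2)
      have thn: "0 \<le> \<theta>' t" using S'_nonneg by (simp add: \<theta>'_def)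
      have "\<theta>' t \<le> M / \<tau>\<^sup>2" unfolding \<theta>'_def using S'_le by (intro divide_right_mono) auto
      also have "\<dots> \<le> 2 * M / t" using t0 t \<tau> M_pos by (simp add: field_simps)
      finally have thM: "\<theta>' t \<le> 2 * M / t" .
      have main: "\<bar>\<beta> * ((C / (2 * sqrt t) * \<theta> t - E t * \<theta>' t) / t ^ n + real n * E t * \<theta> t / (t ^ n * t)) + \<alpha> * (- E t * \<theta> t / t ^ n) + \<theta>' t * (t / t ^ n)\<bar>
         \<le> ?K * (sqrt t / t ^ n)"
        by (rule core_estimate[OF t0 _ C1 _ meta_eq_to_obj_eq[OF C_def] _ _ thn thM E_def C\<sigma>[OF tr] ab])
           (use t0 S_nonneg S_le_1 in \<open>auto simp: \<theta>_def E_def\<close>)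
      have k1: "\<theta>' t * (t / t ^ n) = radial_kernel n \<tau> t" by (simp add: radial_kernel_def \<theta>'_def)
      have k2: "(C / (2 * sqrt t) * \<theta> t - E t * \<theta>' t) / t ^ n + real n * E t * \<theta> t / (t ^ n * t) = - p' t"
        and k3: "- E t * \<theta> t / t ^ n = - p t"
        by (simp_all add: p'_def p_def m_def m'_def st add_divide_distrib diff_divide_distrib mult_ac)
      have "\<bar>\<beta> * - p' t + \<alpha> * - p t + radial_kernel n \<tau> t\<bar> \<le> ?K * (sqrt t / t ^ n)" by (rule main[unfolded k1 k2 k3])
      also have "\<dots> \<le> ?K * (2 * \<tau> / \<tau> ^ (2 * n))"
      proof (intro mult_left_mono frac_le K)
        have "t \<le> 4 * \<tau>\<^sup>2" using t zero_le_power2[of \<tau>] by linarith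
        then have "sqrt t \<le> sqrt (4 * \<tau>\<^sup>2)" by (rule real_sqrt_le_mono)
        then show "sqrt t \<le> 2 * \<tau>" using \<tau> by (simp add: real_sqrt_mult)
        show "\<tau> ^ (2 * n) \<le> t ^ n" unfolding power_mult using False by (intro power_mono) auto
      qed (use \<tau> in auto)
      finally show ?thesis by (simp add: mult_ac)
    qed
  qed (use h_d h_smooth h0 in blast)+
qed

end

subsection \<open>Smooth functions of several complex variables\<close>

lemma real_pderiv_eq: "(f has_derivative f') (at z) \<Longrightarrow> real_pderiv f z v = f' v"
  by (simp add: real_pderiv_def frechet_derivative_at[symmetric])

lemma Ck_on_SucI:
  assumes "\<And>z. (f has_derivative f' z) (at z)" "\<And>v. Ck_on k UNIV (\<lambda>z. f' z v)"
  shows "Ck_on (Suc k) UNIV f"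
proof -
  have "f differentiable_on UNIV"
    using assms(1) by (auto simp: differentiable_on_def differentiable_def)
  moreover have "(\<lambda>z. real_pderiv f z v) = (\<lambda>z. f' z v)" for v
    using real_pderiv_eq[OF assms(1)] by auto
  ultimately show ?thesis using assms(2) by (auto intro: differentiable_imp_continuous_on)
qed

lemma Ck_on_Suc_has_derivative:
  assumes "Ck_on (Suc k) UNIV f"
  shows "(f has_derivative real_pderiv f z) (at z)" "Ck_on k UNIV (\<lambda>z. real_pderiv f z v)"
proof -
  have "f differentiable (at z)" using assms by (auto simp: differentiable_on_def)
  then show "(f has_derivative real_pderiv f z) (at z)"
    unfolding real_pderiv_def[abs_def] frechet_derivative_works by simp
qed (use assms in auto)

lemma Ck_on_imp_continuous: "Ck_on k S f \<Longrightarrow> continuous_on S f"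
  by (cases k) auto

lemma Ck_on_Suc_D: "Ck_on (Suc k) S f \<Longrightarrow> Ck_on k S f"
proof (induction k arbitrary: f)
  case (Suc k)
  have "Ck_on (Suc k) S (\<lambda>z. real_pderiv f z v)" for v using Suc.prems by simp
  then have "Ck_on k S (\<lambda>z. real_pderiv f z v)" for v by (rule Suc.IH)
  then show ?case using Suc.prems by simp
qed simp

lemma Ck_on_const: "Ck_on k UNIV (\<lambda>_. c)"
proof (induction k arbitrary: c)
  case (Suc k)
  then show ?case by (intro Ck_on_SucI[where f'="\<lambda>z v. 0"]) auto
qed simp

lemma Ck_on_affine:
  fixes L :: "complex^'n \<Rightarrow> 'b::real_normed_vector"
  assumes "bounded_linear L"
  shows "Ck_on k UNIV (\<lambda>z. L (z - c))"
proof (cases k)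
  case 0
  then show ?thesis by (auto intro!: bounded_linear.continuous_on[OF assms] continuous_intros)
next
  case (Suc m)
  have "((\<lambda>z. L (z - c)) has_derivative L) (at z)" for z
    by (rule bounded_linear.has_derivative[OF assms, THEN has_derivative_eq_rhs])
       (auto intro!: derivative_eq_intros)
  then show ?thesis unfolding Suc by (intro Ck_on_SucI) (auto intro: Ck_on_const)
qed

lemma Ck_on_add:
  "Ck_on k UNIV f \<Longrightarrow> Ck_on k UNIV g \<Longrightarrow> Ck_on k UNIV (\<lambda>z. f z + g z)"
proof (induction k arbitrary: f g)
  case (Suc k)
  note Suc_deriv = Ck_on_Suc_has_derivative[OF Suc.prems(1)] Ck_on_Suc_has_derivative[OF Suc.prems(2)]
  show ?case
    by (rule Ck_on_SucI[OF has_derivative_add[OF Suc_deriv(1) Suc_deriv(3)]])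
       (rule Suc.IH[OF Suc_deriv(2,4)])
qed (auto intro: continuous_on_add)

lemma Ck_on_mult:
  fixes f g :: "complex^'n \<Rightarrow> 'b::real_normed_algebra"
  shows "Ck_on k UNIV f \<Longrightarrow> Ck_on k UNIV g \<Longrightarrow> Ck_on k UNIV (\<lambda>z. f z * g z)"
proof (induction k arbitrary: f g)
  case (Suc k)
  note Suc_deriv = Ck_on_Suc_has_derivative[OF Suc.prems(1)] Ck_on_Suc_has_derivative[OF Suc.prems(2)]
  show ?case
    by (rule Ck_on_SucI[OF has_derivative_mult[OF Suc_deriv(1) Suc_deriv(3)]])
       (rule Ck_on_add[OF Suc.IH[OF Ck_on_Suc_D[OF Suc.prems(1)] Suc_deriv(4)]
          Suc.IH[OF Suc_deriv(2) Ck_on_Suc_D[OF Suc.prems(2)]]])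
qed (auto intro: continuous_on_mult)

text \<open>Lifts the smoothness of a radial profile to a function of several complex variables
  through the quadratic form.\<close>

lemma Ck_on_compose_real:
  fixes q :: "complex^'n \<Rightarrow> real"
  assumes "Ck_on k UNIV q"
  shows "Ck_real k UNIV h \<Longrightarrow> Ck_on k UNIV (\<lambda>z. h (q z))"
  using assms
proof (induction k arbitrary: h)
  case 0
  then show ?case by (auto intro: continuous_on_compose2)
next
  case (Suc k)
  note q = Ck_on_Suc_has_derivative[OF Suc.prems(2)]
  have h: "(h has_derivative (\<lambda>s. s * deriv h t)) (at t)" for t
    using Ck_real_Suc_has_deriv[OF Suc.prems(1)]
    by (simp add: has_field_derivative_def mult_commute_abs)
  show ?case
  proof (rule Ck_on_SucI)
    show "((\<lambda>z. h (q z)) has_derivative (\<lambda>v. real_pderiv q z v * deriv h (q z))) (at z)" for z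
      using has_derivative_compose[OF q(1) h] .
    show "Ck_on k UNIV (\<lambda>z. real_pderiv q z v * deriv h (q z))" for v
      by (rule Ck_on_mult[OF q(2) Suc.IH[OF _ Ck_on_Suc_D[OF Suc.prems(2)]]]) (use Suc.prems in simp)
  qed
qed

lemma Ck_on_of_real: "Ck_on k UNIV f \<Longrightarrow> Ck_on k UNIV (\<lambda>z. complex_of_real (f z))"
proof (induction k arbitrary: f)
  case (Suc k)
  show ?case
    by (rule Ck_on_SucI[OF has_derivative_of_real[OF Ck_on_Suc_has_derivative(1)[OF Suc.prems]]])
       (rule Suc.IH[OF Ck_on_Suc_has_derivative(2)[OF Suc.prems]])
qed (auto intro: continuous_on_of_real)

section \<open>Functions of a Hermitian quadratic form\<close>

definition coeff_mat :: "(complex^'n \<Rightarrow> 'n \<Rightarrow> 'n \<Rightarrow> complex) \<Rightarrow> complex^'n \<Rightarrow> complex^'n^'n" where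
  "coeff_mat a z = (\<chi> j k. a z j k)"

definition quad_form :: "complex^'n^'n \<Rightarrow> complex^'n \<Rightarrow> real" where
  "quad_form B \<zeta> = inner (B *v \<zeta>) \<zeta>"

definition self_adjoint :: "complex^'n^'n \<Rightarrow> bool" where
  "self_adjoint B \<longleftrightarrow> (\<forall>\<xi> \<eta>. inner (B *v \<xi>) \<eta> = inner \<xi> (B *v \<eta>))"

lemma bounded_linear_matrix_complex: "bounded_linear (\<lambda>\<zeta>. (B::complex^'n^'n) *v \<zeta>)"
proof -
  have "linear (\<lambda>\<zeta>. B *v \<zeta>)"
    by (rule linearI) (simp_all add: matrix_vector_right_distrib vec_eq_iff matrix_vector_mult_def sum_distrib_left algebra_simps scaleR_sum_right sum.distrib)
  then show ?thesis by (rule linear_conv_bounded_linear[THEN iffD1])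
qed

lemma quad_form_has_derivative:
  assumes "self_adjoint B"
  shows "((\<lambda>y. quad_form B (y - x)) has_derivative (\<lambda>v. 2 * inner (B *v (y - x)) v)) (at y)"
proof -
  have L: "((\<lambda>y. B *v (y - x)) has_derivative (\<lambda>v. B *v v)) (at y)"
    by (rule bounded_linear.has_derivative[OF bounded_linear_matrix_complex, THEN has_derivative_eq_rhs])
       (auto intro!: derivative_eq_intros)
  have "((\<lambda>y. inner (B *v (y - x)) (y - x)) has_derivative
     (\<lambda>v. inner (B *v (y - x)) v + inner (B *v v) (y - x))) (at y)"
    by (rule has_derivative_inner[OF L, THEN has_derivative_eq_rhs]) (auto intro!: derivative_eq_intros)
  moreover have "inner (B *v v) (y - x) = inner (B *v (y - x)) v" for v
    by (metis assms inner_commute self_adjoint_def)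
  ultimately show ?thesis by (simp add: quad_form_def[abs_def])
qed

lemma Ck_on_quad_form:
  assumes "self_adjoint B"
  shows "Ck_on k UNIV (\<lambda>y. quad_form B (y - x))"
proof (cases k)
  case 0
  then show ?thesis
    using quad_form_has_derivative[OF assms]
    by (auto intro!: continuous_at_imp_continuous_on has_derivative_continuous)
next
  case (Suc m)
  have "Ck_on m UNIV (\<lambda>y. 2 * inner (B *v (y - x)) v)" for v
    by (intro Ck_on_affine[where L="\<lambda>y. 2 * inner (B *v y) v"] bounded_linear_const_mult
        bounded_linear_inner_left_comp[OF bounded_linear_matrix_complex] )
  then show ?thesis unfolding Suc
    by (intro Ck_on_SucI[OF quad_form_has_derivative[OF assms]]) auto
qed

lemma inner_axis_complex: "inner (P::complex^'n) (axis k c) = inner (P $ k) c"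
  by (simp add: inner_axis)

lemma matrix_vector_axis_complex: "((B::complex^'n^'n) *v axis j c) $ k = B $ k $ j * c"
proof -
  have "(\<Sum>i\<in>UNIV. B $ k $ i * axis j c $ i) = (\<Sum>i\<in>UNIV. if i = j then B $ k $ j * c else 0)"
    by (rule sum.cong) (auto simp: axis_def)
  then show ?thesis by (simp add: matrix_vector_mult_def)
qed

lemma inner_coeff_mat:
  "inner (coeff_mat a z *v P) P = Re (\<Sum>j\<in>UNIV. \<Sum>k\<in>UNIV. a z j k * (cnj (P $ j) * P $ k))"
proof -
  have "inner c d = Re (c * cnj d)" for c d by (simp add: inner_complex_def)
  then show ?thesis
    by (simp only: inner_vec_def coeff_mat_def matrix_vector_mult_def sum_distrib_right Re_sum vec_lambda_beta)
       (simp only: mult_ac)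
qed

lemma Re_trace_coeff_mat:
  "Re (trace (coeff_mat a z ** B)) = Re (\<Sum>j\<in>UNIV. \<Sum>k\<in>UNIV. a z j k * B $ k $ j)"
  by (simp add: trace_def coeff_mat_def matrix_matrix_mult_def)

text \<open>Chain rule: for \<open>q y = quad_form B (y - x)\<close> the derivative of
  \<open>q\<close> in the conjugate of \<open>z_k\<close> is entry \<open>k\<close> of
  \<open>B *v (y - x)\<close>, and its mixed second derivatives are the entries of \<open>B\<close>.
  If \<open>B\<close> inverts the coefficient matrix at \<open>y\<close>, the two coefficients are
  \<open>q\<close> itself and the dimension, which gives the ordinary differential operator
  \<open>t h'' + n h'\<close>.\<close>

lemma alpha_ddc_radial:
  fixes h h' h'' :: "real \<Rightarrow> real"
  assumes B: "self_adjoint B" and h: "\<And>t. (h has_real_derivative h' t) (at t)"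
    and h': "\<And>t. (h' has_real_derivative h'' t) (at t)"
  shows "alpha_ddc a (\<lambda>y. h (quad_form B (y - x))) y =
    inner (coeff_mat a y *v (B *v (y - x))) (B *v (y - x)) * h'' (quad_form B (y - x))
    + Re (trace (coeff_mat a y ** B)) * h' (quad_form B (y - x))"
proof -
  define q where "q y = quad_form B (y - x)" for y
  define P where "P y = B *v (y - x)" for y
  have q: "(q has_derivative (\<lambda>v. 2 * inner (P y) v)) (at y)" for y
    unfolding q_def P_def by (rule quad_form_has_derivative[OF B])
  have P: "(P has_derivative (\<lambda>v. B *v v)) (at y)" for y
    unfolding P_def by (rule bounded_linear.has_derivative[OF bounded_linear_matrix_complex, THEN has_derivative_eq_rhs])
       (auto intro!: derivative_eq_intros)
  have comp: "((\<lambda>y. g (q y)) has_derivative (\<lambda>v. 2 * inner (P y) v * g' (q y))) (at y)"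
    if "\<And>t. (g has_real_derivative g' t) (at t)" for g g' :: "real \<Rightarrow> real" and y
    using has_derivative_compose[OF q[of y], of g "\<lambda>s. s * g' (q y)"] that[of "q y"]
    by (simp add: has_field_derivative_def mult_commute_abs)
  have dzbar: "wirt_dzbar k (\<lambda>y. complex_of_real (h (q y))) y = complex_of_real (h' (q y)) * P y $ k" for k y
    unfolding wirt_dzbar_def real_pderiv_eq[OF has_derivative_of_real[OF comp[OF h]]]
    by (simp add: inner_axis_complex inner_complex_def complex_eq_iff)
  have Pk: "((\<lambda>y. P y $ k) has_derivative (\<lambda>v. (B *v v) $ k)) (at y)" for k y
    using bounded_linear.has_derivative[OF bounded_linear_vec_nth P] .
  have "wirt_dz j (wirt_dzbar k (\<lambda>y. complex_of_real (h (q y)))) y =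
     complex_of_real (h'' (q y)) * (cnj (P y $ j) * P y $ k) + complex_of_real (h' (q y)) * B $ k $ j" for j k
  proof -
    have "wirt_dzbar k (\<lambda>y. complex_of_real (h (q y))) = (\<lambda>y. complex_of_real (h' (q y)) * P y $ k)"
      using dzbar by auto
    note pd = real_pderiv_eq[OF has_derivative_mult[OF has_derivative_of_real[OF comp[OF h']] Pk]]
    have c: "cnj (P y $ j) = complex_of_real (Re (P y $ j)) - \<i> * complex_of_real (Im (P y $ j))"
      by (simp add: complex_eq_iff)
    show ?thesis unfolding c \<open>wirt_dzbar k _ = _\<close> wirt_dz_def pd
      by (simp add: inner_axis_complex inner_complex_def matrix_vector_axis_complex field_simps)
  qed
  then have "alpha_ddc a (\<lambda>y. h (q y)) y = Re (\<Sum>j\<in>UNIV. \<Sum>k\<in>UNIV. a y j k *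
     (complex_of_real (h'' (q y)) * (cnj (P y $ j) * P y $ k) + complex_of_real (h' (q y)) * B $ k $ j))"
    by (simp add: alpha_ddc_def)
  also have "\<dots> = Re (complex_of_real (h'' (q y)) * (\<Sum>j\<in>UNIV. \<Sum>k\<in>UNIV. a y j k * (cnj (P y $ j) * P y $ k))
     + complex_of_real (h' (q y)) * (\<Sum>j\<in>UNIV. \<Sum>k\<in>UNIV. a y j k * B $ k $ j))"
    by (simp only: sum_distrib_left sum.distrib ring_distribs mult.left_commute)
  also have "\<dots> = inner (coeff_mat a y *v P y) (P y) * h'' (q y) + Re (trace (coeff_mat a y ** B)) * h' (q y)"
    unfolding inner_coeff_mat Re_trace_coeff_mat by simp
  finally show ?thesis by (simp add: q_def P_def)
qed

subsection \<open>Integration by parts\<close>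

lemma continuous_compact_support_integrable:
  fixes f :: "'a::euclidean_space \<Rightarrow> 'b::{banach, second_countable_topology}"
  assumes "continuous_on UNIV f" "compact K" "\<And>z. z \<notin> K \<Longrightarrow> f z = 0"
  shows "integrable lborel f"
proof -
  have "integrable lborel (\<lambda>z. indicator K z *\<^sub>R f z)"
    by (rule borel_integrable_compact) (use assms in \<open>auto intro: continuous_on_subset\<close>)
  moreover have "(\<lambda>z. indicator K z *\<^sub>R f z) = f"
    using assms(3) by (auto simp: indicator_def fun_eq_iff)
  ultimately show ?thesis by simp
qed

lemma lborel_integral_translate:
  fixes f :: "'a::euclidean_space \<Rightarrow> 'b::{banach, second_countable_topology}"
  assumes "f \<in> borel_measurable borel"
  shows "integral\<^sup>L lborel (\<lambda>x. f (c + x)) = integral\<^sup>L lborel f"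
proof -
  have "integral\<^sup>L lborel f = integral\<^sup>L (distr lborel borel ((+) c)) f"
    by (simp add: lborel_distr_plus)
  also have "\<dots> = integral\<^sup>L lborel (\<lambda>x. f (c + x))"
    by (rule integral_distr) (use assms in auto)
  finally show ?thesis by simp
qed

lemma lborel_integrable_translate:
  fixes f :: "'a::euclidean_space \<Rightarrow> 'b::{banach, second_countable_topology}"
  assumes "integrable lborel f"
  shows "integrable lborel (\<lambda>x. f (c + x))"
proof -
  have "integrable (distr lborel borel ((+) c)) f" using assms by (simp add: lborel_distr_plus)
  then show ?thesis by (subst (asm) integrable_distr_eq) (use assms in auto)
qed

text \<open>Difference quotients integrate to 0 by translation invariance of Lebesgue measure. They
  are bounded by the supremum of the derivative and supported in a fixed compact set, so dominated
  convergence passes this to the derivative.\<close>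

lemma integral_directional_derivative_eq_0:
  fixes f :: "'a::euclidean_space \<Rightarrow> 'b::{banach, second_countable_topology}"
  assumes f': "\<And>z. (f has_derivative f' z) (at z)" and cont: "continuous_on UNIV (\<lambda>z. f' z v)"
    and K: "compact K" "\<And>z. z \<notin> K \<Longrightarrow> f z = 0"
  shows "integrable lborel (\<lambda>z. f' z v)" "integral\<^sup>L lborel (\<lambda>z. f' z v) = 0"
proof -
  have f'0: "f' z v = 0" if "z \<notin> K" for z
  proof -
    have "((\<lambda>_. 0) has_derivative f' z) (at z)"
      by (rule has_derivative_transform_within_open[OF f'[of z], of "-K"])
         (use that K in \<open>auto simp: compact_imp_closed\<close>)
    then have "f' z = (\<lambda>_. 0)" by (rule has_derivative_unique) simp
    then show ?thesis by simp
  qed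
  show int: "integrable lborel (\<lambda>z. f' z v)"
    by (rule continuous_compact_support_integrable[OF cont K(1) f'0])
  have fc: "continuous_on UNIV f"
    using f' by (auto intro!: continuous_at_imp_continuous_on has_derivative_continuous)
  have fint: "integrable lborel f" by (rule continuous_compact_support_integrable[OF fc K])
  have fm: "f \<in> borel_measurable borel" using fint by auto
  have "bounded ((\<lambda>z. f' z v) ` K)"
    by (intro compact_imp_bounded compact_continuous_image continuous_on_subset[OF cont] K) auto
  then obtain b where b: "\<forall>z\<in>K. norm (f' z v) \<le> b" by (auto simp: bounded_iff)
  have b': "norm (f' z v) \<le> \<bar>b\<bar>" for z using b f'0[of z] by (cases "z \<in> K") force+
  have line: "((\<lambda>s. f (x + s *\<^sub>R v)) has_derivative (\<lambda>s. s *\<^sub>R f' (x + t *\<^sub>R v) v)) (at t)" for x t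
  proof -
    have "((\<lambda>s. x + s *\<^sub>R v) has_derivative (\<lambda>s. s *\<^sub>R v)) (at t)"
      by (auto intro!: derivative_eq_intros)
    from has_derivative_compose[OF this f']
    show ?thesis using linear_cmul[OF has_derivative_linear[OF f']] by simp
  qed
  define h where "h i = 1 / real (Suc i)" for i
  have h: "0 < h i" "h i \<le> 1" for i by (auto simp: h_def)
  have h0: "h \<longlonglongrightarrow> 0" unfolding h_def using LIMSEQ_inverse_real_of_nat by (simp add: inverse_eq_divide)
  define g where "g i x = (f (h i *\<^sub>R v + x) - f x) /\<^sub>R h i" for i x
  have lip: "norm (f (h i *\<^sub>R v + x) - f x) \<le> \<bar>b\<bar> * h i" for i x
  proof -
    have "norm (f (x + h i *\<^sub>R v) - f (x + 0 *\<^sub>R v)) \<le> \<bar>b\<bar> * norm (h i - 0)"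
    proof (rule differentiable_bound[where S=UNIV and f="\<lambda>s. f (x + s *\<^sub>R v)" and f'="\<lambda>t s. s *\<^sub>R f' (x + t *\<^sub>R v) v"])
      show "onorm (\<lambda>s. s *\<^sub>R f' (x + t *\<^sub>R v) v) \<le> \<bar>b\<bar>" for t
        by (rule onorm_le) (simp add: b' mult.commute mult_left_mono)
    qed (use line in auto)
    then show ?thesis using h[of i] by (simp add: add.commute)
  qed
  \<comment> \<open>Since \<open>h i \<le> 1\<close>, the shift \<open>h i *\<^sub>R v\<close> stays
    in this ball, so all difference quotients vanish off the same compact set.\<close>
  define K' where "K' = {x - y |x y. x \<in> K \<and> y \<in> cball 0 (norm v)}"
  have K': "compact K'" unfolding K'_def by (intro compact_differences K compact_cball)
  have g0: "g i x = 0" if "x \<notin> K'" for i x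
  proof -
    have "x \<notin> K" using that unfolding K'_def by force
    moreover have "h i *\<^sub>R v + x \<notin> K"
    proof
      assume "h i *\<^sub>R v + x \<in> K"
      moreover have "h i *\<^sub>R v \<in> cball 0 (norm v)" using h[of i] by (simp add: mult_left_le_one_le)
      ultimately have "(h i *\<^sub>R v + x) - h i *\<^sub>R v \<in> K'" unfolding K'_def by blast
      then show False using that by simp
    qed
    ultimately show ?thesis using K by (simp add: g_def)
  qed
  have "(\<lambda>i. integral\<^sup>L lborel (g i)) \<longlonglongrightarrow> integral\<^sup>L lborel (\<lambda>z. f' z v)"
  proof (rule integral_dominated_convergence[where w="\<lambda>x. \<bar>b\<bar> * indicator K' x"])
    show "(\<lambda>z. f' z v) \<in> borel_measurable lborel" using int by auto
    show "g i \<in> borel_measurable lborel" for i unfolding g_def using fm by measurable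
    show "integrable lborel (\<lambda>x. \<bar>b\<bar> * indicator K' x :: real)"
      using emeasure_compact_finite[OF K'] borel_compact[OF K']
      by (intro integrable_mult_right integrable_real_indicator) auto
    show "AE x in lborel. (\<lambda>i. g i x) \<longlonglongrightarrow> f' x v"
    proof (rule AE_I2)
      fix x
      have "((\<lambda>s. norm (f (x + s *\<^sub>R v) - f x - s *\<^sub>R f' x v) / norm s) \<longlongrightarrow> 0) (at 0)"
        using line[of x 0] by (simp add: has_derivative_at)
      then have "(\<lambda>i. norm (f (x + h i *\<^sub>R v) - f x - h i *\<^sub>R f' x v) / norm (h i)) \<longlonglongrightarrow> 0"
      proof (rule filterlim_compose)
        show "filterlim h (at 0) sequentially"
          using h0 h by (auto simp: filterlim_at intro!: always_eventually) (metis less_irrefl)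
      qed
      moreover have "norm (f (x + h i *\<^sub>R v) - f x - h i *\<^sub>R f' x v) / norm (h i) = norm (g i x - f' x v)" for i
      proof -
        have "g i x - f' x v = (f (x + h i *\<^sub>R v) - f x - h i *\<^sub>R f' x v) /\<^sub>R h i"
          using h[of i] by (simp add: g_def scaleR_diff_right add.commute)
        then show ?thesis using h[of i] by (simp add: divide_inverse mult.commute)
      qed
      ultimately have "(\<lambda>i. norm (g i x - f' x v)) \<longlonglongrightarrow> 0" by simp
      then show "(\<lambda>i. g i x) \<longlonglongrightarrow> f' x v"
        using Lim_null tendsto_norm_zero_iff by blast
    qed
    show "AE x in lborel. norm (g i x) \<le> \<bar>b\<bar> * indicator K' x" for i
    proof (rule AE_I2)
      fix x
      show "norm (g i x) \<le> \<bar>b\<bar> * indicator K' x"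
      proof (cases "x \<in> K'")
        case True
        have "norm (g i x) = norm (f (h i *\<^sub>R v + x) - f x) / h i"
          using h[of i] by (simp add: g_def divide_inverse mult.commute)
        also have "\<dots> \<le> \<bar>b\<bar> * h i / h i" using lip h[of i] by (intro divide_right_mono) auto
        finally show ?thesis using True h[of i] by simp
      qed (simp add: g0)
    qed
  qed
  moreover have "integral\<^sup>L lborel (g i) = 0" for i
    unfolding g_def using fint fm
    by (simp add: lborel_integrable_translate lborel_integral_translate)
  ultimately show "integral\<^sup>L lborel (\<lambda>z. f' z v) = 0" by (simp add: LIMSEQ_const_iff)
qed

section \<open>Integration by parts in Wirtinger derivatives\<close>

lemma integral_real_pderiv_eq_0:
  fixes f :: "complex^'n \<Rightarrow> complex"
  assumes "Ck_on 1 UNIV f" "compact K" "\<And>z. z \<notin> K \<Longrightarrow> f z = 0"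
  shows "integrable lborel (\<lambda>z. real_pderiv f z v)" "integral\<^sup>L lborel (\<lambda>z. real_pderiv f z v) = 0"
  using integral_directional_derivative_eq_0[of f "\<lambda>z v. real_pderiv f z v" v K]
    Ck_on_Suc_has_derivative[of 0 f] assms by simp_all

lemma integral_wirt_dz_eq_0:
  assumes "Ck_on 1 UNIV f" "compact K" "\<And>z. z \<notin> K \<Longrightarrow> f z = 0"
  shows "integrable lborel (wirt_dz j f)" "integral\<^sup>L lborel (wirt_dz j f) = 0"
  using integral_real_pderiv_eq_0[OF assms] unfolding wirt_dz_def[abs_def] by simp_all

lemma integral_wirt_dzbar_eq_0:
  assumes "Ck_on 1 UNIV f" "compact K" "\<And>z. z \<notin> K \<Longrightarrow> f z = 0"
  shows "integrable lborel (wirt_dzbar j f)" "integral\<^sup>L lborel (wirt_dzbar j f) = 0"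
  using integral_real_pderiv_eq_0[OF assms] unfolding wirt_dzbar_def[abs_def] by simp_all

lemma has_derivative_real_pderiv: "f differentiable (at z) \<Longrightarrow> (f has_derivative real_pderiv f z) (at z)"
  unfolding real_pderiv_def[abs_def] using frechet_derivative_works by blast

lemma real_pderiv_mult:
  fixes f g :: "complex^'n \<Rightarrow> complex"
  assumes "f differentiable (at z)" "g differentiable (at z)"
  shows "real_pderiv (\<lambda>w. f w * g w) z v = real_pderiv f z v * g z + f z * real_pderiv g z v"
proof -
  have "(f has_derivative real_pderiv f z) (at z)" "(g has_derivative real_pderiv g z) (at z)"
    using assms by (auto intro: has_derivative_real_pderiv)
  then show ?thesis by (subst real_pderiv_eq[OF has_derivative_mult]) (auto simp: add.commute)
qed

lemma wirt_dz_mult: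
  assumes "f differentiable (at z)" "g differentiable (at z)"
  shows "wirt_dz j (\<lambda>w. f w * g w) z = wirt_dz j f z * g z + f z * wirt_dz j g z"
  using real_pderiv_mult[OF assms] by (simp add: wirt_dz_def field_simps)

lemma wirt_dzbar_mult:
  assumes "f differentiable (at z)" "g differentiable (at z)"
  shows "wirt_dzbar j (\<lambda>w. f w * g w) z = wirt_dzbar j f z * g z + f z * wirt_dzbar j g z"
  using real_pderiv_mult[OF assms] by (simp add: wirt_dzbar_def field_simps)

lemma differentiable_on_open_at:
  "Ck_on 1 U f \<Longrightarrow> open U \<Longrightarrow> z \<in> U \<Longrightarrow> f differentiable (at z)"
  using at_within_open[of z U] by (auto simp: differentiable_on_def)

text \<open>The coefficients are differentiable only on \<open>U\<close> and arbitrary outside. A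
  factor supported in a compact subset of \<open>U\<close> makes the product globally
  \<open>C^1\<close>, glued from \<open>U\<close> and the complement of the support.\<close>

lemma Ck_on_mult_compact_support:
  fixes A g :: "complex^'n \<Rightarrow> complex"
  assumes A: "Ck_on 1 U A" "open U" and g: "Ck_on 1 UNIV g" and K: "compact K" "K \<subseteq> U" "\<And>z. z \<notin> K \<Longrightarrow> g z = 0"
  shows "Ck_on 1 UNIV (\<lambda>z. A z * g z)"
proof -
  have dA: "A differentiable (at z)" if "z \<in> U" for z using differentiable_on_open_at[OF A that] .
  have dg: "g differentiable (at z)" for z using differentiable_on_open_at[OF g, of z] by simp
  have K': "open (- K)" using K by (simp add: compact_imp_closed open_Compl)
  have z0: "((\<lambda>z. A z * g z) has_derivative (\<lambda>_. 0)) (at z)" if "z \<in> - K" for z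
    by (rule has_derivative_transform_within_open[OF has_derivative_const K' that]) (use K in auto)
  have d: "(\<lambda>z. A z * g z) differentiable (at z)" for z
    using z0[of z] differentiable_mult[OF dA dg, of z] K by (cases "z \<in> U") (auto simp: differentiable_def)
  have "continuous_on UNIV (\<lambda>z. real_pderiv (\<lambda>z. A z * g z) z v)" for v
  proof -
    have "continuous_on U (\<lambda>z. real_pderiv A z v * g z + A z * real_pderiv g z v)"
      using A g by (intro continuous_intros) (auto intro: continuous_on_subset)
    then have "continuous_on U (\<lambda>z. real_pderiv (\<lambda>z. A z * g z) z v)"
      by (rule continuous_on_eq) (simp add: real_pderiv_mult dA dg)
    moreover have "continuous_on (-K) (\<lambda>z. real_pderiv (\<lambda>z. A z * g z) z v)"
      by (rule continuous_on_eq[where f="\<lambda>_. 0"]) (simp_all add: real_pderiv_eq[OF z0])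
    ultimately have "continuous_on (U \<union> - K) (\<lambda>z. real_pderiv (\<lambda>z. A z * g z) z v)"
      by (rule continuous_on_open_Un[OF A(2) K'])
    moreover have "U \<union> - K = UNIV" using K by auto
    ultimately show ?thesis by simp
  qed
  then show ?thesis using d by (auto simp: differentiable_on_def intro!: differentiable_imp_continuous_on)
qed

lemma Ck_on_wirt_dzbar:
  "Ck_on (Suc k) UNIV f \<Longrightarrow> Ck_on k UNIV (wirt_dzbar j f)"
proof -
  assume f: "Ck_on (Suc k) UNIV f"
  have "Ck_on k UNIV (\<lambda>z. (real_pderiv f z (axis j 1) + \<i> * real_pderiv f z (axis j \<i>)) * (1/2))"
    by (intro Ck_on_mult Ck_on_add Ck_on_const Ck_on_Suc_has_derivative(2)[OF f])
  then show ?thesis by (simp add: wirt_dzbar_def[abs_def])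
qed

lemma real_pderiv_eq_0:
  assumes "open S" "z \<in> S" "\<And>w. w \<in> S \<Longrightarrow> f w = 0"
  shows "real_pderiv f z v = 0"
proof -
  have "(f has_derivative (\<lambda>_. 0)) (at z)"
    by (rule has_derivative_transform_within_open[OF has_derivative_const[of 0] assms(1,2)])
       (use assms(3) in auto)
  then show ?thesis by (rule real_pderiv_eq)
qed

lemma wirt_dzbar_eq_0:
  assumes "z \<notin> closure {z. f z \<noteq> 0}"
  shows "wirt_dzbar j f z = 0"
proof -
  have "real_pderiv f z v = 0" for v
  proof (rule real_pderiv_eq_0)
    show "f w = 0" if "w \<in> - closure {z. f z \<noteq> 0}" for w
      using that closure_subset[of "{z. f z \<noteq> 0}"] by blast
  qed (use assms in \<open>auto simp: open_Compl\<close>)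
  then show ?thesis by (simp add: wirt_dzbar_def)
qed

text \<open>Closedness is postulated for the holomorphic derivatives in the first index. The
  Hermitian symmetry holds on an open set, so it can be differentiated, and conjugation gives the
  companion identity in the second index.\<close>

lemma closed_form_dzbar:
  assumes "admissible_form U a" "z \<in> U"
  shows "(\<Sum>k\<in>UNIV. wirt_dzbar k (\<lambda>w. a w j k) z) = 0"
proof -
  have U: "open U" and C: "\<And>j k. Ck_on 1 U (\<lambda>z. a z j k)" and herm: "\<And>z j k. z \<in> U \<Longrightarrow> a z k j = cnj (a z j k)"
    and cl: "\<And>k. (\<Sum>j\<in>UNIV. wirt_dz j (\<lambda>w. a w j k) z) = 0"
    using assms unfolding admissible_form_def by blast+
  have "real_pderiv (\<lambda>w. a w j k) z v = cnj (real_pderiv (\<lambda>w. a w k j) z v)" for k v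
  proof -
    have d: "((\<lambda>w. a w k j) has_derivative real_pderiv (\<lambda>w. a w k j) z) (at z)"
      by (rule has_derivative_real_pderiv[OF differentiable_on_open_at[OF C U assms(2)]])
    have "((\<lambda>w. a w j k) has_derivative (\<lambda>v. cnj (real_pderiv (\<lambda>w. a w k j) z v))) (at z)"
      by (rule has_derivative_transform_within_open[OF bounded_linear.has_derivative[OF bounded_linear_cnj d] U assms(2)])
         (rule herm[symmetric])
    then show ?thesis by (rule real_pderiv_eq)
  qed
  then have "wirt_dzbar k (\<lambda>w. a w j k) z = cnj (wirt_dz k (\<lambda>w. a w k j) z)" for k
    by (simp add: wirt_dz_def wirt_dzbar_def)
  then have "(\<Sum>k\<in>UNIV. wirt_dzbar k (\<lambda>w. a w j k) z) = cnj (\<Sum>k\<in>UNIV. wirt_dz k (\<lambda>w. a w k j) z)"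
    by simp
  then show ?thesis using cl by simp
qed

text \<open>Two integrations by parts move both derivatives from the test function to the affine
  function, whose second derivatives vanish. Each one differentiates the coefficients as well, and
  closedness, once in either index, removes these terms. Constants and the difference of
  \<open>|z|^2\<close> and \<open>|z - z0|^2\<close> are instances.\<close>

lemma integral_affine_alpha_ddc_eq_0:
  fixes a :: "complex^'n \<Rightarrow> 'n \<Rightarrow> 'n \<Rightarrow> complex" and l :: "complex^'n \<Rightarrow> real"
  assumes form: "admissible_form U a" and \<omega>: "nonneg_test_fun U \<omega>"
    and l: "\<And>z. l z = c + inner p z"
  shows "integral\<^sup>L lborel (\<lambda>z. l z * alpha_ddc a \<omega> z) = 0" "integrable lborel (\<lambda>z. l z * alpha_ddc a \<omega> z)"
proof -
  define K where "K = closure {z. \<omega> z \<noteq> 0}"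
  have K: "compact K" "K \<subseteq> U" "\<And>z. z \<notin> K \<Longrightarrow> \<omega> z = 0"
    using \<omega> closure_subset[of "{z. \<omega> z \<noteq> 0}"] by (auto simp: nonneg_test_fun_def K_def)
  have U: "open U" and C: "\<And>j k. Ck_on 1 U (\<lambda>z. a z j k)"
    and cl: "\<And>z k. z \<in> U \<Longrightarrow> (\<Sum>j\<in>UNIV. wirt_dz j (\<lambda>w. a w j k) z) = 0"
    using form unfolding admissible_form_def by blast+
  define W where "W z = complex_of_real (\<omega> z)" for z
  define L where "L z = complex_of_real (l z)" for z
  have W: "Ck_on k UNIV W" for k
    unfolding W_def using \<omega> by (intro Ck_on_of_real) (auto simp: nonneg_test_fun_def smooth_on_def)
  have Ld: "(L has_derivative (\<lambda>v. complex_of_real (inner p v))) (at z)" for z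
    unfolding L_def l by (auto intro!: derivative_eq_intros)
  have L: "Ck_on 1 UNIV L"
    by (simp, rule Ck_on_SucI[OF Ld, of 0, simplified])
  define P where "P j = (complex_of_real (inner p (axis j 1)) - \<i> * complex_of_real (inner p (axis j \<i>))) / 2" for j
  have LP: "wirt_dz j L z = P j" for j z unfolding wirt_dz_def real_pderiv_eq[OF Ld] P_def ..
  define g where "g k = wirt_dzbar k W" for k
  have g: "Ck_on 1 UNIV (g k)" for k
    unfolding g_def One_nat_def by (intro Ck_on_wirt_dzbar W)
  have WK: "closure {z. W z \<noteq> 0} = K" by (simp add: W_def K_def)
  have g0: "g k z = 0" if "z \<notin> K" for k z unfolding g_def using wirt_dzbar_eq_0[of z W] WK that by simp
  have dA: "(\<lambda>z. a z j k) differentiable (at z)" if "z \<in> U" for z j k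
    using differentiable_on_open_at[OF C U that] .
  have dg: "g k differentiable (at z)" for k z using differentiable_on_open_at[OF g, of z] by simp
  have dW: "W differentiable (at z)" for z using differentiable_on_open_at[OF W, of z] by simp
  have dL: "L differentiable (at z)" for z using Ld by (auto simp: differentiable_def)
  have gL: "Ck_on 1 UNIV (\<lambda>z. g k z * L z)" for k by (rule Ck_on_mult[OF g L])
  have agL: "Ck_on 1 UNIV (\<lambda>z. a z j k * (g k z * L z))" for j k
    by (rule Ck_on_mult_compact_support[OF C U gL K(1,2)]) (simp add: g0)
  have aW: "Ck_on 1 UNIV (\<lambda>z. a z j k * W z)" for j k
    by (rule Ck_on_mult_compact_support[OF C U W K(1,2)]) (simp add: W_def K(3))
  have I1: "integrable lborel (wirt_dz j (\<lambda>z. a z j k * (g k z * L z)))"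
       "integral\<^sup>L lborel (wirt_dz j (\<lambda>z. a z j k * (g k z * L z))) = 0" for j k
    by (rule integral_wirt_dz_eq_0[OF agL K(1)]; simp add: g0)+
  have I2: "integrable lborel (wirt_dzbar k (\<lambda>z. a z j k * W z))"
       "integral\<^sup>L lborel (wirt_dzbar k (\<lambda>z. a z j k * W z)) = 0" for j k
    by (rule integral_wirt_dzbar_eq_0[OF aW K(1)]; simp add: W_def K(3))+
  define T where "T z = (\<Sum>j\<in>UNIV. \<Sum>k\<in>UNIV. a z j k * wirt_dz j (g k) z)" for z
  define R where "R z = (\<Sum>j\<in>UNIV. P j * (\<Sum>k\<in>UNIV. a z j k * g k z))" for z
  have wdz0: "wirt_dz j (g k) z = 0" if "z \<notin> K" for j k z
  proof -
    have "real_pderiv (g k) z v = 0" for v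
      by (rule real_pderiv_eq_0[of "- K"]) (use that g0 K(1) in \<open>auto simp: compact_imp_closed open_Compl\<close>)
    then show ?thesis by (simp add: wirt_dz_def)
  qed
  \<comment> \<open>First integration by parts: \<open>L * T\<close> is the wanted integrand and
    \<open>R\<close> collects the terms in which the affine function is differentiated to the
    constants \<open>P j\<close>.\<close>
  have div1: "(\<Sum>j\<in>UNIV. \<Sum>k\<in>UNIV. wirt_dz j (\<lambda>z. a z j k * (g k z * L z)) z) = L z * T z + R z" for z
  proof (cases "z \<in> U")
    case True
    have "wirt_dz j (\<lambda>z. a z j k * (g k z * L z)) z
        = wirt_dz j (\<lambda>w. a w j k) z * (g k z * L z) + (L z * (a z j k * wirt_dz j (g k) z) + P j * (a z j k * g k z))" for j k
      unfolding wirt_dz_mult[OF dA[OF True] differentiable_mult[OF dg dL]] wirt_dz_mult[OF dg dL] LP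
      by (simp add: algebra_simps)
    then have "(\<Sum>j\<in>UNIV. \<Sum>k\<in>UNIV. wirt_dz j (\<lambda>z. a z j k * (g k z * L z)) z)
       = (\<Sum>j\<in>UNIV. \<Sum>k\<in>UNIV. wirt_dz j (\<lambda>w. a w j k) z * (g k z * L z)) + (L z * T z + R z)"
      by (simp only: sum.distrib T_def R_def sum_distrib_left)
    also have "(\<Sum>j\<in>UNIV. \<Sum>k\<in>UNIV. wirt_dz j (\<lambda>w. a w j k) z * (g k z * L z))
       = (\<Sum>k\<in>UNIV. (\<Sum>j\<in>UNIV. wirt_dz j (\<lambda>w. a w j k) z) * (g k z * L z))"
      by (subst sum.swap) (simp only: sum_distrib_right)
    finally show ?thesis using cl[OF True] by simp
  next
    case False
    then have zK: "z \<notin> K" using K by auto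
    have "real_pderiv (\<lambda>z. a z j k * (g k z * L z)) z v = 0" for j k v
      by (rule real_pderiv_eq_0[of "- K"]) (use zK g0 K(1) in \<open>auto simp: compact_imp_closed open_Compl\<close>)
    then show ?thesis using wdz0[OF zK] g0[OF zK] by (simp add: wirt_dz_def[of _ "\<lambda>z. a z _ _ * (g _ z * L z)"] T_def R_def)
  qed
  \<comment> \<open>Second integration by parts: as the \<open>P j\<close> are constants, this shows
    that \<open>R\<close> is itself a divergence.\<close>
  have div2: "(\<Sum>k\<in>UNIV. wirt_dzbar k (\<lambda>z. a z j k * W z) z) = (\<Sum>k\<in>UNIV. a z j k * g k z)" for j z
  proof (cases "z \<in> U")
    case True
    have "(\<Sum>k\<in>UNIV. wirt_dzbar k (\<lambda>z. a z j k * W z) z)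
       = (\<Sum>k\<in>UNIV. wirt_dzbar k (\<lambda>w. a w j k) z) * W z + (\<Sum>k\<in>UNIV. a z j k * g k z)"
      by (simp add: wirt_dzbar_mult[OF dA[OF True] dW] g_def sum.distrib sum_distrib_right)
    then show ?thesis using closed_form_dzbar[OF form True] by simp
  next
    case False
    then have zK: "z \<notin> K" using K by auto
    have "wirt_dzbar k (\<lambda>z. a z j k * W z) z = 0" for k
    proof (rule wirt_dzbar_eq_0)
      have "closure {z. a z j k * W z \<noteq> 0} \<subseteq> K" unfolding WK[symmetric] by (intro closure_mono) auto
      then show "z \<notin> closure {z. a z j k * W z \<noteq> 0}" using zK by blast
    qed
    then show ?thesis using g0[OF zK] by simp
  qed
  have R: "integrable lborel R" "integral\<^sup>L lborel R = 0"
  proof -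
    have "integrable lborel (\<lambda>z. \<Sum>j\<in>UNIV. P j * (\<Sum>k\<in>UNIV. wirt_dzbar k (\<lambda>z. a z j k * W z) z))"
      using I2(1) by (intro Bochner_Integration.integrable_sum integrable_mult_right)
    moreover have "integral\<^sup>L lborel (\<lambda>z. \<Sum>j\<in>UNIV. P j * (\<Sum>k\<in>UNIV. wirt_dzbar k (\<lambda>z. a z j k * W z) z)) = 0"
      using I2 by (simp add: Bochner_Integration.integral_sum Bochner_Integration.integrable_sum)
    ultimately show "integrable lborel R" "integral\<^sup>L lborel R = 0" by (simp_all add: div2 R_def[abs_def])
  qed
  have S: "integrable lborel (\<lambda>z. L z * T z + R z)" "integral\<^sup>L lborel (\<lambda>z. L z * T z + R z) = 0"
  proof -
    have "integrable lborel (\<lambda>z. \<Sum>j\<in>UNIV. \<Sum>k\<in>UNIV. wirt_dz j (\<lambda>z. a z j k * (g k z * L z)) z)"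
      using I1(1) by (intro Bochner_Integration.integrable_sum)
    moreover have "integral\<^sup>L lborel (\<lambda>z. \<Sum>j\<in>UNIV. \<Sum>k\<in>UNIV. wirt_dz j (\<lambda>z. a z j k * (g k z * L z)) z) = 0"
      using I1 by (simp add: Bochner_Integration.integral_sum Bochner_Integration.integrable_sum)
    ultimately show "integrable lborel (\<lambda>z. L z * T z + R z)" "integral\<^sup>L lborel (\<lambda>z. L z * T z + R z) = 0"
      by (simp_all add: div1)
  qed
  have LT: "integrable lborel (\<lambda>z. L z * T z)" "integral\<^sup>L lborel (\<lambda>z. L z * T z) = 0"
    using Bochner_Integration.integrable_diff[OF S(1) R(1)] Bochner_Integration.integral_diff[OF S(1) R(1)] S(2) R(2)
    by simp_all
  have eq: "l z * alpha_ddc a \<omega> z = Re (L z * T z)" for z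
    by (simp add: alpha_ddc_def T_def L_def g_def W_def[abs_def])
  show "integrable lborel (\<lambda>z. l z * alpha_ddc a \<omega> z)"
    unfolding eq by (rule integrable_Re[OF LT(1)])
  show "integral\<^sup>L lborel (\<lambda>z. l z * alpha_ddc a \<omega> z) = 0"
    unfolding eq using integral_Re[OF LT(1)] LT(2) by simp
qed

subsection \<open>Lebesgue points\<close>

text \<open>Density of compactly supported continuous functions in \<open>L^1\<close>, phrased as a
  property of one function so that it can be carried through the induction on integrable
  functions.\<close>

definition L1_approx :: "('a::euclidean_space \<Rightarrow> real) \<Rightarrow> bool" where
  "L1_approx f \<longleftrightarrow> (\<forall>\<epsilon>>0. \<exists>g K. continuous_on UNIV g \<and> compact K \<and> (\<forall>z. z \<notin> K \<longrightarrow> g z = 0) \<and>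
      (\<integral>x. \<bar>f x - g x\<bar> \<partial>lborel) < \<epsilon>)"

lemma L1_approx_limit:
  fixes f :: "'a::euclidean_space \<Rightarrow> real"
  assumes f: "integrable lborel f"
    and h: "\<And>\<epsilon>. \<epsilon> > 0 \<Longrightarrow> \<exists>h. integrable lborel h \<and> L1_approx h \<and> (\<integral>x. \<bar>f x - h x\<bar> \<partial>lborel) < \<epsilon>"
  shows "L1_approx f"
  unfolding L1_approx_def
proof (intro allI impI)
  fix \<epsilon> :: real assume "\<epsilon> > 0"
  then obtain h where h: "integrable lborel h" "L1_approx h" "(\<integral>x. \<bar>f x - h x\<bar> \<partial>lborel) < \<epsilon>/2"
    using h[of "\<epsilon>/2"] by auto
  obtain g K where g: "continuous_on UNIV g" "compact K" "\<forall>z. z \<notin> K \<longrightarrow> g z = 0" "(\<integral>x. \<bar>h x - g x\<bar> \<partial>lborel) < \<epsilon>/2"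
    using h(2) \<open>\<epsilon> > 0\<close> unfolding L1_approx_def by (meson half_gt_zero)
  have gi: "integrable lborel g" using continuous_compact_support_integrable[OF g(1,2)] g(3) by blast
  have "(\<integral>x. \<bar>f x - g x\<bar> \<partial>lborel) \<le> (\<integral>x. \<bar>f x - h x\<bar> + \<bar>h x - g x\<bar> \<partial>lborel)"
    using f h(1) gi by (intro integral_mono) auto
  also have "\<dots> = (\<integral>x. \<bar>f x - h x\<bar> \<partial>lborel) + (\<integral>x. \<bar>h x - g x\<bar> \<partial>lborel)"
    using f h(1) gi by (intro Bochner_Integration.integral_add) auto
  also have "\<dots> < \<epsilon>" using h g by simp
  finally show "\<exists>g K. continuous_on UNIV g \<and> compact K \<and> (\<forall>z. z \<notin> K \<longrightarrow> g z = 0) \<and>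
      (\<integral>x. \<bar>f x - g x\<bar> \<partial>lborel) < \<epsilon>" using g by blast
qed

lemma L1_approx_dominated:
  fixes f w :: "'a::euclidean_space \<Rightarrow> real"
  assumes s: "\<And>i::nat. integrable lborel (s i)" "\<And>i. L1_approx (s i)" and f: "integrable lborel f"
    and lim: "\<And>x. (\<lambda>i. s i x) \<longlonglongrightarrow> f x" and w: "integrable lborel w" "\<And>i x. \<bar>s i x\<bar> \<le> w x"
  shows "L1_approx f"
proof (rule L1_approx_limit[OF f])
  fix \<epsilon> :: real assume "\<epsilon> > 0"
  have "(\<lambda>i. \<integral>x. \<bar>f x - s i x\<bar> \<partial>lborel) \<longlonglongrightarrow> (\<integral>x. 0 \<partial>(lborel :: 'a measure))"
  proof (rule integral_dominated_convergence[where w="\<lambda>x. \<bar>f x\<bar> + w x"])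
    show "AE x in lborel. (\<lambda>i. \<bar>f x - s i x\<bar>) \<longlonglongrightarrow> 0"
    proof (rule AE_I2)
      fix x
      have "(\<lambda>i. \<bar>f x - s i x\<bar>) \<longlonglongrightarrow> \<bar>f x - f x\<bar>" by (intro tendsto_intros lim)
      then show "(\<lambda>i. \<bar>f x - s i x\<bar>) \<longlonglongrightarrow> 0" by simp
    qed
    show "AE x in lborel. norm \<bar>f x - s i x\<bar> \<le> \<bar>f x\<bar> + w x" for i
      using w(2)[of i] by (intro AE_I2) (smt (verit) real_norm_def)
  qed (use f s w in auto)
  then have "\<forall>\<^sub>F i in sequentially. (\<integral>x. \<bar>f x - s i x\<bar> \<partial>lborel) < \<epsilon>"
    using \<open>\<epsilon> > 0\<close> by (simp add: order_tendstoD)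
  then obtain i where "(\<integral>x. \<bar>f x - s i x\<bar> \<partial>lborel) < \<epsilon>" using eventually_happens' sequentially_bot by blast
  then show "\<exists>h. integrable lborel h \<and> L1_approx h \<and> (\<integral>x. \<bar>f x - h x\<bar> \<partial>lborel) < \<epsilon>" using s by blast
qed

lemma L1_approx_add:
  assumes f: "integrable lborel f" "L1_approx f" and f': "integrable lborel f'" "L1_approx f'"
  shows "L1_approx (\<lambda>x. f x + f' x)"
  unfolding L1_approx_def
proof (intro allI impI)
  fix \<epsilon> :: real assume "\<epsilon> > 0"
  obtain g K where g: "continuous_on UNIV g" "compact K" "\<forall>z. z \<notin> K \<longrightarrow> g z = 0" "(\<integral>x. \<bar>f x - g x\<bar> \<partial>lborel) < \<epsilon>/2"
    using f(2) \<open>\<epsilon> > 0\<close> unfolding L1_approx_def by (meson half_gt_zero)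
  obtain g' K' where g': "continuous_on UNIV g'" "compact K'" "\<forall>z. z \<notin> K' \<longrightarrow> g' z = 0" "(\<integral>x. \<bar>f' x - g' x\<bar> \<partial>lborel) < \<epsilon>/2"
    using f'(2) \<open>\<epsilon> > 0\<close> unfolding L1_approx_def by (meson half_gt_zero)
  have gi: "integrable lborel g" "integrable lborel g'"
    using continuous_compact_support_integrable[OF g(1,2)] g(3)
      continuous_compact_support_integrable[OF g'(1,2)] g'(3) by blast+
  have "(\<integral>x. \<bar>(f x + f' x) - (g x + g' x)\<bar> \<partial>lborel) \<le> (\<integral>x. \<bar>f x - g x\<bar> + \<bar>f' x - g' x\<bar> \<partial>lborel)"
    using f f' gi by (intro integral_mono) auto
  also have "\<dots> = (\<integral>x. \<bar>f x - g x\<bar> \<partial>lborel) + (\<integral>x. \<bar>f' x - g' x\<bar> \<partial>lborel)"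
    using f f' gi by (intro Bochner_Integration.integral_add) auto
  also have "\<dots> < \<epsilon>" using g g' by simp
  finally have lt: "(\<integral>x. \<bar>(f x + f' x) - (g x + g' x)\<bar> \<partial>lborel) < \<epsilon>" .
  show "\<exists>g K. continuous_on UNIV g \<and> compact K \<and> (\<forall>z. z \<notin> K \<longrightarrow> g z = 0) \<and>
      (\<integral>x. \<bar>(f x + f' x) - g x\<bar> \<partial>lborel) < \<epsilon>"
    by (rule exI[of _ "\<lambda>x. g x + g' x"], rule exI[of _ "K \<union> K'"])
       (use g g' lt in \<open>auto intro: continuous_on_add compact_Un\<close>)
qed

lemma L1_approx_cmult:
  assumes f: "integrable lborel f" "L1_approx f"
  shows "L1_approx (\<lambda>x. f x * c)"
  unfolding L1_approx_def
proof (intro allI impI)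
  fix \<epsilon> :: real assume "\<epsilon> > 0"
  then have e: "\<epsilon> / (\<bar>c\<bar> + 1) > 0" by simp
  then obtain g K where g: "continuous_on UNIV g" "compact K" "\<forall>z. z \<notin> K \<longrightarrow> g z = 0" "(\<integral>x. \<bar>f x - g x\<bar> \<partial>lborel) < \<epsilon> / (\<bar>c\<bar> + 1)"
    using f(2) unfolding L1_approx_def by meson
  have "(\<integral>x. \<bar>f x * c - g x * c\<bar> \<partial>lborel) = (\<integral>x. \<bar>f x - g x\<bar> \<partial>lborel) * \<bar>c\<bar>"
    by (simp add: abs_mult flip: left_diff_distrib)
  also have "\<dots> \<le> (\<integral>x. \<bar>f x - g x\<bar> \<partial>lborel) * (\<bar>c\<bar> + 1)"
    by (intro mult_left_mono) (auto intro: integral_nonneg_AE)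
  also have "\<dots> < \<epsilon>" using g(4) by (simp add: pos_less_divide_eq)
  finally have lt: "(\<integral>x. \<bar>f x * c - g x * c\<bar> \<partial>lborel) < \<epsilon>" .
  show "\<exists>g K. continuous_on UNIV g \<and> compact K \<and> (\<forall>z. z \<notin> K \<longrightarrow> g z = 0) \<and>
      (\<integral>x. \<bar>f x * c - g x\<bar> \<partial>lborel) < \<epsilon>"
    by (rule exI[of _ "\<lambda>x. g x * c"], rule exI[of _ K])
       (use g lt in \<open>auto intro: continuous_on_mult\<close>)
qed

lemma L1_approx_continuous:
  assumes "continuous_on UNIV g" "compact K" "\<And>z. z \<notin> K \<Longrightarrow> g z = 0"
  shows "L1_approx g"
  unfolding L1_approx_def by (intro allI impI exI[of _ g] exI[of _ K]) (use assms in auto)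

lemma L1_approx_compact:
  fixes K :: "'a::euclidean_space set"
  assumes "compact K"
  shows "L1_approx (indicator K :: 'a \<Rightarrow> real)"
proof (cases "K = {}")
  case True
  then show ?thesis using L1_approx_continuous[of "\<lambda>_. 0" "{}"] by (simp add: indicator_def[abs_def])
next
  case False
  \<comment> \<open>Tent functions over shrinking neighbourhoods of \<open>K\<close>; they decrease
    to its indicator and all live within distance 1 of it.\<close>
  define s where "s i x = max 0 (1 - real (Suc i) * infdist x K)" for i x
  define K' where "K' = {x. infdist x K \<le> 1}"
  have K': "compact K'" unfolding K'_def by (rule compact_infdist_le[OF False assms]) simp
  have sc: "continuous_on UNIV (s i)" for i
    unfolding s_def by (intro continuous_intros)
  have s0: "s i x = 0" if "x \<notin> K'" for i x
  proof -
    have "1 * 1 \<le> real (Suc i) * infdist x K" using that by (intro mult_mono) (auto simp: K'_def)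
    then show ?thesis by (simp add: s_def)
  qed
  have sle: "\<bar>s i x\<bar> \<le> 1" for i x by (simp add: s_def infdist_nonneg)
  have int: "integrable lborel (indicator A :: 'a \<Rightarrow> real)" if "compact A" for A
    using emeasure_compact_finite[OF that] borel_compact[OF that] by (intro integrable_real_indicator) auto
  show ?thesis
  proof (rule L1_approx_dominated[where s=s and w="indicator K'"])
    show "integrable lborel (s i)" "L1_approx (s i)" for i
      using continuous_compact_support_integrable[OF sc K' s0] L1_approx_continuous[OF sc K' s0] by blast+
    show "\<bar>s i x\<bar> \<le> indicator K' x" for i x using sle s0 by (cases "x \<in> K'") auto
    show "(\<lambda>i. s i x) \<longlonglongrightarrow> indicator K x" for x
    proof (cases "x \<in> K")
      case True
      then show ?thesis by (simp add: s_def)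
    next
      case False
      then have d: "infdist x K > 0"
        using in_closed_iff_infdist_zero[of K x] assms \<open>K \<noteq> {}\<close> infdist_nonneg[of x K]
        by (auto simp: compact_imp_closed less_le)
      obtain N where N: "real N > 1 / infdist x K" using reals_Archimedean2 by blast
      have "s i x = 0" if "i \<ge> N" for i
      proof -
        have "1 / infdist x K \<le> real (Suc i)" using N that by linarith
        then show ?thesis using d by (simp add: s_def field_simps)
      qed
      then have "\<forall>\<^sub>F i in sequentially. s i x = 0" by (auto simp: eventually_sequentially)
      then show ?thesis using False by (simp add: tendsto_eventually)
    qed
  qed (use int assms K' in auto)
qed

text \<open>Inner regularity replaces the set by a closed subset up to small measure, and
  intersecting with growing balls reduces closed sets to compact ones.\<close>

lemma L1_approx_borel_indicator:
  fixes A :: "'a::euclidean_space set"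
  assumes A: "A \<in> sets lborel" "emeasure lborel A < \<infinity>"
  shows "L1_approx (indicator A :: 'a \<Rightarrow> real)"
proof -
  have int: "integrable lborel (indicator B :: 'a \<Rightarrow> real)" if "B \<in> sets borel" "B \<subseteq> A" for B
    using that A by (intro integrable_real_indicator) (auto intro: le_less_trans[OF emeasure_mono])
  have closed: "L1_approx (indicator T :: 'a \<Rightarrow> real)" if T: "closed T" "T \<subseteq> A" for T
  proof (rule L1_approx_dominated[where s="\<lambda>i. indicator (T \<inter> cball 0 (real i))" and w="indicator T"])
    fix i :: nat
    show "integrable lborel (indicator (T \<inter> cball 0 (real i)) :: 'a \<Rightarrow> real)"
      using T by (intro int) auto
    show "L1_approx (indicator (T \<inter> cball 0 (real i)) :: 'a \<Rightarrow> real)"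
      using T by (intro L1_approx_compact closed_Int_compact) auto
  next
    fix x :: 'a
    obtain N where "norm x \<le> real N" using real_arch_simple by blast
    then have "\<forall>\<^sub>F i in sequentially. indicator (T \<inter> cball 0 (real i)) x = (indicator T x :: real)"
      by (intro eventually_sequentiallyI[of N]) (auto simp: indicator_def)
    then show "(\<lambda>i. indicator (T \<inter> cball 0 (real i)) x) \<longlonglongrightarrow> (indicator T x :: real)"
      by (rule tendsto_eventually)
  qed (use int T in \<open>auto simp: indicator_def\<close>)
  show ?thesis
  proof (rule L1_approx_limit)
    fix \<epsilon> :: real assume "\<epsilon> > 0"
    have "A \<in> sets lebesgue" using A by auto
    then obtain T where T: "closed T" "T \<subseteq> A" "emeasure lebesgue (A - T) < ennreal \<epsilon>"
      using sets_lebesgue_inner_closed[OF _ \<open>\<epsilon> > 0\<close>] by metis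
    have AT: "A - T \<in> sets lborel" using A T by auto
    then have em: "emeasure lborel (A - T) < ennreal \<epsilon>" using T(3) by (simp add: emeasure_completion)
    have "(\<integral>x. \<bar>indicator A x - indicator T x\<bar> \<partial>lborel) = (\<integral>x. indicator (A - T) x \<partial>(lborel :: 'a measure) :: real)"
      using T(2) by (intro Bochner_Integration.integral_cong) (auto simp: indicator_def)
    also have "\<dots> = measure lborel (A - T)" using AT by simp
    also have "\<dots> < \<epsilon>"
    proof -
      have "emeasure lborel (A - T) = ennreal (measure lborel (A - T))"
        using em by (intro emeasure_eq_ennreal_measure) (auto simp: top_unique)
      then show ?thesis using em by (simp add: ennreal_less_iff)
    qed
    finally have "(\<integral>x. \<bar>indicator A x - indicator T x\<bar> \<partial>lborel) < \<epsilon>" .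
    moreover have "integrable lborel (indicator T :: 'a \<Rightarrow> real)" using T by (intro int) auto
    ultimately show "\<exists>h. integrable lborel h \<and> L1_approx h \<and> (\<integral>x. \<bar>indicator A x - h x\<bar> \<partial>lborel) < \<epsilon>"
      using closed[OF T(1,2)] by (intro exI[of _ "indicator T"] conjI)
  qed (use int A in auto)
qed

lemma integrable_imp_L1_approx:
  fixes f :: "'a::euclidean_space \<Rightarrow> real"
  assumes "integrable lborel f"
  shows "L1_approx f"
  using assms
proof (induction rule: integrable_induct)
  case (base A c)
  have "integrable lborel (indicator A :: 'a \<Rightarrow> real)" using base by (intro integrable_real_indicator) auto
  then show ?case using L1_approx_cmult[OF _ L1_approx_borel_indicator[OF base]] by simp
next
  case (add f g)
  then show ?case by (intro L1_approx_add)
next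
  case (lim f s)
  show ?case
    by (rule L1_approx_dominated[where s=s and w="\<lambda>x. 2 * norm (f x)"]) (use lim in auto)
qed

text \<open>For a compactly supported continuous function this is uniform continuity. In general the
  approximation error is counted twice, once translated, and translation does not change it; hence
  thirds of \<open>\<epsilon>\<close>.\<close>

lemma L1_translation_continuous:
  fixes f :: "'a::euclidean_space \<Rightarrow> real"
  assumes f: "integrable lborel f" and "\<epsilon> > 0"
  obtains \<delta> where "\<delta> > 0" "\<And>c. norm c < \<delta> \<Longrightarrow> (\<integral>x. \<bar>f (c + x) - f x\<bar> \<partial>lborel) \<le> \<epsilon>"
proof -
  obtain g K where g: "continuous_on UNIV g" "compact K" "\<forall>z. z \<notin> K \<longrightarrow> g z = 0" "(\<integral>x. \<bar>f x - g x\<bar> \<partial>lborel) < \<epsilon>/3"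
    using integrable_imp_L1_approx[OF f] \<open>\<epsilon> > 0\<close> unfolding L1_approx_def by (metis divide_pos_pos zero_less_numeral)
  have gi: "integrable lborel g" using continuous_compact_support_integrable[OF g(1,2)] g(3) by blast
  \<comment> \<open>Contains every \<open>x\<close> for which \<open>g x\<close> or
    \<open>g (c + x)\<close> can be nonzero when \<open>norm c < 1\<close>. The larger set
    \<open>K2\<close> below also contains the shifted points, so that uniform continuity applies to
    both arguments.\<close>
  define K' where "K' = {x - y |x y. x \<in> K \<and> y \<in> cball (0::'a) 1}"
  have K': "compact K'" unfolding K'_def
    by (intro compact_differences g compact_cball)
  define m where "m = measure lborel K' + 1"
  have m: "m > 0" unfolding m_def by (smt (verit) measure_nonneg)
  have K'i: "integrable lborel (indicator K' :: 'a \<Rightarrow> real)"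
    using emeasure_compact_finite[OF K'] borel_compact[OF K'] by (intro integrable_real_indicator) auto
  define K2 where "K2 = {x + y |x y. x \<in> K' \<and> y \<in> cball (0::'a) 1}"
  have K2: "compact K2" unfolding K2_def by (intro compact_sums K' compact_cball)
  have "uniformly_continuous_on K2 g"
    by (rule compact_uniformly_continuous[OF continuous_on_subset[OF g(1)] K2]) auto
  then obtain d where d: "d > 0" "\<And>x y. x \<in> K2 \<Longrightarrow> y \<in> K2 \<Longrightarrow> dist y x < d \<Longrightarrow> dist (g y) (g x) < \<epsilon>/(3*m)"
    unfolding uniformly_continuous_on_def using \<open>\<epsilon> > 0\<close> m by (metis divide_pos_pos mult_pos_pos zero_less_numeral)
  show ?thesis
  proof (rule that[of "min 1 d"])
    show "min 1 d > 0" using d by simp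
    fix c :: 'a assume c: "norm c < min 1 d"
    have gc: "\<bar>g (c + x) - g x\<bar> \<le> \<epsilon>/(3*m) * indicator K' x" for x
    proof (cases "x \<in> K'")
      case True
      have "x + c \<in> K2" unfolding K2_def using True c by (intro CollectI exI[of _ x] exI[of _ c]) auto
      moreover have "x + 0 \<in> K2" unfolding K2_def using True by (intro CollectI exI[of _ x] exI[of _ 0]) auto
      ultimately have "dist (g (x + c)) (g x) < \<epsilon>/(3*m)" using c by (intro d(2)) (auto simp: dist_norm)
      then show ?thesis using True by (simp add: dist_real_def add.commute)
    next
      case False
      have "x \<notin> K" "c + x \<notin> K"
      proof -
        show "x \<notin> K"
        proof
          assume "x \<in> K"
          then have "x - 0 \<in> K'" unfolding K'_def by (intro CollectI exI[of _ x] exI[of _ 0]) auto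
          then show False using False by simp
        qed
        show "c + x \<notin> K"
        proof
          assume "c + x \<in> K"
          then have "(c + x) - c \<in> K'" unfolding K'_def using c by (intro CollectI exI[of _ "c + x"] exI[of _ c]) auto
          then show False using False by simp
        qed
      qed
      then show ?thesis using g(3) \<open>\<epsilon> > 0\<close> m by simp
    qed
    note tr = lborel_integrable_translate
    have "(\<integral>x. \<bar>f (c + x) - f x\<bar> \<partial>lborel) \<le>
        (\<integral>x. \<bar>f (c + x) - g (c + x)\<bar> + (\<epsilon>/(3*m) * indicator K' x + \<bar>f x - g x\<bar>) \<partial>lborel)"
    proof (rule integral_mono)
      show "integrable lborel (\<lambda>x. \<bar>f (c + x) - f x\<bar>)" using f tr[OF f, of c] by auto
      show "integrable lborel (\<lambda>x. \<bar>f (c + x) - g (c + x)\<bar> + (\<epsilon>/(3*m) * indicator K' x + \<bar>f x - g x\<bar>))"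
        using f gi tr[OF f, of c] tr[OF gi, of c] K'i by (intro Bochner_Integration.integrable_add integrable_abs Bochner_Integration.integrable_diff integrable_mult_right) auto
      show "\<bar>f (c + x) - f x\<bar> \<le> \<bar>f (c + x) - g (c + x)\<bar> + (\<epsilon>/(3*m) * indicator K' x + \<bar>f x - g x\<bar>)" for x
        using gc[of x] by linarith
    qed
    also have "\<dots> = (\<integral>x. \<bar>f (c + x) - g (c + x)\<bar> \<partial>lborel) + (\<epsilon>/(3*m) * measure lborel K' + (\<integral>x. \<bar>f x - g x\<bar> \<partial>lborel))"
    proof -
      have i1: "integrable lborel (\<lambda>x. \<bar>f (c + x) - g (c + x)\<bar>)" "integrable lborel (\<lambda>x. \<bar>f x - g x\<bar>)"
        "integrable lborel (\<lambda>x. \<epsilon>/(3*m) * indicator K' x)"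
        using f gi tr[OF f, of c] tr[OF gi, of c] K'i by auto
      have "integral\<^sup>L lborel (\<lambda>x. \<epsilon>/(3*m) * indicator K' x) = \<epsilon>/(3*m) * measure lborel K'"
        using borel_compact[OF K'] by simp
      then show ?thesis using i1 by simp
    qed
    also have "(\<integral>x. \<bar>f (c + x) - g (c + x)\<bar> \<partial>lborel) = (\<integral>x. \<bar>f x - g x\<bar> \<partial>lborel)"
      by (rule lborel_integral_translate[of "\<lambda>x. \<bar>f x - g x\<bar>"]) (use f gi in auto)
    also have "\<epsilon>/(3*m) * measure lborel K' \<le> \<epsilon>/3"
      using m \<open>\<epsilon> > 0\<close> by (simp add: m_def field_simps)
    finally show "(\<integral>x. \<bar>f (c + x) - f x\<bar> \<partial>lborel) \<le> \<epsilon>" using g(4) by simp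
  qed
qed

text \<open>By Fubini the \<open>L^1\<close> norm of the mean oscillation at scale
  \<open>\<tau> i\<close> is an average of the translation moduli \<open>N c\<close> over small
  \<open>c\<close>, hence tends to 0; convergence in \<open>L^1\<close> yields almost everywhere
  convergence along a subsequence. A subsequence is all that is needed below, and no covering
  argument or maximal function enters.\<close>

lemma lebesgue_points_subsequence:
  fixes f :: "'a::euclidean_space \<Rightarrow> real" and \<tau> :: "nat \<Rightarrow> real"
  assumes f: "integrable lborel f" and \<tau>: "\<And>i. \<tau> i > 0" "\<tau> \<longlonglongrightarrow> 0"
  obtains r where "strict_mono r"
    "AE x in lborel. (\<lambda>i. (\<integral>y. indicator (ball x (\<tau> (r i))) y * \<bar>f y - f x\<bar> \<partial>lborel) / \<tau> (r i) ^ DIM('a)) \<longlonglongrightarrow> 0"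
proof -
  define u where "u i x = (\<integral>y. indicator (ball x (\<tau> i)) y * \<bar>f y - f x\<bar> \<partial>lborel) / \<tau> i ^ DIM('a)" for i x
  \<comment> \<open>Substituting \<open>y = c + x\<close> makes the domain of \<open>c\<close>
    independent of \<open>x\<close>, which is what the interchange of integrals needs.\<close>
  define F where "F i c x = indicator (ball 0 (\<tau> i)) c * \<bar>f (c + x) - f x\<bar>" for i and c x :: 'a
  have fm[measurable]: "f \<in> borel_measurable borel" using f by auto
  have Fm: "case_prod (F i) \<in> borel_measurable (lborel \<Otimes>\<^sub>M lborel)" for i
  proof -
    have "(\<lambda>p. (if norm (fst p) < \<tau> i then 1 else 0) * \<bar>f (fst p + snd p) - f (snd p)\<bar>) \<in> borel_measurable (borel \<Otimes>\<^sub>M borel)"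
      by measurable
    moreover have "case_prod (F i) = (\<lambda>p. (if norm (fst p) < \<tau> i then 1 else 0) * \<bar>f (fst p + snd p) - f (snd p)\<bar>)"
      by (auto simp: F_def fun_eq_iff)
    moreover have "measurable (lborel \<Otimes>\<^sub>M lborel) borel = measurable (borel \<Otimes>\<^sub>M borel :: ('a \<times> 'a) measure) (borel :: real measure)"
      by (intro measurable_cong_sets sets_pair_measure_cong) auto
    ultimately show ?thesis by simp
  qed
  have uF: "(\<integral>c. F i c x \<partial>lborel) / \<tau> i ^ DIM('a) = u i x" for i x
  proof -
    have "(\<integral>y. indicator (ball x (\<tau> i)) y * \<bar>f y - f x\<bar> \<partial>lborel)
       = (\<integral>c. indicator (ball x (\<tau> i)) (x + c) * \<bar>f (x + c) - f x\<bar> \<partial>lborel)"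
      by (rule lborel_integral_translate[symmetric])
         (intro borel_measurable_times borel_measurable_indicator borel_measurable_abs borel_measurable_diff fm; simp)
    also have "\<dots> = (\<integral>c. F i c x \<partial>lborel)"
      unfolding F_def by (intro Bochner_Integration.integral_cong) (auto simp: indicator_def dist_norm add.commute)
    finally show ?thesis by (simp add: u_def)
  qed
  have Fx: "integrable lborel (F i c)" for i c
    unfolding F_def using f lborel_integrable_translate[OF f, of c] by (intro integrable_mult_right) auto
  have Fn: "\<bar>F i c x\<bar> = F i c x" for i c x by (simp add: F_def)
  define N where "N c = (\<integral>x. \<bar>f (c + x) - f x\<bar> \<partial>lborel)" for c
  have FN: "(\<integral>x. F i c x \<partial>lborel) = indicator (ball 0 (\<tau> i)) c * N c" for i c
    by (simp add: F_def N_def)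
  have Nm: "N \<in> borel_measurable lborel"
    unfolding N_def[abs_def] by (rule lborel.borel_measurable_lebesgue_integral) measurable
  have ball_int: "integrable lborel (indicator (ball 0 (\<tau> i)) :: 'a \<Rightarrow> real)" for i
    using emeasure_bounded_finite[OF bounded_ball] by (intro integrable_real_indicator) auto
  have N2: "\<bar>N c\<bar> \<le> 2 * (\<integral>x. \<bar>f x\<bar> \<partial>lborel)" for c
  proof -
    have "N c \<le> (\<integral>x. \<bar>f (c + x)\<bar> + \<bar>f x\<bar> \<partial>lborel)"
      unfolding N_def using f lborel_integrable_translate[OF f, of c] by (intro integral_mono) auto
    also have "\<dots> = (\<integral>x. \<bar>f (c + x)\<bar> \<partial>lborel) + (\<integral>x. \<bar>f x\<bar> \<partial>lborel)"
      using f lborel_integrable_translate[OF f, of c] by (intro Bochner_Integration.integral_add) auto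
    also have "(\<integral>x. \<bar>f (c + x)\<bar> \<partial>lborel) = (\<integral>x. \<bar>f x\<bar> \<partial>lborel)"
      by (rule lborel_integral_translate[of "\<lambda>x. \<bar>f x\<bar>"]) measurable
    finally show ?thesis by (simp add: N_def)
  qed
  have BN: "integrable lborel (\<lambda>c. indicator (ball 0 (\<tau> i)) c * N c)" for i
  proof (rule Bochner_Integration.integrable_bound)
    show "integrable lborel (\<lambda>c::'a. indicator (ball 0 (\<tau> i)) c * (2 * (\<integral>x. \<bar>f x\<bar> \<partial>lborel)))"
      using ball_int[of i] by (rule integrable_mult_left)
    show "AE c in lborel. norm (indicator (ball 0 (\<tau> i)) c * N c) \<le> norm (indicator (ball 0 (\<tau> i)) c * (2 * (\<integral>x. \<bar>f x\<bar> \<partial>lborel)))"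
      using N2 by (intro AE_I2) (auto simp: indicator_def intro: order_trans[OF _ abs_ge_self])
  qed (intro borel_measurable_times[OF borel_measurable_indicator Nm], simp)
  have Fint: "integrable (lborel \<Otimes>\<^sub>M lborel) (case_prod (F i))" for i
    by (rule lborel_pair.Fubini_integrable[OF Fm]) (simp_all add: Fn FN BN Fx)
  have ui: "integrable lborel (u i)" for i
    unfolding uF[symmetric, abs_def] by (intro integrable_divide lborel_pair.integrable_snd[OF Fint])
  have un: "norm (u i x) = u i x" for i x
    unfolding u_def using \<tau>(1)[of i] by (simp add: integral_nonneg_AE)
  define v where "v = unit_ball_vol (real DIM('a))"
  have Iu: "(\<integral>x. norm (u i x) \<partial>lborel) = (\<integral>c. indicator (ball 0 (\<tau> i)) c * N c \<partial>lborel) / \<tau> i ^ DIM('a)" for i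
    unfolding un unfolding uF[symmetric] using lborel_pair.Fubini_integral[OF Fint[of i]] by (simp add: FN)
  have "(\<lambda>i. \<integral>x. norm (u i x) \<partial>lborel) \<longlonglongrightarrow> 0"
  proof (rule LIMSEQ_I)
    fix e :: real assume "e > 0"
    then have "e / (v + 1) > 0" unfolding v_def by (simp add: add_nonneg_pos)
    then obtain \<delta> where \<delta>: "\<delta> > 0" "\<And>c. norm c < \<delta> \<Longrightarrow> N c \<le> e / (v + 1)"
      using L1_translation_continuous[OF f] unfolding N_def by blast
    have "\<forall>\<^sub>F i in sequentially. \<tau> i < \<delta>" using \<tau>(2) \<delta>(1) by (rule order_tendstoD)
    then obtain M where M: "\<And>i. i \<ge> M \<Longrightarrow> \<tau> i < \<delta>" by (auto simp: eventually_sequentially)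
    have "norm ((\<integral>x. norm (u i x) \<partial>lborel) - 0) < e" if "i \<ge> M" for i
    proof -
      have "(\<integral>c. indicator (ball 0 (\<tau> i)) c * N c \<partial>lborel) \<le> (\<integral>c. indicator (ball (0::'a) (\<tau> i)) c * (e / (v + 1)) \<partial>lborel)"
      proof (rule integral_mono[OF BN integrable_mult_left[OF ball_int]])
        show "indicator (ball 0 (\<tau> i)) c * N c \<le> indicator (ball 0 (\<tau> i)) c * (e / (v + 1))" for c
          using \<delta>(2)[of c] M[OF that] by (auto simp: indicator_def)
      qed
      also have "\<dots> = v * \<tau> i ^ DIM('a) * (e / (v + 1))"
        using \<tau>(1)[of i] by (simp add: content_ball v_def)
      finally have "(\<integral>x. norm (u i x) \<partial>lborel) \<le> v * (e / (v + 1))"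
        unfolding Iu using \<tau>(1)[of i] by (simp add: field_simps)
      also have "\<dots> < e" using \<open>e > 0\<close> unfolding v_def by (simp add: field_simps add_nonneg_pos)
      finally have "(\<integral>x. norm (u i x) \<partial>lborel) < e" .
      moreover have "0 \<le> (\<integral>x. norm (u i x) \<partial>lborel)" by (rule integral_nonneg_AE) simp
      ultimately show ?thesis by (simp only: diff_zero real_norm_def[of "integral\<^sup>L _ _"] abs_of_nonneg)
    qed
    then show "\<exists>M. \<forall>i\<ge>M. norm ((\<integral>x. norm (u i x) \<partial>lborel) - 0) < e" by blast
  qed
  from tendsto_L1_AE_subseq[OF ui this] obtain r where "strict_mono r" "AE x in lborel. (\<lambda>n. u (r n) x) \<longlonglongrightarrow> 0"
    by blast
  then show ?thesis using that by (simp add: u_def)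
qed

subsection \<open>Freezing the coefficients\<close>

lemma matrix_vector_mult_norm_bound:
  fixes A :: "complex^'n^'n"
  assumes "\<And>j k. norm (A $ j $ k) \<le> c"
  shows "norm (A *v \<xi>) \<le> (real CARD('n))\<^sup>2 * c * norm \<xi>"
proof -
  have "norm ((A *v \<xi>) $ j) \<le> real CARD('n) * (c * norm \<xi>)" for j
  proof -
    have "norm ((A *v \<xi>) $ j) \<le> (\<Sum>k\<in>UNIV. norm (A $ j $ k * \<xi> $ k))"
      unfolding matrix_vector_mult_def vec_lambda_beta by (rule norm_sum)
    also have "\<dots> \<le> (\<Sum>k\<in>(UNIV :: 'n set). c * norm \<xi>)"
    proof (rule sum_mono)
      fix k
      have "c \<ge> 0" using assms[of j k] norm_ge_zero order_trans by blast
      then show "norm (A $ j $ k * \<xi> $ k) \<le> c * norm \<xi>"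
        unfolding norm_mult by (intro mult_mono assms Finite_Cartesian_Product.norm_nth_le) auto
    qed
    finally show ?thesis by simp
  qed
  then have "(\<Sum>j\<in>UNIV. norm ((A *v \<xi>) $ j)) \<le> (\<Sum>j\<in>(UNIV::'n set). real CARD('n) * (c * norm \<xi>))"
    by (intro sum_mono)
  moreover have "norm (A *v \<xi>) \<le> (\<Sum>j\<in>UNIV. norm ((A *v \<xi>) $ j))"
    unfolding norm_vec_def by (rule L2_set_le_sum) simp
  ultimately show ?thesis by (simp add: power2_eq_square mult_ac)
qed

text \<open>Mean value inequality on a convex set; the operator norm of the derivative is bounded by
  its values on the basis, which are continuous on the compact ball.\<close>

lemma C1_lipschitz_on_cball:
  fixes f :: "complex^'n \<Rightarrow> complex"
  assumes f: "Ck_on 1 U f" "open U" and R: "cball z0 R \<subseteq> U"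
  obtains c where "c \<ge> 0" "\<And>x y. x \<in> cball z0 R \<Longrightarrow> y \<in> cball z0 R \<Longrightarrow> norm (f y - f x) \<le> c * norm (y - x)"
proof -
  have d: "(f has_derivative real_pderiv f z) (at z)" if "z \<in> U" for z
    using has_derivative_real_pderiv[OF differentiable_on_open_at[OF f that]] .
  have "bounded ((\<lambda>z. \<Sum>b\<in>Basis. norm (real_pderiv f z b)) ` cball z0 R)"
  proof (intro compact_imp_bounded compact_continuous_image compact_cball continuous_on_sum continuous_on_norm)
    show "continuous_on (cball z0 R) (\<lambda>z. real_pderiv f z b)" for b
      using f R by (auto intro: continuous_on_subset)
  qed
  then obtain c where c: "\<forall>z\<in>cball z0 R. \<bar>\<Sum>b\<in>Basis. norm (real_pderiv f z b)\<bar> \<le> c"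
    by (auto simp: bounded_iff)
  show ?thesis
  proof (rule that[of "\<bar>c\<bar>"])
    fix x y assume xy: "x \<in> cball z0 R" "y \<in> cball z0 R"
    show "norm (f y - f x) \<le> \<bar>c\<bar> * norm (y - x)"
    proof (rule differentiable_bound[OF convex_cball _ _ xy(2,1)])
      fix z assume z: "z \<in> cball z0 R"
      then have zU: "z \<in> U" using R by blast
      show "(f has_derivative real_pderiv f z) (at z within cball z0 R)"
        by (rule has_derivative_at_withinI[OF d[OF zU]])
      have "onorm (real_pderiv f z) \<le> (\<Sum>b\<in>Basis. norm (real_pderiv f z b))"
        by (rule onorm_componentwise[OF has_derivative_bounded_linear[OF d[OF zU]]])
      also have "\<dots> \<le> \<bar>c\<bar>" using c z by force
      finally show "onorm (real_pderiv f z) \<le> \<bar>c\<bar>" .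
    qed
  qed simp
qed

lemma coeff_mat_self_adjoint:
  fixes a :: "complex^'n \<Rightarrow> 'n \<Rightarrow> 'n \<Rightarrow> complex"
  assumes "admissible_form U a" "z \<in> U"
  shows "self_adjoint (coeff_mat a z)"
  unfolding self_adjoint_def
proof (intro allI)
  fix \<xi> \<eta> :: "complex^'n"
  have herm: "a z k j = cnj (a z j k)" for j k using assms unfolding admissible_form_def by blast
  have ic: "inner c d = Re (c * cnj d)" for c d by (simp add: inner_complex_def)
  have "inner \<xi> (coeff_mat a z *v \<eta>) = Re (\<Sum>j\<in>UNIV. \<Sum>k\<in>UNIV. \<xi> $ j * cnj (a z j k * \<eta> $ k))"
    by (simp only: inner_vec_def coeff_mat_def matrix_vector_mult_def vec_lambda_beta ic cnj_sum sum_distrib_left Re_sum)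
  also have "\<dots> = Re (\<Sum>j\<in>UNIV. \<Sum>k\<in>UNIV. a z k j * \<xi> $ j * cnj (\<eta> $ k))"
    by (intro arg_cong[where f=Re] sum.cong refl)
      (simp only: complex_cnj_mult herm[symmetric] mult_ac)
  also have "\<dots> = Re (\<Sum>k\<in>UNIV. \<Sum>j\<in>UNIV. a z k j * \<xi> $ j * cnj (\<eta> $ k))"
    by (subst sum.swap) (rule refl)
  also have "\<dots> = inner (coeff_mat a z *v \<xi>) \<eta>"
    by (simp only: inner_vec_def coeff_mat_def matrix_vector_mult_def vec_lambda_beta ic sum_distrib_right Re_sum)
  finally show "inner (coeff_mat a z *v \<xi>) \<eta> = inner \<xi> (coeff_mat a z *v \<eta>)" by simp
qed

text \<open>The definition of the form pairs \<open>a z j k\<close> with \<open>\<xi>\<close> in the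
  first index and the conjugate in the second, whereas the matrix acts through its second index.
  Positivity therefore has to be applied to the conjugate vector.\<close>

lemma coeff_mat_positive:
  fixes a :: "complex^'n \<Rightarrow> 'n \<Rightarrow> 'n \<Rightarrow> complex"
  assumes "admissible_form U a" "z \<in> U" "\<xi> \<noteq> 0"
  shows "inner (coeff_mat a z *v \<xi>) \<xi> > 0"
proof -
  define \<eta> where "\<eta> = (\<chi> i. cnj (\<xi> $ i))"
  have "\<eta> \<noteq> 0" using assms(3) by (auto simp: \<eta>_def vec_eq_iff)
  then have "Re (\<Sum>j\<in>UNIV. \<Sum>k\<in>UNIV. a z j k * \<eta> $ j * cnj (\<eta> $ k)) > 0"
    using assms unfolding admissible_form_def by blast
  then show ?thesis by (simp add: inner_coeff_mat \<eta>_def mult_ac)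
qed

lemma coeff_mat_diff_bound:
  fixes a :: "complex^'n \<Rightarrow> 'n \<Rightarrow> 'n \<Rightarrow> complex"
  assumes "admissible_form U a" "cball z0 R \<subseteq> U"
  obtains c where "c \<ge> 0"
    "\<And>x y j k. x \<in> cball z0 R \<Longrightarrow> y \<in> cball z0 R \<Longrightarrow> norm (a y j k - a x j k) \<le> c * norm (y - x)"
proof -
  have "\<forall>j k. \<exists>c\<ge>0. \<forall>x\<in>cball z0 R. \<forall>y\<in>cball z0 R. norm (a y j k - a x j k) \<le> c * norm (y - x)"
  proof (intro allI)
    fix j k
    obtain c where "c \<ge> 0" "\<And>x y. x \<in> cball z0 R \<Longrightarrow> y \<in> cball z0 R \<Longrightarrow> norm (a y j k - a x j k) \<le> c * norm (y - x)"
      by (rule C1_lipschitz_on_cball[of U "\<lambda>z. a z j k" z0 R]) (use assms in \<open>unfold admissible_form_def, blast+\<close>)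
    then show "\<exists>c\<ge>0. \<forall>x\<in>cball z0 R. \<forall>y\<in>cball z0 R. norm (a y j k - a x j k) \<le> c * norm (y - x)" by blast
  qed
  then obtain c where c: "\<And>j k. c j k \<ge> 0"
    "\<And>j k x y. x \<in> cball z0 R \<Longrightarrow> y \<in> cball z0 R \<Longrightarrow> norm (a y j k - a x j k) \<le> c j k * norm (y - x)"
    by metis
  define C where "C = (\<Sum>j\<in>UNIV. \<Sum>k\<in>UNIV. c j k)"
  have le: "c j k \<le> C" for j k
  proof -
    have "c j k \<le> (\<Sum>k\<in>UNIV. c j k)" using c(1) by (intro member_le_sum) auto
    also have "\<dots> \<le> C" unfolding C_def using c(1)
      by (intro member_le_sum[of j UNIV "\<lambda>j. \<Sum>k\<in>UNIV. c j k"]) (auto intro: sum_nonneg)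
    finally show ?thesis .
  qed
  show ?thesis
  proof (rule that[of C])
    show "C \<ge> 0" unfolding C_def using c(1) by (intro sum_nonneg) auto
    show "norm (a y j k - a x j k) \<le> C * norm (y - x)" if "x \<in> cball z0 R" "y \<in> cball z0 R" for x y j k
      using order_trans[OF c(2)[OF that, of j k] mult_right_mono[OF le[of j k] norm_ge_zero]] .
  qed
qed

text \<open>\<open>B x\<close> is the inverse of the coefficient matrix at \<open>x\<close>. At
  \<open>y = x\<close> the two coefficients in \<open>alpha_ddc_radial\<close> have their frozen
  values exactly; for other \<open>y\<close> the error is the Lipschitz error of the coefficients,
  measured in the quadratic form of \<open>B x\<close>. One radius and one set of constants serve
  all centres near \<open>z0\<close>.\<close>

lemma frozen_inverse:
  fixes a :: "complex^'n \<Rightarrow> 'n \<Rightarrow> 'n \<Rightarrow> complex"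
  assumes form: "admissible_form U a" and V: "open V" "z0 \<in> V" "V \<subseteq> U"
  obtains R C1 \<kappa> and B :: "complex^'n \<Rightarrow> complex^'n^'n" where
    "R > 0" "C1 > 0" "\<kappa> > 0" "cball z0 R \<subseteq> V"
    "\<And>x. x \<in> cball z0 R \<Longrightarrow> self_adjoint (B x)"
    "\<And>x \<zeta>. x \<in> cball z0 R \<Longrightarrow> \<kappa> * (norm \<zeta>)\<^sup>2 \<le> quad_form (B x) \<zeta>"
    "\<And>x y. x \<in> cball z0 R \<Longrightarrow> y \<in> cball z0 R \<Longrightarrow>
       \<bar>inner (coeff_mat a y *v (B x *v (y - x))) (B x *v (y - x)) - quad_form (B x) (y - x)\<bar>
         \<le> C1 * quad_form (B x) (y - x) * sqrt (quad_form (B x) (y - x))"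
    "\<And>x y. x \<in> cball z0 R \<Longrightarrow> y \<in> cball z0 R \<Longrightarrow>
       \<bar>Re (trace (coeff_mat a y ** B x)) - real CARD('n)\<bar> \<le> C1 * sqrt (quad_form (B x) (y - x))"
    "\<And>y. continuous_on (cball z0 R) (\<lambda>x. quad_form (B x) (y - x))"
proof -
  let ?A = "coeff_mat a"
  let ?n = "real CARD('n)"
  obtain R0 where R0: "R0 > 0" "cball z0 R0 \<subseteq> V" using V open_contains_cball by blast
  obtain c where c: "c \<ge> 0"
    "\<And>x y j k. x \<in> cball z0 R0 \<Longrightarrow> y \<in> cball z0 R0 \<Longrightarrow> norm (a y j k - a x j k) \<le> c * norm (y - x)"
    by (rule coeff_mat_diff_bound[OF form, of z0 R0]) (use R0 V in auto)
  define L where "L = ?n\<^sup>2 * c"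
  have L0: "L \<ge> 0" using c by (simp add: L_def)
  have Alip: "norm (?A y *v \<xi> - ?A x *v \<xi>) \<le> L * norm (y - x) * norm \<xi>"
    if "x \<in> cball z0 R0" "y \<in> cball z0 R0" for x y \<xi>
  proof -
    have "norm ((?A y - ?A x) *v \<xi>) \<le> ?n\<^sup>2 * (c * norm (y - x)) * norm \<xi>"
      by (rule matrix_vector_mult_norm_bound) (use c(2)[OF that] in \<open>simp add: coeff_mat_def\<close>)
    then show ?thesis by (simp add: L_def matrix_vector_mult_diff_rdistrib mult_ac)
  qed
  have blA: "bounded_linear (\<lambda>\<xi>. ?A z0 *v \<xi>)" by (rule bounded_linear_matrix_complex)
  obtain M0 where M0: "M0 > 0" "\<And>\<xi>. norm (?A z0 *v \<xi>) \<le> M0 * norm \<xi>"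
    using bounded_linear.pos_bounded[OF blA] by (metis mult.commute)
  obtain \<mu>0 where \<mu>0: "\<mu>0 > 0" "\<And>\<xi>. inner (?A z0 *v \<xi>) \<xi> \<ge> \<mu>0 * (norm \<xi>)\<^sup>2"
  proof -
    have cont: "continuous_on (sphere 0 1) (\<lambda>\<xi>. inner (?A z0 *v \<xi>) \<xi>)"
      by (intro continuous_intros bounded_linear.continuous_on[OF blA])
    have ne: "sphere (0::complex^'n) 1 \<noteq> {}" by simp
    obtain \<xi>0 where \<xi>0: "\<xi>0 \<in> sphere 0 1" "\<forall>\<xi>\<in>sphere 0 1. inner (?A z0 *v \<xi>0) \<xi>0 \<le> inner (?A z0 *v \<xi>) \<xi>"
      using continuous_attains_inf[OF compact_sphere ne cont] by blast
    define m where "m = inner (?A z0 *v \<xi>0) \<xi>0"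
    have "\<xi>0 \<noteq> 0" using \<xi>0(1) by auto
    then have m: "m > 0" unfolding m_def using coeff_mat_positive[OF form] V by blast
    have "inner (?A z0 *v \<xi>) \<xi> \<ge> m * (norm \<xi>)\<^sup>2" for \<xi>
    proof (cases "\<xi> = 0")
      case False
      define \<eta> where "\<eta> = (1 / norm \<xi>) *\<^sub>R \<xi>"
      have "\<eta> \<in> sphere 0 1" using False by (simp add: \<eta>_def)
      then have "m \<le> inner (?A z0 *v \<eta>) \<eta>" using \<xi>0 by (simp add: m_def)
      moreover have "\<xi> = norm \<xi> *\<^sub>R \<eta>" using False by (simp add: \<eta>_def)
      then have "inner (?A z0 *v \<xi>) \<xi> = (norm \<xi>)\<^sup>2 * inner (?A z0 *v \<eta>) \<eta>"
        using linear_cmul[OF bounded_linear.linear[OF blA], of "norm \<xi>" \<eta>]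
        by (metis inner_scaleR_left inner_scaleR_right mult.assoc power2_eq_square)
      ultimately show ?thesis by (metis mult.commute mult_left_mono zero_le_power2)
    qed simp
    then show ?thesis using that m by blast
  qed
  \<comment> \<open>Within this radius the coefficients move so little that half of the coercivity
    constant \<open>\<mu>0\<close> at \<open>z0\<close> survives; \<open>L + 1\<close> avoids
    dividing by 0.\<close>
  define R where "R = min R0 (\<mu>0 / (2 * (L + 1)))"
  define \<mu> where "\<mu> = \<mu>0 / 2"
  define MA where "MA = M0 + L * R0 + 1"
  have R: "R > 0" "R \<le> R0" "R \<le> \<mu>0 / (2 * (L + 1))" using R0 \<mu>0 L0 by (auto simp: R_def)
  have \<mu>: "\<mu> > 0" using \<mu>0 by (simp add: \<mu>_def)
  have MA: "MA > 0" using M0 L0 R0 by (auto simp: MA_def intro!: add_nonneg_pos add_nonneg_nonneg)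
  have sub: "cball z0 R \<subseteq> cball z0 R0" using R by auto
  have z0R: "z0 \<in> cball z0 R0" using R0 by simp
  have coer: "\<mu> * (norm \<xi>)\<^sup>2 \<le> inner (?A x *v \<xi>) \<xi>" if "x \<in> cball z0 R" for x \<xi>
  proof -
    have "inner (?A x *v \<xi>) \<xi> = inner (?A z0 *v \<xi>) \<xi> + inner (?A x *v \<xi> - ?A z0 *v \<xi>) \<xi>"
      by (simp add: inner_diff_left)
    moreover have "\<bar>inner (?A x *v \<xi> - ?A z0 *v \<xi>) \<xi>\<bar> \<le> (L * norm (x - z0) * norm \<xi>) * norm \<xi>"
      by (rule order_trans[OF Cauchy_Schwarz_ineq2 mult_right_mono[OF Alip[OF z0R]]]) (use that sub in auto)
    moreover have "L * norm (x - z0) \<le> \<mu>"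
    proof -
      have "norm (x - z0) \<le> \<mu>0 / (2 * (L + 1))" using that R by (simp add: dist_norm norm_minus_commute)
      then have "L * norm (x - z0) \<le> L * (\<mu>0 / (2 * (L + 1)))" using L0 by (rule mult_left_mono)
      also have "\<dots> \<le> \<mu>" using L0 \<mu>0 by (simp add: \<mu>_def field_simps)
      finally show ?thesis .
    qed
    then have "L * norm (x - z0) * (norm \<xi> * norm \<xi>) \<le> \<mu> * (norm \<xi> * norm \<xi>)"
      by (rule mult_right_mono) simp
    ultimately show ?thesis using \<mu>0(2)[of \<xi>] by (simp add: \<mu>_def power2_eq_square mult_ac abs_le_iff)
  qed
  have Abd: "norm (?A x *v \<xi>) \<le> MA * norm \<xi>" if "x \<in> cball z0 R" for x \<xi>
  proof -
    have "norm (?A x *v \<xi>) \<le> norm (?A z0 *v \<xi>) + norm (?A x *v \<xi> - ?A z0 *v \<xi>)"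
      by (rule norm_triangle_sub)
    also have "\<dots> \<le> M0 * norm \<xi> + L * R0 * norm \<xi>"
    proof (intro add_mono M0)
      have "norm (?A x *v \<xi> - ?A z0 *v \<xi>) \<le> L * norm (x - z0) * norm \<xi>"
        using Alip[OF z0R, of x \<xi>] that sub by auto
      also have "\<dots> \<le> L * R0 * norm \<xi>"
        using that R L0 by (intro mult_right_mono mult_left_mono) (auto simp: dist_norm norm_minus_commute)
      finally show "norm (?A x *v \<xi> - ?A z0 *v \<xi>) \<le> L * R0 * norm \<xi>" .
    qed
    also have "\<dots> \<le> MA * norm \<xi>" by (simp add: MA_def algebra_simps)
    finally show ?thesis .
  qed
  have "\<exists>B. ?A x ** B = mat 1" if x: "x \<in> cball z0 R" for x
  proof -
    have "\<forall>\<xi>. ?A x *v \<xi> = 0 \<longrightarrow> \<xi> = 0"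
    proof (intro allI impI)
      fix \<xi> :: "complex^'n" assume "?A x *v \<xi> = 0"
      then have "\<mu> * (norm \<xi>)\<^sup>2 \<le> 0" using coer[OF x, of \<xi>] by simp
      then show "\<xi> = 0" using \<mu> by (simp add: mult_le_0_iff)
    qed
    then show ?thesis using matrix_left_invertible_ker[of "?A x"] matrix_left_right_inverse by blast
  qed
  then obtain B where B: "\<And>x. x \<in> cball z0 R \<Longrightarrow> ?A x ** B x = mat 1" by metis
  have AB: "?A x *v (B x *v \<zeta>) = \<zeta>" if "x \<in> cball z0 R" for x \<zeta>
    using B[OF that] by (simp add: matrix_vector_mul_assoc)
  have Pbd: "norm (B x *v \<zeta>) \<le> norm \<zeta> / \<mu>" if x: "x \<in> cball z0 R" for x \<zeta>
  proof (cases "B x *v \<zeta> = 0")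
    case True
    then show ?thesis using \<mu> by simp
  next
    case False
    have "\<mu> * (norm (B x *v \<zeta>))\<^sup>2 \<le> inner \<zeta> (B x *v \<zeta>)" using coer[OF x, of "B x *v \<zeta>"] AB[OF x] by simp
    also have "\<dots> \<le> norm \<zeta> * norm (B x *v \<zeta>)" by (rule norm_cauchy_schwarz)
    finally have "(\<mu> * norm (B x *v \<zeta>)) * norm (B x *v \<zeta>) \<le> norm \<zeta> * norm (B x *v \<zeta>)"
      by (simp add: power2_eq_square mult_ac)
    then have "\<mu> * norm (B x *v \<zeta>) \<le> norm \<zeta>" using False by simp
    then show ?thesis using \<mu> by (simp add: field_simps)
  qed
  have qA: "quad_form (B x) \<zeta> = inner (?A x *v (B x *v \<zeta>)) (B x *v \<zeta>)" if "x \<in> cball z0 R" for x \<zeta>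
    using AB[OF that] by (simp add: quad_form_def inner_commute)
  \<comment> \<open>As the coefficient matrix sends \<open>B x *v \<zeta>\<close> to
    \<open>\<zeta>\<close>, the norm of \<open>\<zeta>\<close> is at most \<open>MA\<close> times
    that of \<open>B x *v \<zeta>\<close>, while the quadratic form is at least \<open>\<mu>\<close>
    times the square of the latter.\<close>
  define \<kappa> where "\<kappa> = \<mu> / MA\<^sup>2"
  have \<kappa>: "\<kappa> > 0" using \<mu> MA by (simp add: \<kappa>_def)
  have qlow: "\<kappa> * (norm \<zeta>)\<^sup>2 \<le> quad_form (B x) \<zeta>" if x: "x \<in> cball z0 R" for x \<zeta>
  proof -
    have "norm \<zeta> \<le> MA * norm (B x *v \<zeta>)" using Abd[OF x, of "B x *v \<zeta>"] AB[OF x] by simp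
    then have "(norm \<zeta>)\<^sup>2 \<le> (MA * norm (B x *v \<zeta>))\<^sup>2" by (intro power_mono) auto
    then have "\<kappa> * (norm \<zeta>)\<^sup>2 \<le> \<kappa> * (MA * norm (B x *v \<zeta>))\<^sup>2" using \<kappa> by simp
    also have "\<dots> = \<mu> * (norm (B x *v \<zeta>))\<^sup>2" using MA by (simp add: \<kappa>_def power_mult_distrib)
    also have "\<dots> \<le> quad_form (B x) \<zeta>" using coer[OF x] qA[OF x] by simp
    finally show ?thesis .
  qed
  have nq: "norm \<zeta> \<le> sqrt (quad_form (B x) \<zeta>) / sqrt \<kappa>" if x: "x \<in> cball z0 R" for x \<zeta>
  proof -
    have "sqrt (\<kappa> * (norm \<zeta>)\<^sup>2) \<le> sqrt (quad_form (B x) \<zeta>)" by (rule real_sqrt_le_mono[OF qlow[OF x]])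
    then show ?thesis using \<kappa> by (simp add: real_sqrt_mult field_simps)
  qed
  have q0: "quad_form (B x) \<zeta> \<ge> 0" if x: "x \<in> cball z0 R" for x \<zeta>
    using order_trans[OF _ qlow[OF x, of \<zeta>]] \<kappa> by simp
  \<comment> \<open>Both errors are converted from norms to the quadratic form by \<open>nq\<close>:
    the second order coefficient has a cubic error in the distance, the trace a linear one. The
    final 1 makes the constant positive.\<close>
  define C1 where "C1 = L / (\<mu>\<^sup>2 * (\<kappa> * sqrt \<kappa>)) + ?n\<^sup>2 * c / (\<mu> * sqrt \<kappa>) + 1"
  have parts: "L / (\<mu>\<^sup>2 * (\<kappa> * sqrt \<kappa>)) \<ge> 0" "?n\<^sup>2 * c / (\<mu> * sqrt \<kappa>) \<ge> 0"
    using L0 c \<mu> \<kappa> by simp_all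
  then have C1: "C1 > 0" "L / (\<mu>\<^sup>2 * (\<kappa> * sqrt \<kappa>)) \<le> C1" "?n\<^sup>2 * c / (\<mu> * sqrt \<kappa>) \<le> C1"
    by (auto simp: C1_def)
  show ?thesis
  proof (rule that[of R C1 \<kappa> B])
    show "self_adjoint (B x)" if x: "x \<in> cball z0 R" for x
      unfolding self_adjoint_def
    proof (intro allI)
      fix \<xi> \<eta> :: "complex^'n"
      have sa: "inner (?A x *v \<xi>) \<eta> = inner \<xi> (?A x *v \<eta>)" for \<xi> \<eta>
        using coeff_mat_self_adjoint[OF form, of x] subsetD[OF order_trans[OF order_trans[OF sub R0(2)] V(3)] x]
        unfolding self_adjoint_def by blast
      have "inner (B x *v \<xi>) \<eta> = inner (B x *v \<xi>) (?A x *v (B x *v \<eta>))" using AB[OF x] by simp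
      also have "\<dots> = inner \<xi> (B x *v \<eta>)" using AB[OF x] sa by metis
      finally show "inner (B x *v \<xi>) \<eta> = inner \<xi> (B x *v \<eta>)" .
    qed
    show "\<bar>inner (?A y *v (B x *v (y - x))) (B x *v (y - x)) - quad_form (B x) (y - x)\<bar>
         \<le> C1 * quad_form (B x) (y - x) * sqrt (quad_form (B x) (y - x))"
      if x: "x \<in> cball z0 R" and y: "y \<in> cball z0 R" for x y
    proof -
      define \<zeta> P q where "\<zeta> = y - x" and "P = B x *v \<zeta>" and "q = quad_form (B x) \<zeta>"
      have "inner (?A y *v P) P - q = inner (?A y *v P - ?A x *v P) P"
        unfolding q_def qA[OF x] P_def by (simp add: inner_diff_left)
      then have "\<bar>inner (?A y *v P) P - q\<bar> \<le> norm (?A y *v P - ?A x *v P) * norm P"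
        by (simp only: Cauchy_Schwarz_ineq2)
      also have "\<dots> \<le> (L * norm \<zeta> * norm P) * norm P"
        unfolding \<zeta>_def by (intro mult_right_mono Alip subsetD[OF sub x] subsetD[OF sub y]) simp
      also have "\<dots> \<le> (L * norm \<zeta> * (norm \<zeta> / \<mu>)) * (norm \<zeta> / \<mu>)"
        using L0 \<mu> Pbd[OF x, of \<zeta>] by (intro mult_mono) (auto simp: P_def)
      also have "\<dots> = L / \<mu>\<^sup>2 * (norm \<zeta> ^ 3)" by (simp add: power2_eq_square power3_eq_cube)
      also have "\<dots> \<le> L / \<mu>\<^sup>2 * ((sqrt q / sqrt \<kappa>) ^ 3)"
        using L0 nq[OF x, of \<zeta>] by (intro mult_left_mono power_mono) (auto simp: q_def)
      also have "\<dots> = L / (\<mu>\<^sup>2 * (\<kappa> * sqrt \<kappa>)) * (q * sqrt q)"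
        using q0[OF x, of \<zeta>] \<kappa> by (simp add: q_def power3_eq_cube power_divide)
      also have "\<dots> \<le> C1 * (q * sqrt q)"
        using C1(2) q0[OF x, of \<zeta>] by (intro mult_right_mono) (auto simp: q_def)
      finally show ?thesis by (simp add: q_def P_def \<zeta>_def mult.assoc)
    qed
    show "\<bar>Re (trace (?A y ** B x)) - ?n\<bar> \<le> C1 * sqrt (quad_form (B x) (y - x))"
      if x: "x \<in> cball z0 R" and y: "y \<in> cball z0 R" for x y
    proof -
      define \<zeta> where "\<zeta> = y - x"
      have "Re (trace (?A x ** B x)) = ?n" by (simp add: B[OF x] trace_def mat_def)
      then have "Re (trace (?A y ** B x)) - ?n = Re (\<Sum>j\<in>UNIV. \<Sum>k\<in>UNIV. (a y j k - a x j k) * B x $ k $ j)"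
        unfolding Re_trace_coeff_mat by (simp add: left_diff_distrib sum_subtractf algebra_simps)
      also have "\<bar>\<dots>\<bar> \<le> norm (\<Sum>j\<in>UNIV. \<Sum>k\<in>UNIV. (a y j k - a x j k) * B x $ k $ j)"
        by (rule abs_Re_le_cmod)
      also have "\<dots> \<le> (\<Sum>j\<in>(UNIV::'n set). \<Sum>k\<in>(UNIV::'n set). (c * norm \<zeta>) * (1 / \<mu>))"
      proof (intro sum_norm_le)
        fix j k :: 'n
        have "norm (B x $ k $ j) = norm ((B x *v axis j 1) $ k)" by (simp add: matrix_vector_axis_complex)
        also have "\<dots> \<le> norm (B x *v axis j 1)" by (rule Finite_Cartesian_Product.norm_nth_le)
        also have "\<dots> \<le> 1 / \<mu>" using Pbd[OF x, of "axis j 1"] by (simp add: norm_axis_1)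
        finally have "norm (B x $ k $ j) \<le> 1 / \<mu>" .
        moreover have "norm (a y j k - a x j k) \<le> c * norm \<zeta>" unfolding \<zeta>_def using c(2) x y sub by blast
        ultimately show "norm ((a y j k - a x j k) * B x $ k $ j) \<le> (c * norm \<zeta>) * (1 / \<mu>)"
          unfolding norm_mult using c(1) by (intro mult_mono) auto
      qed
      also have "\<dots> = ?n\<^sup>2 * c / \<mu> * norm \<zeta>" by (simp add: power2_eq_square)
      also have "\<dots> \<le> ?n\<^sup>2 * c / \<mu> * (sqrt (quad_form (B x) \<zeta>) / sqrt \<kappa>)"
        using nq[OF x] c(1) \<mu> by (intro mult_left_mono) auto
      also have "\<dots> = ?n\<^sup>2 * c / (\<mu> * sqrt \<kappa>) * sqrt (quad_form (B x) \<zeta>)" by simp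
      also have "\<dots> \<le> C1 * sqrt (quad_form (B x) \<zeta>)"
        using C1(3) q0[OF x] by (intro mult_right_mono) auto
      finally show ?thesis by (simp add: \<zeta>_def)
    qed
    show "continuous_on (cball z0 R) (\<lambda>x. quad_form (B x) (y - x))" for y
    proof -
      have "continuous_on (cball z0 R) (\<lambda>x. B x *v (y - x))"
        unfolding continuous_on_def
      proof
        fix x' assume x': "x' \<in> cball z0 R"
        define P' where "P' = B x' *v (y - x')"
        \<comment> \<open>Continuity of the inverse without a formula for it: coercivity bounds the
          difference of two solutions by its image under the coefficient matrix, and that image is a
          difference of data plus a Lipschitz term.\<close>
        have bd: "norm (B x *v (y - x) - P') \<le> (1 + L * norm P') / \<mu> * norm (x - x')" if x: "x \<in> cball z0 R" for x
        proof -
          define P where "P = B x *v (y - x)"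
          have "\<mu> * (norm (P - P'))\<^sup>2 \<le> inner (?A x *v (P - P')) (P - P')" by (rule coer[OF x])
          also have "\<dots> \<le> norm (?A x *v (P - P')) * norm (P - P')" by (rule norm_cauchy_schwarz)
          finally have "\<mu> * norm (P - P') \<le> norm (?A x *v (P - P'))"
            using \<mu> by (cases "P = P'") (auto simp: power2_eq_square simp flip: mult.assoc)
          also have "?A x *v (P - P') = (x' - x) - (?A x *v P' - ?A x' *v P')"
            using AB[OF x, of "y - x"] AB[OF x', of "y - x'"]
            by (simp add: P_def P'_def matrix_vector_mult_diff_distrib)
          also have "norm \<dots> \<le> norm (x' - x) + L * norm (x - x') * norm P'"
            using x x' sub by (intro order_trans[OF norm_triangle_ineq4 add_left_mono] Alip) auto
          also have "\<dots> = (1 + L * norm P') * norm (x - x')" by (simp add: norm_minus_commute algebra_simps)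
          finally show ?thesis using \<mu> by (simp add: P_def field_simps)
        qed
        have "((\<lambda>x. (1 + L * norm P') / \<mu> * norm (x - x')) \<longlongrightarrow> (1 + L * norm P') / \<mu> * norm (x' - x')) (at x' within cball z0 R)"
          by (intro tendsto_intros)
        then have lim: "((\<lambda>x. (1 + L * norm P') / \<mu> * norm (x - x')) \<longlongrightarrow> 0) (at x' within cball z0 R)"
          by simp
        have "\<forall>\<^sub>F x in at x' within cball z0 R. norm (B x *v (y - x) - P') \<le> (1 + L * norm P') / \<mu> * norm (x - x')"
          unfolding eventually_at_filter by (rule always_eventually) (use bd in blast)
        from Lim_null_comparison[OF this lim]
        have "((\<lambda>x. B x *v (y - x) - P') \<longlongrightarrow> 0) (at x' within cball z0 R)" .
        then show "((\<lambda>x. B x *v (y - x)) \<longlongrightarrow> B x' *v (y - x')) (at x' within cball z0 R)"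
          unfolding P'_def by (rule Lim_null[THEN iffD2])
      qed
      then show ?thesis unfolding quad_form_def by (intro continuous_intros)
    qed
    show "cball z0 R \<subseteq> V" using sub R0(2) by (rule order_trans)
  qed (fact R(1) C1(1) \<kappa> qlow)+
qed

subsection \<open>The submean inequality\<close>

text \<open>Outside \<open>U\<close> the coefficients are arbitrary functions, so measurability and
  boundedness come from continuity on the compact support together with vanishing off it.\<close>

lemma alpha_ddc_test_bounded:
  assumes form: "admissible_form U a" and \<omega>: "nonneg_test_fun U \<omega>"
  obtains b where "\<And>z. \<bar>alpha_ddc a \<omega> z\<bar> \<le> b" "alpha_ddc a \<omega> \<in> borel_measurable borel"
    "\<And>z. z \<notin> closure {z. \<omega> z \<noteq> 0} \<Longrightarrow> alpha_ddc a \<omega> z = 0"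
proof -
  define K where "K = closure {z. \<omega> z \<noteq> 0}"
  have K: "compact K" "K \<subseteq> U" "\<And>z. z \<notin> K \<Longrightarrow> \<omega> z = 0"
    using \<omega> closure_subset[of "{z. \<omega> z \<noteq> 0}"] by (auto simp: nonneg_test_fun_def K_def)
  have C: "\<And>j k. Ck_on 1 U (\<lambda>z. a z j k)"
    using form unfolding admissible_form_def by blast
  define W where "W z = complex_of_real (\<omega> z)" for z
  have W: "Ck_on k UNIV W" for k
    unfolding W_def using \<omega> by (intro Ck_on_of_real) (auto simp: nonneg_test_fun_def smooth_on_def)
  define g where "g k = wirt_dzbar k W" for k
  have g: "Ck_on 1 UNIV (g k)" for k
    unfolding g_def One_nat_def by (intro Ck_on_wirt_dzbar W)
  have WK: "closure {z. W z \<noteq> 0} = K" by (simp add: W_def K_def)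
  have g0: "g k z = 0" if "z \<notin> K" for k z unfolding g_def using wirt_dzbar_eq_0[of z W] WK that by simp
  have d0: "wirt_dz j (g k) z = 0" if "z \<notin> K" for j k z
  proof -
    have "real_pderiv (g k) z v = 0" for v
      by (rule real_pderiv_eq_0[of "- K"]) (use that g0 K(1) in \<open>auto simp: compact_imp_closed open_Compl\<close>)
    then show ?thesis by (simp add: wirt_dz_def)
  qed
  have eq: "alpha_ddc a \<omega> z = Re (\<Sum>j\<in>UNIV. \<Sum>k\<in>UNIV. a z j k * wirt_dz j (g k) z)" for z
    by (simp add: alpha_ddc_def g_def W_def[abs_def])
  have z0: "alpha_ddc a \<omega> z = 0" if "z \<notin> K" for z unfolding eq using d0[OF that] by simp
  have cw: "continuous_on UNIV (wirt_dz j (g k))" for j k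
    unfolding wirt_dz_def[abs_def] using Ck_on_Suc_has_derivative(2)[of 0 "g k"] g[of k]
    by (intro continuous_intros) auto
  have cont: "continuous_on K (alpha_ddc a \<omega>)"
    unfolding eq[abs_def]
    by (intro continuous_on_Re continuous_on_sum continuous_on_mult
        continuous_on_subset[OF cw] continuous_on_subset[OF Ck_on_imp_continuous[OF C] K(2)]) simp
  have "bounded (alpha_ddc a \<omega> ` K)" by (intro compact_imp_bounded compact_continuous_image cont K)
  then obtain b where b: "\<forall>z\<in>K. \<bar>alpha_ddc a \<omega> z\<bar> \<le> b" by (auto simp: bounded_iff)
  have "(\<lambda>z. indicator K z *\<^sub>R alpha_ddc a \<omega> z) \<in> borel_measurable borel"
    by (rule borel_measurable_continuous_on_indicator[OF borel_compact[OF K(1)] cont])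
  moreover have "(\<lambda>z. indicator K z *\<^sub>R alpha_ddc a \<omega> z) = alpha_ddc a \<omega>"
    using z0 by (auto simp: indicator_def fun_eq_iff)
  ultimately have "alpha_ddc a \<omega> \<in> borel_measurable borel" by simp
  moreover have "\<bar>alpha_ddc a \<omega> z\<bar> \<le> \<bar>b\<bar>" for z using b z0[of z] by (cases "z \<in> K") force+
  ultimately show ?thesis using that[of "\<bar>b\<bar>"] z0 unfolding K_def by blast
qed

lemma integrable_mult_bounded:
  fixes f g :: "'a::euclidean_space \<Rightarrow> real"
  assumes "integrable lborel f" "g \<in> borel_measurable borel" "\<And>z. \<bar>g z\<bar> \<le> b"
  shows "integrable lborel (\<lambda>z. f z * g z)"
proof (rule Bochner_Integration.integrable_bound)
  show "integrable lborel (\<lambda>z. f z * b)" using assms(1) by simp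
  show "(\<lambda>z. f z * g z) \<in> borel_measurable lborel" using assms(1,2) by auto
  show "AE z in lborel. norm (f z * g z) \<le> norm (f z * b)"
    unfolding real_norm_def abs_mult
    by (intro AE_I2 mult_left_mono order_trans[OF assms(3) abs_ge_self]) simp
qed

lemma L1_loc_integrable_alpha_ddc:
  assumes form: "admissible_form U a" and D: "D \<subseteq> U" and \<omega>: "nonneg_test_fun D \<omega>"
    and f: "\<And>C. compact C \<Longrightarrow> C \<subseteq> D \<Longrightarrow> set_integrable lborel C f"
  shows "integrable lborel (\<lambda>z. f z * alpha_ddc a \<omega> z)"
proof -
  let ?K = "closure {z. \<omega> z \<noteq> 0}"
  have \<omega>U: "nonneg_test_fun U \<omega>" and K: "compact ?K" "?K \<subseteq> D"
    using \<omega> D by (auto simp: nonneg_test_fun_def)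
  obtain b where b: "\<And>z. \<bar>alpha_ddc a \<omega> z\<bar> \<le> b" "alpha_ddc a \<omega> \<in> borel_measurable borel"
    "\<And>z. z \<notin> ?K \<Longrightarrow> alpha_ddc a \<omega> z = 0"
    by (rule alpha_ddc_test_bounded[OF form \<omega>U]) blast
  have "integrable lborel (\<lambda>z. (indicator ?K z *\<^sub>R f z) * alpha_ddc a \<omega> z)"
    using f[OF K] b unfolding set_integrable_def by (intro integrable_mult_bounded) auto
  moreover have "(\<lambda>z. (indicator ?K z *\<^sub>R f z) * alpha_ddc a \<omega> z) = (\<lambda>z. f z * alpha_ddc a \<omega> z)"
    using b(3) by (auto simp: indicator_def fun_eq_iff)
  ultimately show ?thesis by simp
qed

lemma DIM_complex_vec: "DIM(complex^'n) = 2 * CARD('n)"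
  by simp

lemma lborel_integral_scale:
  fixes f :: "'a::euclidean_space \<Rightarrow> real"
  assumes "f \<in> borel_measurable borel" "r > 0"
  shows "integral\<^sup>L lborel f = r ^ DIM('a) * integral\<^sup>L lborel (\<lambda>w. f (x + r *\<^sub>R w))"
proof -
  have "integral\<^sup>L lborel f = integral\<^sup>L (density (distr lborel borel (\<lambda>w. x + r *\<^sub>R w)) (\<lambda>_. ennreal (\<bar>r\<bar> ^ DIM('a)))) f"
    using lborel_affine[of r x] assms(2) by simp
  also have "\<dots> = integral\<^sup>L (distr lborel borel (\<lambda>w. x + r *\<^sub>R w)) (\<lambda>y. \<bar>r\<bar> ^ DIM('a) *\<^sub>R f y)"
    using assms by (intro integral_density) auto
  also have "\<dots> = integral\<^sup>L lborel (\<lambda>w. \<bar>r\<bar> ^ DIM('a) *\<^sub>R f (x + r *\<^sub>R w))"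
    using assms by (intro integral_distr) auto
  finally show ?thesis using assms(2) by simp
qed

section \<open>The radial kernel and its scaling\<close>

context smooth_step begin

lemma radial_kernel_nonneg: "0 \<le> t \<Longrightarrow> 0 \<le> radial_kernel n r t"
  unfolding radial_kernel_def by (intro mult_nonneg_nonneg divide_nonneg_nonneg S'_nonneg) auto

lemma radial_kernel_eq_0:
  assumes "r > 0" "t \<le> r\<^sup>2 \<or> 2 * r\<^sup>2 \<le> t"
  shows "radial_kernel n r t = 0"
  using assms S'_0[of "t / r\<^sup>2"] S'_2[of "t / r\<^sup>2"]
  by (auto simp: radial_kernel_def pos_divide_le_eq pos_le_divide_eq)

lemma radial_kernel_le:
  assumes "r > 0"
  shows "\<bar>radial_kernel n r t\<bar> \<le> 2 * M / r ^ (2 * n)"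
proof (cases "r\<^sup>2 < t \<and> t < 2 * r\<^sup>2")
  case True
  then have t: "t > 0" by (smt (verit) zero_le_power2)
  have "S' (t / r\<^sup>2) / r\<^sup>2 * (t / t ^ n) \<le> M / r\<^sup>2 * (2 * r\<^sup>2 / (r\<^sup>2) ^ n)"
    using True t assms S'_le S'_nonneg M_pos
    by (intro mult_mono divide_right_mono frac_le power_mono divide_nonneg_nonneg) auto
  also have "\<dots> = 2 * M / r ^ (2 * n)" using assms by (simp add: power_mult)
  finally show ?thesis
    using radial_kernel_nonneg[of t n r] t by (simp add: radial_kernel_def abs_of_nonneg del: times_divide_eq_left times_divide_eq_right)
next
  case False
  then have "radial_kernel n r t = 0" by (intro radial_kernel_eq_0[OF assms]) linarith
  then show ?thesis using M_pos assms by simp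
qed

lemma continuous_radial_kernel:
  assumes "r > 0"
  shows "continuous_on UNIV (radial_kernel n r)"
proof -
  have S'c: "continuous_on UNIV S'" using Ck_real_imp_continuous[OF S'_smooth[of 0]] .
  have "continuous_on {0<..} (radial_kernel n r)"
    unfolding radial_kernel_def[abs_def]
    by (intro continuous_intros continuous_on_compose2[OF S'c]) (use assms in auto)
  moreover have "continuous_on {..<r\<^sup>2} (radial_kernel n r)"
    by (rule continuous_on_eq[where f="\<lambda>_. 0"]) (use assms in \<open>auto simp: radial_kernel_eq_0\<close>)
  ultimately have "continuous_on ({0<..} \<union> {..<r\<^sup>2}) (radial_kernel n r)"
    by (intro continuous_on_open_Un) auto
  moreover have "{0<..} \<union> {..<r\<^sup>2} = (UNIV :: real set)"
    using assms by (auto simp: not_less) (smt (verit) zero_less_power2)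
  ultimately show ?thesis by simp
qed

text \<open>The exponent \<open>2 * n\<close> is the real dimension, so after dilation the kernels
  of all radii have the same total mass.\<close>

lemma radial_kernel_scale:
  assumes "r > 0"
  shows "r ^ (2 * n) * radial_kernel n r (r\<^sup>2 * s) = radial_kernel n 1 s"
  using assms by (simp add: radial_kernel_def power_mult_distrib power_mult)

end

text \<open>Fixes the output of \<open>frozen_inverse\<close> around \<open>z0\<close>.
  \<open>V\<close> is the domain of the functions to be averaged and contains the ball of radius
  \<open>R\<close>.\<close>

locale frozen_form = smooth_step S S' M for S S' M +
  fixes a :: "complex^'n \<Rightarrow> 'n \<Rightarrow> 'n \<Rightarrow> complex" and U V :: "(complex^'n) set" and z0 :: "complex^'n"
    and R C1 \<kappa> :: real and B :: "complex^'n \<Rightarrow> complex^'n^'n"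
  assumes form: "admissible_form U a" and VU: "V \<subseteq> U"
    and R_pos: "R > 0" and C1_pos: "C1 > 0" and \<kappa>_pos: "\<kappa> > 0" and cball_V: "cball z0 R \<subseteq> V"
    and B_sa: "\<And>x. x \<in> cball z0 R \<Longrightarrow> self_adjoint (B x)"
    and B_lower: "\<And>x \<zeta>. x \<in> cball z0 R \<Longrightarrow> \<kappa> * (norm \<zeta>)\<^sup>2 \<le> quad_form (B x) \<zeta>"
    and B_beta: "\<And>x y. x \<in> cball z0 R \<Longrightarrow> y \<in> cball z0 R \<Longrightarrow>
       \<bar>inner (coeff_mat a y *v (B x *v (y - x))) (B x *v (y - x)) - quad_form (B x) (y - x)\<bar>
         \<le> C1 * quad_form (B x) (y - x) * sqrt (quad_form (B x) (y - x))"
    and B_alpha: "\<And>x y. x \<in> cball z0 R \<Longrightarrow> y \<in> cball z0 R \<Longrightarrow>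
       \<bar>Re (trace (coeff_mat a y ** B x)) - real CARD('n)\<bar> \<le> C1 * sqrt (quad_form (B x) (y - x))"
    and B_cont: "\<And>y. continuous_on (cball z0 R) (\<lambda>x. quad_form (B x) (y - x))"
begin

text \<open>A weight on a thin ellipsoidal shell around the centre \<open>x\<close>, adapted to the
  coefficients frozen at \<open>x\<close>. It is not normalised; \<open>kernel_mass\<close> is its
  total mass, the same for every radius.\<close>

definition mean_kernel :: "real \<Rightarrow> complex^'n \<Rightarrow> complex^'n \<Rightarrow> real" where
  "mean_kernel r x y = radial_kernel CARD('n) r (quad_form (B x) (y - x))"

definition kernel_mass :: "complex^'n \<Rightarrow> real" where
  "kernel_mass x = integral\<^sup>L lborel (mean_kernel 1 x)"

definition C2 :: real where "C2 = 4 * (real CARD('n) + 1) * C1"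

text \<open>The loss in \<open>outer_estimate\<close>, with \<open>C2\<close> in the role of the
  constant \<open>C\<close> there. It tends to 1 as \<open>r\<close> tends to 0.\<close>

definition kernel_factor :: "real \<Rightarrow> real" where
  "kernel_factor r = (1 - C1 * sqrt 2 * r) * (1 - C2 * sqrt 2 * r)"

text \<open>The second condition is what the radial profile needs; the third keeps the support of a
  test function centred in the half ball inside the ball of radius \<open>R\<close>.\<close>

definition admissible_radius :: "real \<Rightarrow> bool" where
  "admissible_radius r \<longleftrightarrow> r > 0 \<and> C2 * sqrt 2 * r \<le> 1/2 \<and> 2 * r < sqrt \<kappa> * (R / 2)"

lemma quad_form_nonneg: "x \<in> cball z0 R \<Longrightarrow> 0 \<le> quad_form (B x) \<zeta>"
  using order_trans[OF _ B_lower[of x \<zeta>]] \<kappa>_pos by simp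

lemma norm_lt_of_quad_form:
  assumes "x \<in> cball z0 R" "quad_form (B x) \<zeta> \<le> 2 * r\<^sup>2" "r > 0"
  shows "norm \<zeta> < 2 * r / sqrt \<kappa>"
proof -
  have "\<kappa> * (norm \<zeta>)\<^sup>2 < (2 * r)\<^sup>2"
  proof -
    have "\<kappa> * (norm \<zeta>)\<^sup>2 \<le> 2 * r\<^sup>2" using B_lower[OF assms(1)] assms(2) by (rule order_trans)
    also have "\<dots> < 4 * r\<^sup>2" using assms(3) by simp
    finally show ?thesis by (simp add: power_mult_distrib)
  qed
  then have "(sqrt \<kappa> * norm \<zeta>)\<^sup>2 < (2 * r)\<^sup>2" using \<kappa>_pos by (simp add: power_mult_distrib)
  then have "sqrt \<kappa> * norm \<zeta> < 2 * r" using power_less_imp_less_base assms(3) by fastforce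
  then show ?thesis using \<kappa>_pos by (simp add: field_simps)
qed

lemma mean_kernel_nonneg: "x \<in> cball z0 R \<Longrightarrow> 0 \<le> mean_kernel r x y"
  unfolding mean_kernel_def by (intro radial_kernel_nonneg quad_form_nonneg)

lemma mean_kernel_le: "r > 0 \<Longrightarrow> \<bar>mean_kernel r x y\<bar> \<le> 2 * M / r ^ (2 * CARD('n))"
  unfolding mean_kernel_def by (rule radial_kernel_le)

lemma mean_kernel_eq_0:
  assumes "x \<in> cball z0 R" "r > 0" "2 * r / sqrt \<kappa> \<le> norm (y - x)"
  shows "mean_kernel r x y = 0"
proof -
  have "\<not> quad_form (B x) (y - x) \<le> 2 * r\<^sup>2" using norm_lt_of_quad_form[of x "y - x" r] assms by auto
  then show ?thesis unfolding mean_kernel_def by (intro radial_kernel_eq_0 assms) auto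
qed

lemma continuous_quad_form: "x \<in> cball z0 R \<Longrightarrow> continuous_on UNIV (\<lambda>y. quad_form (B x) (y - x))"
  using Ck_on_imp_continuous[OF Ck_on_quad_form[OF B_sa]] .

lemma continuous_mean_kernel:
  assumes "x \<in> cball z0 R" "r > 0"
  shows "continuous_on UNIV (mean_kernel r x)"
  unfolding mean_kernel_def[abs_def]
  by (rule continuous_on_compose2[OF continuous_radial_kernel[OF assms(2)] continuous_quad_form[OF assms(1)]]) auto

lemma continuous_mean_kernel_center:
  assumes "r > 0"
  shows "continuous_on (cball z0 R) (\<lambda>x. mean_kernel r x y)"
  unfolding mean_kernel_def[abs_def]
  by (rule continuous_on_compose2[OF continuous_radial_kernel[OF assms] B_cont]) auto

lemma mean_kernel_integrable:
  assumes "x \<in> cball z0 R" "r > 0"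
  shows "integrable lborel (mean_kernel r x)"
  by (rule continuous_compact_support_integrable[OF continuous_mean_kernel[OF assms], of "cball x (2 * r / sqrt \<kappa>)"])
     (auto simp: dist_norm norm_minus_commute intro!: mean_kernel_eq_0 assms)

lemma integral_mean_kernel:
  assumes x: "x \<in> cball z0 R" and r: "r > 0"
  shows "integral\<^sup>L lborel (mean_kernel r x) = kernel_mass x"
proof -
  have m: "mean_kernel r x \<in> borel_measurable borel" "mean_kernel 1 x \<in> borel_measurable borel"
    using continuous_mean_kernel[OF x] r by (auto intro!: borel_measurable_continuous_onI)
  have "quad_form (B x) (r *\<^sub>R w) = r\<^sup>2 * quad_form (B x) w" for w
    using linear_cmul[OF bounded_linear.linear[OF bounded_linear_matrix_complex], of "B x" r w]
    by (simp add: quad_form_def power2_eq_square)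
  then have "r ^ (2 * CARD('n)) * mean_kernel r x (x + r *\<^sub>R w) = mean_kernel 1 x (x + w)" for w
    using radial_kernel_scale[OF r, of "CARD('n)" "quad_form (B x) w"] by (simp add: mean_kernel_def)
  then have "integral\<^sup>L lborel (mean_kernel r x) = integral\<^sup>L lborel (\<lambda>w. mean_kernel 1 x (x + w))"
    using lborel_integral_scale[OF m(1) r, of x]
    by (simp only: DIM_complex_vec flip: Bochner_Integration.integral_mult_right_zero)
  also have "\<dots> = kernel_mass x" unfolding kernel_mass_def by (rule lborel_integral_translate[OF m(2)])
  finally show ?thesis .
qed

text \<open>The kernel is continuous and nonnegative, and scaling a unit vector reaches the level
  \<open>3/2\<close> of the quadratic form, where \<open>S'\<close> is known to be positive.\<close>

lemma kernel_mass_pos: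
  assumes x: "x \<in> cball z0 R"
  shows "kernel_mass x > 0"
proof -
  have "\<exists>\<zeta>. quad_form (B x) \<zeta> = 3/2"
  proof -
    obtain e :: "complex^'n" where e: "norm e = 1" using vector_choose_size[of 1] by auto
    define q where "q = quad_form (B x) e"
    have q: "q > 0" using B_lower[OF x, of e] e \<kappa>_pos by (simp add: q_def)
    have "quad_form (B x) (sqrt (3/2/q) *\<^sub>R e) = (sqrt (3/2/q))\<^sup>2 * q"
      using linear_cmul[OF bounded_linear.linear[OF bounded_linear_matrix_complex], of "B x" "sqrt (3/2/q)" e]
      by (simp add: quad_form_def q_def power2_eq_square del: real_sqrt_mult_self)
    also have "\<dots> = 3/2" using q by simp
    finally show ?thesis by blast
  qed
  then obtain \<zeta> where \<zeta>: "quad_form (B x) \<zeta> = 3/2" by blast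
  have "mean_kernel 1 x (x + \<zeta>) > 0"
    using S'_pos by (simp add: mean_kernel_def radial_kernel_def \<zeta>)
  have int: "integrable lborel (mean_kernel 1 x)" using mean_kernel_integrable[OF x] by simp
  have nn: "AE y in lborel. 0 \<le> mean_kernel 1 x y" using mean_kernel_nonneg[OF x] by simp
  have "kernel_mass x \<noteq> 0"
  proof
    assume "kernel_mass x = 0"
    then have ae: "AE y in lborel. mean_kernel 1 x y = 0"
      unfolding kernel_mass_def using integral_nonneg_eq_0_iff_AE[OF int nn] by simp
    define O1 where "O1 = {y. 0 < mean_kernel 1 x y}"
    have "open O1" unfolding O1_def
      using continuous_mean_kernel[OF x, of 1] by (intro open_Collect_less) auto
    moreover have "x + \<zeta> \<in> O1" using \<open>mean_kernel 1 x (x + \<zeta>) > 0\<close> by (simp add: O1_def)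
    ultimately obtain e where e: "e > 0" "ball (x + \<zeta>) e \<subseteq> O1" using open_contains_ball by blast
    have "AE y in lborel. y \<notin> ball (x + \<zeta>) e" using ae by eventually_elim (use e O1_def in auto)
    then have "emeasure lborel (ball (x + \<zeta>) e) = 0"
      by (subst (asm) AE_iff_measurable[of "ball (x + \<zeta>) e"]) auto
    then have "measure lborel (ball (x + \<zeta>) e) = 0" by (simp add: measure_def)
    then show False using e(1) by simp
  qed
  moreover have "kernel_mass x \<ge> 0" unfolding kernel_mass_def by (rule integral_nonneg_AE[OF nn])
  ultimately show ?thesis by linarith
qed

end

lemma integrable_indicator_mult_abs:
  fixes g :: "'a::euclidean_space \<Rightarrow> real"
  assumes "integrable lborel g" "A \<in> sets borel"
  shows "integrable lborel (\<lambda>y. indicator A y * \<bar>g y\<bar>)"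
proof -
  have "integrable lborel (\<lambda>y. \<bar>g y\<bar> * indicator A y)"
    by (rule integrable_mult_bounded[OF integrable_abs[OF assms(1)] borel_measurable_indicator[OF assms(2)], of 1])
       (simp add: indicator_def)
  then show ?thesis by (simp add: mult.commute)
qed

context frozen_form begin

text \<open>Composes the radial profile with the quadratic form frozen at \<open>x\<close>. Near the
  centre the operator gives minus the kernel at scale \<open>\<tau>\<close> up to an error,
  elsewhere at least a multiple of the kernel at scale \<open>r\<close>; pairing with a subharmonic
  function thus compares its means at the two scales.\<close>

lemma test_function_exists:
  assumes r: "admissible_radius r" and \<tau>: "0 < \<tau>" "2 * \<tau>\<^sup>2 \<le> r\<^sup>2" and x: "x \<in> cball z0 (R/2)"
  obtains \<phi> where "nonneg_test_fun V \<phi>"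
    "\<And>y. y \<in> cball z0 R \<Longrightarrow> 2 * \<tau>\<^sup>2 \<le> quad_form (B x) (y - x) \<Longrightarrow> alpha_ddc a \<phi> y \<ge> kernel_factor r * mean_kernel r x y"
    "\<And>y. y \<in> cball z0 R \<Longrightarrow> quad_form (B x) (y - x) \<le> 2 * \<tau>\<^sup>2 \<Longrightarrow>
       \<bar>alpha_ddc a \<phi> y + mean_kernel \<tau> x y\<bar> \<le> 2 * (2 * M * (C1 + C2) + 2 * C2) * (\<tau> / \<tau> ^ (2 * CARD('n)))"
    "\<And>y. y \<notin> cball z0 R \<Longrightarrow> alpha_ddc a \<phi> y = 0"
proof -
  have r0: "r > 0" "C2 * sqrt 2 * r \<le> 1/2" "2 * r < sqrt \<kappa> * (R / 2)" using r by (auto simp: admissible_radius_def)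
  have xR: "x \<in> cball z0 R" using x R_pos by auto
  obtain h h' h'' where h: "\<And>t. (h has_real_derivative h' t) (at t)" "\<And>t. (h' has_real_derivative h'' t) (at t)"
    "\<And>k. Ck_real k UNIV h" "\<And>t. 0 \<le> h t" "\<And>t. 2 * r\<^sup>2 \<le> t \<Longrightarrow> h t = 0"
    "\<And>t \<alpha> \<beta>. 2 * \<tau>\<^sup>2 \<le> t \<Longrightarrow> (t \<le> 2 * r\<^sup>2 \<longrightarrow> \<bar>\<beta> - t\<bar> \<le> C1 * t * sqrt t) \<Longrightarrow> (t \<le> 2 * r\<^sup>2 \<longrightarrow> \<bar>\<alpha> - real CARD('n)\<bar> \<le> C1 * sqrt t) \<Longrightarrow>
       \<beta> * h'' t + \<alpha> * h' t \<ge> (1 - C1 * sqrt 2 * r) * (1 - 4 * (real CARD('n) + 1) * C1 * sqrt 2 * r) * radial_kernel CARD('n) r t"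
    "\<And>t \<alpha> \<beta>. t \<le> 2 * \<tau>\<^sup>2 \<Longrightarrow> \<bar>\<beta> - t\<bar> \<le> C1 * t * sqrt t \<Longrightarrow> \<bar>\<alpha> - real CARD('n)\<bar> \<le> C1 * sqrt t \<Longrightarrow>
       \<bar>\<beta> * h'' t + \<alpha> * h' t + radial_kernel CARD('n) \<tau> t\<bar>
         \<le> 2 * (2 * M * (C1 + 4 * (real CARD('n) + 1) * C1) + 2 * (4 * (real CARD('n) + 1) * C1)) * (\<tau> / \<tau> ^ (2 * CARD('n)))"
    by (rule radial_profile[of C1 \<tau> r "CARD('n)"]) (use C1_pos \<tau> r0 in \<open>auto simp: C2_def\<close>)
  define \<phi> where "\<phi> y = h (quad_form (B x) (y - x))" for y
  have L: "alpha_ddc a \<phi> y = inner (coeff_mat a y *v (B x *v (y - x))) (B x *v (y - x)) * h'' (quad_form (B x) (y - x))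
    + Re (trace (coeff_mat a y ** B x)) * h' (quad_form (B x) (y - x))" for y
    unfolding \<phi>_def[abs_def] by (rule alpha_ddc_radial[OF B_sa[OF xR] h(1,2)])
  define K where "K = cball x (2 * r / sqrt \<kappa>)"
  have supp: "{y. \<phi> y \<noteq> 0} \<subseteq> K"
  proof
    fix y assume "y \<in> {y. \<phi> y \<noteq> 0}"
    then have "quad_form (B x) (y - x) \<le> 2 * r\<^sup>2" using h(5)[of "quad_form (B x) (y - x)"] by (force simp: \<phi>_def)
    then have "norm (y - x) < 2 * r / sqrt \<kappa>" by (rule norm_lt_of_quad_form[OF xR _ r0(1)])
    then show "y \<in> K" by (simp add: K_def dist_norm norm_minus_commute)
  qed
  have clK: "closure {y. \<phi> y \<noteq> 0} \<subseteq> K" by (rule closure_minimal[OF supp]) (simp add: K_def)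
  have rR: "2 * r / sqrt \<kappa> \<le> R / 2" using r0 \<kappa>_pos by (simp add: field_simps)
  have KR: "K \<subseteq> cball z0 R"
  proof (intro subsetI)
    fix y assume "y \<in> K"
    then have "dist x y \<le> R / 2" using rR by (simp add: K_def)
    then show "y \<in> cball z0 R" using x dist_triangle[of z0 y x] by simp
  qed
  have test: "nonneg_test_fun V \<phi>"
    unfolding nonneg_test_fun_def smooth_on_def
  proof (intro conjI allI)
    show "Ck_on k UNIV \<phi>" for k
      unfolding \<phi>_def[abs_def] by (rule Ck_on_compose_real[OF Ck_on_quad_form[OF B_sa[OF xR]] h(3)])
    show "0 \<le> \<phi> z" for z by (simp add: \<phi>_def h(4))
    show "compact (closure {y. \<phi> y \<noteq> 0})"
      using compact_Int_closed[of K "closure {y. \<phi> y \<noteq> 0}"] clK by (simp add: K_def Int_absorb1)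
    show "closure {y. \<phi> y \<noteq> 0} \<subseteq> V" using clK KR cball_V by blast
  qed
  show ?thesis
  proof (rule that[OF test])
    fix y assume y: "y \<in> cball z0 R" "2 * \<tau>\<^sup>2 \<le> quad_form (B x) (y - x)"
    show "kernel_factor r * mean_kernel r x y \<le> alpha_ddc a \<phi> y"
      unfolding L mean_kernel_def kernel_factor_def C2_def
      by (rule h(6)[OF y(2)]) (use B_beta[OF xR y(1)] B_alpha[OF xR y(1)] in auto)
  next
    fix y assume y: "y \<in> cball z0 R" "quad_form (B x) (y - x) \<le> 2 * \<tau>\<^sup>2"
    show "\<bar>alpha_ddc a \<phi> y + mean_kernel \<tau> x y\<bar> \<le> 2 * (2 * M * (C1 + C2) + 2 * C2) * (\<tau> / \<tau> ^ (2 * CARD('n)))"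
      unfolding L mean_kernel_def C2_def
      by (rule h(7)[OF y(2) B_beta[OF xR y(1)] B_alpha[OF xR y(1)]])
  next
    fix y assume y: "y \<notin> cball z0 R"
    have "nonneg_test_fun U \<phi>" using test VU by (auto simp: nonneg_test_fun_def)
    then show "alpha_ddc a \<phi> y = 0"
      by (rule alpha_ddc_test_bounded[OF form]) (use y clK KR in blast)
  qed
qed

text \<open>The test inequality for the function of \<open>test_function_exists\<close>. The last
  term is the core error: the integral over a ball of volume comparable to
  \<open>\<tau> ^ (2 * CARD('n))\<close> is divided by that power and multiplied by
  \<open>\<tau>\<close>, so it vanishes in the limit at Lebesgue points.\<close>

lemma submean_inequality_approx:
  fixes f :: "complex^'n \<Rightarrow> real"
  assumes r: "admissible_radius r" and \<tau>: "0 < \<tau>" "2 * \<tau>\<^sup>2 \<le> r\<^sup>2" and x: "x \<in> cball z0 (R/2)"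
    and g: "integrable lborel g" and gf: "\<And>y. g y = indicator (cball z0 R) y * f y"
    and neg: "\<And>y. y \<in> cball z0 R \<Longrightarrow> f y \<le> 0"
    and sub: "\<And>\<omega>. nonneg_test_fun V \<omega> \<Longrightarrow> 0 \<le> (\<integral>y. f y * alpha_ddc a \<omega> y \<partial>lborel)"
  defines "\<rho> \<equiv> 2 * \<tau> / sqrt \<kappa>"
  shows "(\<integral>y. g y * mean_kernel \<tau> x y \<partial>lborel) \<le> kernel_factor r * (\<integral>y. g y * mean_kernel r x y \<partial>lborel)
     + 2 * (2 * M * (C1 + C2) + 2 * C2) * (\<tau> / \<tau> ^ (2 * CARD('n))) * (\<integral>y. indicator (ball x \<rho>) y * \<bar>g y\<bar> \<partial>lborel)"
proof -
  let ?E = "2 * (2 * M * (C1 + C2) + 2 * C2) * (\<tau> / \<tau> ^ (2 * CARD('n)))"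
  have r0: "r > 0" using r by (simp add: admissible_radius_def)
  have xR: "x \<in> cball z0 R" using x R_pos by auto
  have C20: "C2 > 0" using C1_pos by (simp add: C2_def)
  have E0: "?E \<ge> 0" using M_pos C1_pos C20 \<tau> by (intro mult_nonneg_nonneg add_nonneg_nonneg) auto
  obtain \<phi> where \<phi>: "nonneg_test_fun V \<phi>"
    "\<And>y. y \<in> cball z0 R \<Longrightarrow> 2 * \<tau>\<^sup>2 \<le> quad_form (B x) (y - x) \<Longrightarrow> alpha_ddc a \<phi> y \<ge> kernel_factor r * mean_kernel r x y"
    "\<And>y. y \<in> cball z0 R \<Longrightarrow> quad_form (B x) (y - x) \<le> 2 * \<tau>\<^sup>2 \<Longrightarrow>
       \<bar>alpha_ddc a \<phi> y + mean_kernel \<tau> x y\<bar> \<le> ?E"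
    "\<And>y. y \<notin> cball z0 R \<Longrightarrow> alpha_ddc a \<phi> y = 0"
    by (rule test_function_exists[OF r \<tau> x]) blast
  have "nonneg_test_fun U \<phi>" using \<phi>(1) VU by (auto simp: nonneg_test_fun_def)
  then obtain b where b: "\<And>z. \<bar>alpha_ddc a \<phi> z\<bar> \<le> b" "alpha_ddc a \<phi> \<in> borel_measurable borel"
    by (rule alpha_ddc_test_bounded[OF form]) blast
  have i1: "integrable lborel (\<lambda>y. g y * alpha_ddc a \<phi> y)" using integrable_mult_bounded[OF g b(2,1)] .
  have i2: "integrable lborel (\<lambda>y. g y * mean_kernel s x y)" if "s > 0" for s
    by (rule integrable_mult_bounded[OF g _ mean_kernel_le[OF that]])
       (intro borel_measurable_continuous_onI continuous_mean_kernel xR that)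
  have i3: "integrable lborel (\<lambda>y. indicator (ball x \<rho>) y * \<bar>g y\<bar>)"
    by (rule integrable_indicator_mult_abs[OF g]) simp
  have "0 \<le> (\<integral>y. f y * alpha_ddc a \<phi> y \<partial>lborel)" by (rule sub[OF \<phi>(1)])
  also have "\<dots> = (\<integral>y. g y * alpha_ddc a \<phi> y \<partial>lborel)"
    by (rule Bochner_Integration.integral_cong) (use \<phi>(4) in \<open>auto simp: gf indicator_def\<close>)
  also have "\<dots> \<le> (\<integral>y. kernel_factor r * (g y * mean_kernel r x y) - g y * mean_kernel \<tau> x y
       + ?E * (indicator (ball x \<rho>) y * \<bar>g y\<bar>) \<partial>lborel)"
  proof (rule integral_mono[OF i1])
    show "integrable lborel (\<lambda>y. kernel_factor r * (g y * mean_kernel r x y) - g y * mean_kernel \<tau> x y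
       + ?E * (indicator (ball x \<rho>) y * \<bar>g y\<bar>))"
      using i2[OF r0] i2[OF \<tau>(1)] i3 by (intro Bochner_Integration.integrable_add Bochner_Integration.integrable_diff integrable_mult_right)
    fix y
    show "g y * alpha_ddc a \<phi> y \<le> kernel_factor r * (g y * mean_kernel r x y) - g y * mean_kernel \<tau> x y
       + ?E * (indicator (ball x \<rho>) y * \<bar>g y\<bar>)"
    proof (cases "y \<in> cball z0 R")
      case False
      then show ?thesis by (simp add: gf)
    next
      case y: True
      \<comment> \<open>Negativity turns the one-sided lower bound on
        \<open>alpha_ddc a \<phi>\<close> into an upper bound on the product, so an uncontrolled
        surplus away from the centre does no harm.\<close>
      have gn: "g y \<le> 0" using neg[OF y] y by (simp add: gf)
      show ?thesis
      proof (cases "2 * \<tau>\<^sup>2 \<le> quad_form (B x) (y - x)")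
        case True
        have "mean_kernel \<tau> x y = 0" unfolding mean_kernel_def by (rule radial_kernel_eq_0[OF \<tau>(1)]) (use True in simp)
        moreover have "g y * alpha_ddc a \<phi> y \<le> g y * (kernel_factor r * mean_kernel r x y)"
          using \<phi>(2)[OF y True] gn by (rule mult_left_mono_neg)
        moreover have "0 \<le> ?E * (indicator (ball x \<rho>) y * \<bar>g y\<bar>)" by (rule mult_nonneg_nonneg[OF E0]) simp
        ultimately show ?thesis by (simp add: mult.left_commute)
      next
        case False
        then have t: "quad_form (B x) (y - x) \<le> 2 * \<tau>\<^sup>2" by simp
        have "mean_kernel r x y = 0" unfolding mean_kernel_def
          by (rule radial_kernel_eq_0[OF r0]) (use t \<tau>(2) in linarith)
        moreover have "norm (y - x) < \<rho>" unfolding \<rho>_def by (rule norm_lt_of_quad_form[OF xR t \<tau>(1)])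
        then have "y \<in> ball x \<rho>" by (simp add: dist_norm norm_minus_commute)
        moreover have "g y * (alpha_ddc a \<phi> y + mean_kernel \<tau> x y) \<le> \<bar>g y\<bar> * ?E"
        proof -
          have "g y * (alpha_ddc a \<phi> y + mean_kernel \<tau> x y) \<le> \<bar>g y\<bar> * \<bar>alpha_ddc a \<phi> y + mean_kernel \<tau> x y\<bar>"
            by (metis abs_ge_self abs_mult)
          also have "\<dots> \<le> \<bar>g y\<bar> * ?E" by (intro mult_left_mono \<phi>(3)[OF y t]) simp
          finally show ?thesis .
        qed
        ultimately show ?thesis by (simp add: ring_distribs mult.commute)
      qed
    qed
  qed
  also have "\<dots> = kernel_factor r * (\<integral>y. g y * mean_kernel r x y \<partial>lborel) - (\<integral>y. g y * mean_kernel \<tau> x y \<partial>lborel)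
     + ?E * (\<integral>y. indicator (ball x \<rho>) y * \<bar>g y\<bar> \<partial>lborel)"
    using i2[OF r0] i2[OF \<tau>(1)] i3
    by (subst Bochner_Integration.integral_add Bochner_Integration.integral_diff integral_mult_right;
        (intro Bochner_Integration.integrable_diff integrable_mult_right)?; simp?)+
  finally show ?thesis by linarith
qed

text \<open>Lets the inner scale tend to 0 in \<open>submean_inequality_approx\<close> along the
  subsequence of Lebesgue points: the mean at scale \<open>\<tau>\<close> becomes the value times
  the mass, and the core error disappears.\<close>

lemma submean_inequality_AE:
  fixes f :: "complex^'n \<Rightarrow> real"
  assumes r: "admissible_radius r"
    and int: "set_integrable lborel (cball z0 R) f"
    and neg: "\<And>y. y \<in> cball z0 R \<Longrightarrow> f y \<le> 0"
    and sub: "\<And>\<omega>. nonneg_test_fun V \<omega> \<Longrightarrow> 0 \<le> (\<integral>y. f y * alpha_ddc a \<omega> y \<partial>lborel)"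
  shows "AE x in lborel. x \<in> cball z0 (R/2) \<longrightarrow>
     kernel_mass x * f x \<le> kernel_factor r * (\<integral>y. f y * mean_kernel r x y \<partial>lborel)"
proof -
  define N where "N = 2 * CARD('n)"
  define g where "g y = indicator (cball z0 R) y * f y" for y
  have g: "integrable lborel g" using int by (simp add: set_integrable_def g_def[abs_def])
  have r0: "r > 0" "2 * r < sqrt \<kappa> * (R / 2)" using r by (auto simp: admissible_radius_def)
  \<comment> \<open>The shift by 2 gives \<open>\<tau> i \<le> r / 2\<close> from the first index
    on, hence \<open>2 * (\<tau> i)\<^sup>2 \<le> r\<^sup>2\<close>.\<close>
  define \<tau> where "\<tau> i = r / real (i + 2)" for i
  define \<rho> where "\<rho> i = 2 * \<tau> i / sqrt \<kappa>" for i
  have \<tau>: "\<tau> i > 0" "2 * (\<tau> i)\<^sup>2 \<le> r\<^sup>2" for i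
  proof -
    show "\<tau> i > 0" using r0 by (simp add: \<tau>_def)
    have "\<tau> i \<le> r / 2" unfolding \<tau>_def using r0 by (intro divide_left_mono) auto
    then have "(\<tau> i)\<^sup>2 \<le> (r / 2)\<^sup>2" using \<open>\<tau> i > 0\<close> by (intro power_mono) auto
    moreover have "(r / 2)\<^sup>2 = r\<^sup>2 / 4" by (simp add: power_divide)
    ultimately show "2 * (\<tau> i)\<^sup>2 \<le> r\<^sup>2" using zero_le_power2[of "\<tau> i"] by linarith
  qed
  have \<tau>0: "\<tau> \<longlonglongrightarrow> 0"
  proof -
    have "(\<lambda>i. r / real (i + 2)) \<longlonglongrightarrow> 0"
      using LIMSEQ_ignore_initial_segment[OF lim_const_over_n[of r], of 2] by simp
    then show ?thesis by (simp add: \<tau>_def[abs_def])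
  qed
  have \<rho>: "\<rho> i > 0" for i using \<tau> \<kappa>_pos by (simp add: \<rho>_def)
  have "(\<lambda>i. 2 * \<tau> i / sqrt \<kappa>) \<longlonglongrightarrow> 2 * 0 / sqrt \<kappa>" by (intro tendsto_intros \<tau>0) (use \<kappa>_pos in simp)
  then have \<rho>0: "\<rho> \<longlonglongrightarrow> 0" by (simp add: \<rho>_def[abs_def])
  obtain s where s: "strict_mono s"
    "AE x in lborel. (\<lambda>i. (\<integral>y. indicator (ball x (\<rho> (s i))) y * \<bar>g y - g x\<bar> \<partial>lborel) / \<rho> (s i) ^ N) \<longlonglongrightarrow> 0"
    using lebesgue_points_subsequence[OF g \<rho> \<rho>0] unfolding DIM_complex_vec N_def by blast
  show ?thesis using s(2)
  proof eventually_elim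
    case (elim x)
    show ?case
    proof
      assume x: "x \<in> cball z0 (R/2)"
      have xR: "x \<in> cball z0 R" using x R_pos by auto
      define G where "G = (2 / sqrt \<kappa>) ^ N"
      define v where "v = unit_ball_vol (real N)"
      define E where "E = 2 * (2 * M * (C1 + C2) + 2 * C2)"
      define m where "m i = (\<integral>y. indicator (ball x (\<rho> i)) y * \<bar>g y - g x\<bar> \<partial>lborel) / \<rho> i ^ N" for i
      have m0: "(\<lambda>i. m (s i)) \<longlonglongrightarrow> 0" using elim by (simp add: m_def)
      have C20: "C2 > 0" using C1_pos by (simp add: C2_def)
      have E0: "E \<ge> 0" unfolding E_def using M_pos C1_pos C20 by (intro mult_nonneg_nonneg add_nonneg_nonneg) auto
      have \<rho>N: "\<rho> i ^ N = G * \<tau> i ^ N" for i by (simp add: \<rho>_def G_def power_mult_distrib power_divide)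
      have ballint: "integrable lborel (indicator (ball x e) :: _ \<Rightarrow> real)" for e
        using emeasure_bounded_finite[OF bounded_ball] by (intro integrable_real_indicator) auto
      have absint: "integrable lborel (\<lambda>y. indicator (ball x e) y * \<bar>g y - g x\<bar>)" for e
      proof -
        have "integrable lborel (\<lambda>y. g y * indicator (ball x e) y)"
          by (rule integrable_mult_bounded[OF g, of _ 1], rule borel_measurable_indicator) (auto simp: indicator_def)
        then have "integrable lborel (\<lambda>y. \<bar>g y * indicator (ball x e) y - g x * indicator (ball x e) y\<bar>)"
          by (intro integrable_abs Bochner_Integration.integrable_diff integrable_mult_right ballint)
        moreover have "(\<lambda>y. \<bar>g y * indicator (ball x e) y - g x * indicator (ball x e) y\<bar>) = (\<lambda>y. indicator (ball x e) y * \<bar>g y - g x\<bar>)"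
          by (auto simp: indicator_def fun_eq_iff)
        ultimately show ?thesis by simp
      qed
      have mI: "(\<integral>y. indicator (ball x (\<rho> i)) y * \<bar>g y - g x\<bar> \<partial>lborel) = m i * (G * \<tau> i ^ N)" for i
        using \<rho>[of i] unfolding \<rho>N[symmetric] by (simp add: m_def)
      \<comment> \<open>\<open>m i\<close> is the mean oscillation, which tends to 0 along
        \<open>s\<close>, and \<open>G\<close> converts powers of \<open>\<rho>\<close> into powers
        of \<open>\<tau>\<close>. The kernel is at most \<open>2 * M\<close> divided by
        \<open>\<tau> i ^ N\<close>, so all powers of \<open>\<tau>\<close> cancel except the single
        factor in the core error.\<close>
      have step: "g x * kernel_mass x - 2 * M * G * m i
         \<le> kernel_factor r * (\<integral>y. g y * mean_kernel r x y \<partial>lborel) + E * \<tau> i * (G * m i + \<bar>g x\<bar> * (v * G))" for i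
      proof -
        have mk: "mean_kernel (\<tau> i) x \<in> borel_measurable borel"
          by (intro borel_measurable_continuous_onI continuous_mean_kernel xR \<tau>)
        have imk: "integrable lborel (mean_kernel (\<tau> i) x)" by (rule mean_kernel_integrable[OF xR \<tau>(1)])
        have igk: "integrable lborel (\<lambda>y. g y * mean_kernel (\<tau> i) x y)"
          by (rule integrable_mult_bounded[OF g mk mean_kernel_le[OF \<tau>(1)]])
        have "g x * kernel_mass x - (\<integral>y. g y * mean_kernel (\<tau> i) x y \<partial>lborel)
            = (\<integral>y. g x * mean_kernel (\<tau> i) x y - g y * mean_kernel (\<tau> i) x y \<partial>lborel)"
          using imk igk integral_mean_kernel[OF xR \<tau>(1)[of i]] by simp
        also have "\<dots> \<le> (\<integral>y. 2 * M / \<tau> i ^ N * (indicator (ball x (\<rho> i)) y * \<bar>g y - g x\<bar>) \<partial>lborel)"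
        proof (rule integral_mono)
          show "integrable lborel (\<lambda>y. g x * mean_kernel (\<tau> i) x y - g y * mean_kernel (\<tau> i) x y)"
            using imk igk by simp
          show "integrable lborel (\<lambda>y. 2 * M / \<tau> i ^ N * (indicator (ball x (\<rho> i)) y * \<bar>g y - g x\<bar>))"
            using absint by (rule integrable_mult_right)
          fix y
          show "g x * mean_kernel (\<tau> i) x y - g y * mean_kernel (\<tau> i) x y \<le> 2 * M / \<tau> i ^ N * (indicator (ball x (\<rho> i)) y * \<bar>g y - g x\<bar>)"
          proof (cases "y \<in> ball x (\<rho> i)")
            case False
            then have "mean_kernel (\<tau> i) x y = 0"
              by (intro mean_kernel_eq_0[OF xR \<tau>(1)]) (simp add: \<rho>_def dist_norm norm_minus_commute)
            then show ?thesis using False by simp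
          next
            case True
            have "(g x - g y) * mean_kernel (\<tau> i) x y \<le> \<bar>g x - g y\<bar> * \<bar>mean_kernel (\<tau> i) x y\<bar>"
              by (metis abs_ge_self abs_mult)
            also have "\<dots> \<le> \<bar>g x - g y\<bar> * (2 * M / \<tau> i ^ N)"
              unfolding N_def by (intro mult_left_mono mean_kernel_le \<tau>) simp
            finally show ?thesis using True by (simp add: left_diff_distrib abs_minus_commute mult.commute)
          qed
        qed
        also have "\<dots> = 2 * M / \<tau> i ^ N * (m i * (G * \<tau> i ^ N))" by (simp only: integral_mult_right_zero mI)
        also have "\<dots> = 2 * M * G * m i" using \<tau>(1)[of i] by simp
        finally have lower: "g x * kernel_mass x - 2 * M * G * m i \<le> (\<integral>y. g y * mean_kernel (\<tau> i) x y \<partial>lborel)" by simp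
        have "(\<integral>y. indicator (ball x (\<rho> i)) y * \<bar>g y\<bar> \<partial>lborel)
            \<le> (\<integral>y. indicator (ball x (\<rho> i)) y * \<bar>g y - g x\<bar> + \<bar>g x\<bar> * indicator (ball x (\<rho> i)) y \<partial>lborel)"
        proof (rule integral_mono)
          show "integrable lborel (\<lambda>y. indicator (ball x (\<rho> i)) y * \<bar>g y\<bar>)"
            by (rule integrable_indicator_mult_abs[OF g]) simp
          show "integrable lborel (\<lambda>y. indicator (ball x (\<rho> i)) y * \<bar>g y - g x\<bar> + \<bar>g x\<bar> * indicator (ball x (\<rho> i)) y)"
            by (intro Bochner_Integration.integrable_add integrable_mult_right absint ballint)
        qed (auto simp: indicator_def)
        also have "\<dots> = m i * (G * \<tau> i ^ N) + \<bar>g x\<bar> * measure lborel (ball x (\<rho> i))"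
          using absint ballint by (simp add: mI)
        also have "measure lborel (ball x (\<rho> i)) = v * (G * \<tau> i ^ N)"
          unfolding v_def \<rho>N[symmetric] unfolding N_def
          using content_ball[OF less_imp_le[OF \<rho>[of i]], of x] unfolding DIM_complex_vec .
        finally have upper: "(\<integral>y. indicator (ball x (\<rho> i)) y * \<bar>g y\<bar> \<partial>lborel) \<le> m i * (G * \<tau> i ^ N) + \<bar>g x\<bar> * (v * (G * \<tau> i ^ N))" .
        have "E * (\<tau> i / \<tau> i ^ N) * (\<integral>y. indicator (ball x (\<rho> i)) y * \<bar>g y\<bar> \<partial>lborel)
            \<le> E * (\<tau> i / \<tau> i ^ N) * (m i * (G * \<tau> i ^ N) + \<bar>g x\<bar> * (v * (G * \<tau> i ^ N)))"
          using E0 \<tau>(1)[of i] by (intro mult_left_mono upper) auto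
        also have "\<dots> = E * \<tau> i * (G * m i + \<bar>g x\<bar> * (v * G))"
          using \<tau>(1)[of i] by (simp add: field_simps)
        finally have err: "E * (\<tau> i / \<tau> i ^ N) * (\<integral>y. indicator (ball x (\<rho> i)) y * \<bar>g y\<bar> \<partial>lborel)
            \<le> E * \<tau> i * (G * m i + \<bar>g x\<bar> * (v * G))" .
        have "(\<integral>y. g y * mean_kernel (\<tau> i) x y \<partial>lborel) \<le> kernel_factor r * (\<integral>y. g y * mean_kernel r x y \<partial>lborel)
            + E * (\<tau> i / \<tau> i ^ N) * (\<integral>y. indicator (ball x (\<rho> i)) y * \<bar>g y\<bar> \<partial>lborel)"
          unfolding E_def \<rho>_def N_def
          by (rule submean_inequality_approx[OF r \<tau> x g g_def neg sub])
        then show ?thesis using lower err by linarith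
      qed
      have st0: "(\<lambda>i. \<tau> (s i)) \<longlonglongrightarrow> 0"
        using LIMSEQ_subseq_LIMSEQ[OF \<tau>0 s(1)] by (simp add: o_def)
      have "(\<lambda>i. g x * kernel_mass x - 2 * M * G * m (s i)) \<longlonglongrightarrow> g x * kernel_mass x - 2 * M * G * 0"
        by (intro tendsto_intros m0)
      moreover have "(\<lambda>i. kernel_factor r * (\<integral>y. g y * mean_kernel r x y \<partial>lborel) + E * \<tau> (s i) * (G * m (s i) + \<bar>g x\<bar> * (v * G)))
          \<longlonglongrightarrow> kernel_factor r * (\<integral>y. g y * mean_kernel r x y \<partial>lborel) + E * 0 * (G * 0 + \<bar>g x\<bar> * (v * G))"
        by (intro tendsto_intros m0 st0)
      ultimately have "g x * kernel_mass x - 2 * M * G * 0 \<le> kernel_factor r * (\<integral>y. g y * mean_kernel r x y \<partial>lborel) + E * 0 * (G * 0 + \<bar>g x\<bar> * (v * G))"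
        by (rule LIMSEQ_le) (use step in blast)
      then have main: "kernel_mass x * g x \<le> kernel_factor r * (\<integral>y. g y * mean_kernel r x y \<partial>lborel)"
        by (simp add: mult.commute)
      have "(\<integral>y. g y * mean_kernel r x y \<partial>lborel) = (\<integral>y. f y * mean_kernel r x y \<partial>lborel)"
      proof (rule Bochner_Integration.integral_cong)
        fix y
        show "g y * mean_kernel r x y = f y * mean_kernel r x y"
        proof (cases "y \<in> cball z0 R")
          case False
          have "2 * r / sqrt \<kappa> \<le> R / 2" using r0 \<kappa>_pos by (simp add: field_simps)
          also have "R / 2 \<le> norm (y - x)"
            using False x dist_triangle[of z0 y x] by (simp add: dist_norm norm_minus_commute)
          finally have "mean_kernel r x y = 0" by (intro mean_kernel_eq_0[OF xR r0(1)])
          then show ?thesis by simp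
        qed (simp add: g_def)
      qed simp
      moreover have "g x = f x" using xR by (simp add: g_def)
      ultimately show "kernel_mass x * f x \<le> kernel_factor r * (\<integral>y. f y * mean_kernel r x y \<partial>lborel)"
        using main by simp
    qed
  qed
qed

end

subsection \<open>Local regularity by rescaling\<close>

text \<open>\<open>Limsup\<close> along the trivial filter is minus infinity, so this is needed
  before constants and positive multiples can be taken out of limits within sets of full measure. A
  trivial filter would make a small ball null.\<close>

lemma at_within_full_measure_neq_bot:
  fixes z :: "'a::euclidean_space"
  assumes r: "r > 0" and A: "ball z r - A \<in> null_sets lborel"
  shows "at z within A \<noteq> bot"
proof -
  have "z islimpt A"
    unfolding islimpt_approachable
  proof (intro allI impI)
    fix e :: real assume "e > 0"
    define m where "m = min e r"
    have m: "m > 0" using r \<open>e > 0\<close> by (simp add: m_def)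
    show "\<exists>x'\<in>A. x' \<noteq> z \<and> dist x' z < e"
    proof (rule ccontr)
      assume "\<not> ?thesis"
      then have "ball z m \<subseteq> (ball z r - A) \<union> {z}" by (auto simp: m_def dist_commute)
      moreover have "(ball z r - A) \<union> {z} \<in> null_sets lborel" using A by (intro null_sets.Un) auto
      ultimately have "ball z m \<in> null_sets lborel" by (rule null_sets_subset[rotated 2]) auto
      then have "measure lborel (ball z m) = 0" by (simp add: measure_def null_setsD1)
      then show False using m by simp
    qed
  qed
  then show ?thesis by (simp add: trivial_limit_within)
qed

lemma at_neq_bot_euclidean: "at (z::'a::euclidean_space) \<noteq> bot"
  using at_within_full_measure_neq_bot[of 1 z UNIV] by simp

lemma alpha_sh_cmult:
  assumes c: "c > 0" and u: "alpha_sh a D u"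
  shows "alpha_sh a D (\<lambda>z. ereal c * u z)"
proof (cases "\<forall>z\<in>D. u z = -\<infinity>")
  case True
  then show ?thesis using c by (simp add: alpha_sh_def)
next
  case False
  then have L: "L1_loc D u" and us: "strongly_usc D u"
    and sub: "\<And>\<omega>. nonneg_test_fun D \<omega> \<Longrightarrow> 0 \<le> (\<integral>z. real_of_ereal (u z) * alpha_ddc a \<omega> z \<partial>lborel)"
    using u by (auto simp: alpha_sh_def)
  have "L1_loc D (\<lambda>z. ereal c * u z)"
    unfolding L1_loc_def
  proof (intro allI impI conjI)
    fix C assume C: "compact C \<and> C \<subseteq> D"
    have 1: "AE z in lborel. z \<in> C \<longrightarrow> \<bar>u z\<bar> \<noteq> \<infinity>" "set_integrable lborel C (\<lambda>z. real_of_ereal (u z))"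
      using L C by (auto simp: L1_loc_def)
    show "AE z in lborel. z \<in> C \<longrightarrow> \<bar>ereal c * u z\<bar> \<noteq> \<infinity>"
      using 1(1)
    proof eventually_elim
      case (elim z)
      then show ?case by (cases "u z") auto
    qed
    show "set_integrable lborel C (\<lambda>z. real_of_ereal (ereal c * u z))"
      using set_integrable_mult_right[of c, OF 1(2)] by simp
  qed
  moreover have "strongly_usc D (\<lambda>z. ereal c * u z)"
    unfolding strongly_usc_def
  proof (intro ballI conjI allI impI)
    fix z0 assume z0: "z0 \<in> D"
    have ui: "u z0 < \<infinity>" "Limsup (at z0) u \<le> u z0" using us z0 by (auto simp: strongly_usc_def)
    show "ereal c * u z0 < \<infinity>" using ui(1) c by (cases "u z0") auto
    have "Limsup (at z0) (\<lambda>z. ereal c * u z) = ereal c * Limsup (at z0) u"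
      using c by (intro Limsup_ereal_mult_left at_neq_bot_euclidean) simp
    also have "\<dots> \<le> ereal c * u z0" using ui(2) c by (intro ereal_mult_left_mono) auto
    finally show "Limsup (at z0) (\<lambda>z. ereal c * u z) \<le> ereal c * u z0" .
    fix A assume A: "\<exists>r>0. ball z0 r - A \<in> null_sets lborel"
    then have "at z0 within A \<noteq> bot" using at_within_full_measure_neq_bot by blast
    then have "Limsup (at z0 within A) (\<lambda>z. ereal c * u z) = ereal c * Limsup (at z0 within A) u"
      using c by (intro Limsup_ereal_mult_left) auto
    then show "Limsup (at z0 within A) (\<lambda>z. ereal c * u z) = ereal c * u z0"
      using us z0 A by (simp add: strongly_usc_def)
  qed
  moreover have "0 \<le> (\<integral>z. real_of_ereal (ereal c * u z) * alpha_ddc a \<omega> z \<partial>lborel)" if "nonneg_test_fun D \<omega>" for \<omega>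
    using sub[OF that] c by (simp add: mult.assoc)
  ultimately show ?thesis by (simp add: alpha_sh_def)
qed

text \<open>The constant -1 is the competitor that gives the lower bound for the extremal function
  with boundary value -1. The test condition is the affine identity with slope 0.\<close>

lemma alpha_sh_const:
  assumes form: "admissible_form U a" and D: "D \<subseteq> U"
  shows "alpha_sh a D (\<lambda>_. ereal c)"
proof -
  have "set_integrable lborel C (\<lambda>z. c)" if "compact C" for C :: "(complex^'a) set"
    unfolding set_integrable_def using emeasure_compact_finite[OF that] borel_compact[OF that]
    by (intro integrable_scaleR_left integrable_real_indicator) auto
  then have "L1_loc D (\<lambda>_. ereal c)" by (simp add: L1_loc_def)
  moreover have "strongly_usc D (\<lambda>_. ereal c)"
    unfolding strongly_usc_def
    by (auto simp: Limsup_const at_neq_bot_euclidean dest: at_within_full_measure_neq_bot)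
  moreover have "0 \<le> (\<integral>z. real_of_ereal (ereal c) * alpha_ddc a \<omega> z \<partial>lborel)" if \<omega>: "nonneg_test_fun D \<omega>" for \<omega>
  proof -
    have "nonneg_test_fun U \<omega>" using \<omega> D by (auto simp: nonneg_test_fun_def)
    from integral_affine_alpha_ddc_eq_0(1)[OF form this, of "\<lambda>_. c" c 0] show ?thesis by auto
  qed
  ultimately show ?thesis by (simp add: alpha_sh_def)
qed

section \<open>Competitors and bounds of the extremal functions\<close>

lemma U_class_le_omega: "u \<in> U_class a E D \<psi> \<Longrightarrow> u z \<le> omega_alpha a z E D \<psi>"
  unfolding omega_alpha_def by (rule SUP_upper)

lemma le_Limsup_nhds: "f z \<le> Limsup (nhds z) (f :: 'a::topological_space \<Rightarrow> ereal)"
  unfolding Limsup_def by (intro INF_greatest) (auto dest: eventually_nhds_x_imp_x intro: SUP_upper)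

lemma U_class_le_omega_star: "u \<in> U_class a E D \<psi> \<Longrightarrow> u z \<le> omega_alpha_star a z E D \<psi>"
  unfolding omega_alpha_star_def
  using order_trans[OF U_class_le_omega le_Limsup_nhds[of "\<lambda>w. omega_alpha a w E D \<psi>"]] .

text \<open>Translates a limsup of a supremum into a bound that holds near \<open>z0\<close> for all
  competitors at once; \<open>omega_star_eventually_less\<close> is the way back. Working with these
  two avoids handling the extremal function itself.\<close>

lemma omega_star_leI:
  assumes "\<And>\<epsilon>. \<epsilon> > 0 \<Longrightarrow> eventually (\<lambda>z. \<forall>u\<in>U_class a E D \<psi>. u z \<le> ereal (c + \<epsilon>)) (nhds z0)"
  shows "omega_alpha_star a z0 E D \<psi> \<le> ereal c"
proof (rule ereal_le_epsilon2)
  fix \<epsilon> :: real assume "\<epsilon> > 0"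
  have "omega_alpha_star a z0 E D \<psi> \<le> ereal (c + \<epsilon>)"
    unfolding omega_alpha_star_def omega_alpha_def
    by (rule Limsup_bounded, rule eventually_mono[OF assms[OF \<open>\<epsilon> > 0\<close>]]) (auto intro: SUP_least)
  then show "omega_alpha_star a z0 E D \<psi> \<le> ereal c + ereal \<epsilon>" by simp
qed

lemma omega_star_eventually_less:
  assumes "omega_alpha_star a z0 E D \<psi> = ereal c" "\<epsilon> > 0"
  shows "eventually (\<lambda>z. \<forall>u\<in>U_class a E D \<psi>. u z < ereal (c + \<epsilon>)) (nhds z0)"
proof -
  have "Limsup (nhds z0) (\<lambda>w. omega_alpha a w E D \<psi>) < ereal (c + \<epsilon>)"
    using assms by (simp add: omega_alpha_star_def)
  from Limsup_lessD[OF this] show ?thesis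
    by eventually_elim (use U_class_le_omega le_less_trans in blast)
qed

lemma ereal_cmult_less_imp_le:
  assumes "c > 0" "ereal c * x < ereal y"
  shows "x \<le> ereal (y / c)"
  using assms by (cases x) (auto simp: field_simps)

lemma closure_ball_subset_cball: "closure (B \<inter> ball z s) \<subseteq> closure B \<inter> cball z s"
  by (meson Int_lower1 Int_lower2 ball_subset_cball closed_cball closure_minimal closure_mono dual_order.trans le_inf_iff)

text \<open>Multiplying a competitor for -1 by a constant slightly larger than
  \<open>- \<psi> z0\<close> pushes it below \<open>\<psi>\<close> on a small neighbourhood;
  regularity there is divided by the constant again.\<close>

lemma loc_psi_imp_loc_alpha_regular:
  assumes form: "admissible_form U a" and DU: "D \<subseteq> U" and D: "open D"
    and z0: "z0 \<in> K" and psi_cont: "continuous_on K \<psi>" and psi_neg: "\<forall>z\<in>K. \<psi> z < 0"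
    and loc: "loc_psi_regular_point a z0 K D \<psi>"
  shows "loc_alpha_regular_point a z0 K D"
  unfolding loc_alpha_regular_point_def
proof (intro allI impI, elim conjE)
  fix B assume B: "z0 \<in> interior B" "B \<subseteq> D"
  let ?E = "K \<inter> closure B"
  define p where "p = - \<psi> z0"
  have p: "p > 0" using psi_neg z0 by (auto simp: p_def)
  have "(\<lambda>_. ereal (-1)) \<in> U_class a ?E D (\<lambda>_. -1)"
    using alpha_sh_const[OF form DU, of "-1"] by (auto simp: U_class_def)
  from U_class_le_omega_star[OF this] have lower: "ereal (-1) \<le> omega_alpha_star a z0 ?E D (\<lambda>_. -1)" .
  have "omega_alpha_star a z0 ?E D (\<lambda>_. -1) \<le> ereal (-1)"
  proof (rule omega_star_leI)
    fix \<epsilon> :: real assume \<epsilon>: "\<epsilon> > 0"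
    \<comment> \<open>The final bound is \<open>(- p + e) / (p + e)\<close>, that is
      \<open>-1 + 2 * e / (p + e)\<close>, and \<open>2 * e = p * \<epsilon>\<close>.\<close>
    define e where "e = p * \<epsilon> / 2"
    have e: "e > 0" using p \<epsilon> by (simp add: e_def)
    define c where "c = p + e"
    have c: "c > 0" using p e by (simp add: c_def)
    obtain s where s: "s > 0" "\<And>z. z \<in> K \<Longrightarrow> dist z z0 < s \<Longrightarrow> dist (\<psi> z) (\<psi> z0) < e"
      using psi_cont z0 e unfolding continuous_on_iff by metis
    \<comment> \<open>Half the radius, so that the closure still lies where \<open>\<psi>\<close>
      differs from \<open>\<psi> z0\<close> by less than \<open>e\<close>.\<close>
    define B' where "B' = B \<inter> ball z0 (s/2)"
    have zB': "z0 \<in> interior B'" using B s by (simp add: B'_def interior_Int)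
    have clB': "closure B' \<subseteq> closure B \<inter> cball z0 (s/2)"
      unfolding B'_def by (rule closure_ball_subset_cball)
    have mem: "(\<lambda>z. ereal c * u z) \<in> U_class a (K \<inter> closure B') D \<psi>" if u: "u \<in> U_class a ?E D (\<lambda>_. -1)" for u
      unfolding U_class_def
    proof (intro CollectI conjI ballI)
      show "alpha_sh a D (\<lambda>z. ereal c * u z)" using u c by (auto simp: U_class_def intro: alpha_sh_cmult)
      show "ereal c * u z < 0" if "z \<in> D" for z
        using u that c by (cases "u z") (auto simp: U_class_def mult_pos_neg zero_ereal_def dest!: bspec[of D _ z])
      fix z assume z: "z \<in> K \<inter> closure B'"
      then have zE: "z \<in> ?E" and d: "dist z z0 < s" using clB' s(1) by (auto simp: dist_commute)
      have "u z \<le> ereal (-1)" using u zE unfolding U_class_def by blast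
      then have "ereal c * u z \<le> ereal c * ereal (-1)" using c by (intro ereal_mult_left_mono) auto
      also have "\<dots> = ereal (-c)" by simp
      also have "\<dots> \<le> ereal (\<psi> z)" using s(2)[of z] zE d by (auto simp: c_def p_def dist_real_def)
      finally show "ereal c * u z \<le> ereal (\<psi> z)" .
    qed
    have "omega_alpha_star a z0 (K \<inter> closure B') D \<psi> = ereal (\<psi> z0)"
      using loc zB' unfolding loc_psi_regular_point_def by blast
    from omega_star_eventually_less[OF this e]
    show "\<forall>\<^sub>F z in nhds z0. \<forall>u\<in>U_class a ?E D (\<lambda>_. -1). u z \<le> ereal (-1 + \<epsilon>)"
    proof eventually_elim
      case (elim z)
      show ?case
      proof
        fix u assume u: "u \<in> U_class a ?E D (\<lambda>_. -1)"
        have "ereal c * u z < ereal (\<psi> z0 + e)" using bspec[OF elim mem[OF u]] .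
        then have "u z \<le> ereal ((\<psi> z0 + e) / c)" by (rule ereal_cmult_less_imp_le[OF c])
        moreover have "(\<psi> z0 + e) / c \<le> -1 + \<epsilon>"
        proof -
          have "(-1 + \<epsilon>) * c = - p - e + \<epsilon> * p + \<epsilon> * e" by (simp add: c_def algebra_simps)
          moreover have "\<epsilon> * p = 2 * e" "\<epsilon> * e \<ge> 0" using \<epsilon> e by (auto simp: e_def)
          ultimately have "\<psi> z0 + e \<le> (-1 + \<epsilon>) * c" by (simp add: p_def)
          then show ?thesis using c by (simp add: pos_divide_le_eq)
        qed
        ultimately show "u z \<le> ereal (-1 + \<epsilon>)" by (meson ereal_less_eq(3) order_trans)
      qed
    qed
  qed
  then have "omega_alpha_star a z0 ?E D (\<lambda>_. -1) = ereal (-1)" using lower by (rule antisym)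
  then show "omega_alpha_star a z0 ?E D (\<lambda>_. -1) = -1" by (simp add: one_ereal_def)
qed

text \<open>The subharmonic extension is itself a competitor. Hence each regularity statement for
  \<open>\<psi>\<close> amounts to an upper bound.\<close>

lemma psi_le_omega_star:
  assumes ext: "alpha_sh a D \<psi>'" "\<forall>z\<in>D. \<psi>' z < 0" "\<forall>z\<in>K. \<psi>' z = ereal (\<psi> z)"
    and "E \<subseteq> K" "z0 \<in> K"
  shows "ereal (\<psi> z0) \<le> omega_alpha_star a z0 E D \<psi>"
proof -
  have "\<psi>' \<in> U_class a E D \<psi>" using assms by (auto simp: U_class_def)
  from U_class_le_omega_star[OF this, of z0] show ?thesis using assms by auto
qed

text \<open>The reverse scaling: near \<open>z0\<close> every value of \<open>\<psi>\<close> is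
  below \<open>- c\<close> with \<open>c\<close> slightly less than \<open>- \<psi> z0\<close>, so
  dividing a competitor by \<open>c\<close> gives one for -1.\<close>

lemma loc_alpha_imp_loc_psi_regular:
  assumes D: "open D" and KD: "K \<subseteq> D"
    and z0: "z0 \<in> K" and psi_cont: "continuous_on K \<psi>" and psi_neg: "\<forall>z\<in>K. \<psi> z < 0"
    and ext: "alpha_sh a D \<psi>'" "\<forall>z\<in>D. \<psi>' z < 0" "\<forall>z\<in>K. \<psi>' z = ereal (\<psi> z)"
    and loc: "loc_alpha_regular_point a z0 K D"
  shows "loc_psi_regular_point a z0 K D \<psi>"
  unfolding loc_psi_regular_point_def
proof (intro allI impI)
  fix B assume B: "z0 \<in> interior B"
  let ?E = "K \<inter> closure B"
  define p where "p = - \<psi> z0"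
  have p: "p > 0" using psi_neg z0 by (auto simp: p_def)
  have "omega_alpha_star a z0 ?E D \<psi> \<le> ereal (\<psi> z0)"
  proof (rule omega_star_leI)
    fix \<epsilon> :: real assume \<epsilon>: "\<epsilon> > 0"
    \<comment> \<open>The final bound is \<open>(p - e) * (e - 1)\<close>, that is
      \<open>- p + e * (1 + p) - e * e\<close>; the first entry of the minimum keeps
      \<open>c\<close> positive.\<close>
    define e where "e = min (p/2) (\<epsilon> / (1 + p))"
    have e: "e > 0" "e < p" "e * (1 + p) \<le> \<epsilon>"
      using p \<epsilon> by (auto simp: e_def min_def field_simps)
    define c where "c = p - e"
    have c: "c > 0" using e by (simp add: c_def)
    obtain s where s: "s > 0" "\<And>z. z \<in> K \<Longrightarrow> dist z z0 < s \<Longrightarrow> dist (\<psi> z) (\<psi> z0) < e"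
      using psi_cont z0 e unfolding continuous_on_iff by metis
    \<comment> \<open>Local regularity for -1 speaks only of neighbourhoods inside \<open>D\<close>,
      hence the intersection with \<open>D\<close>.\<close>
    define B' where "B' = (B \<inter> D) \<inter> ball z0 (s/2)"
    have zB': "z0 \<in> interior B'" using B s z0 KD D by (auto simp: B'_def interior_Int interior_open)
    have clB': "closure B' \<subseteq> closure B \<inter> cball z0 (s/2)"
      unfolding B'_def using closure_ball_subset_cball[of "B \<inter> D" z0 "s/2"] closure_mono[of "B \<inter> D" B] by blast
    have mem: "(\<lambda>z. ereal (1/c) * u z) \<in> U_class a (K \<inter> closure B') D (\<lambda>_. -1)" if u: "u \<in> U_class a ?E D \<psi>" for u
      unfolding U_class_def
    proof (intro CollectI conjI ballI)
      show "alpha_sh a D (\<lambda>z. ereal (1/c) * u z)" using u c by (auto simp: U_class_def intro!: alpha_sh_cmult)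
      show "ereal (1/c) * u z < 0" if "z \<in> D" for z
        using u that c by (cases "u z") (auto simp: U_class_def divide_neg_pos zero_ereal_def dest!: bspec[of D _ z])
      fix z assume z: "z \<in> K \<inter> closure B'"
      then have zE: "z \<in> ?E" and d: "dist z z0 < s" using clB' s(1) by (auto simp: dist_commute)
      have "u z \<le> ereal (\<psi> z)" using u zE unfolding U_class_def by blast
      also have "\<dots> \<le> ereal (- c)" using s(2)[of z] zE d by (auto simp: c_def p_def dist_real_def)
      finally have "ereal (1/c) * u z \<le> ereal (1/c) * ereal (-c)" using c by (intro ereal_mult_left_mono) auto
      then show "ereal (1/c) * u z \<le> ereal (-1)" using c by simp
    qed
    have "omega_alpha_star a z0 (K \<inter> closure B') D (\<lambda>_. -1) = ereal (-1)"
    proof -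
      have "B' \<subseteq> D" by (auto simp: B'_def)
      then show ?thesis using loc zB' unfolding loc_alpha_regular_point_def by (simp add: one_ereal_def)
    qed
    from omega_star_eventually_less[OF this e(1)]
    show "\<forall>\<^sub>F z in nhds z0. \<forall>u\<in>U_class a ?E D \<psi>. u z \<le> ereal (\<psi> z0 + \<epsilon>)"
    proof eventually_elim
      case (elim z)
      show ?case
      proof
        fix u assume u: "u \<in> U_class a ?E D \<psi>"
        have "ereal (1/c) * u z < ereal (-1 + e)" using bspec[OF elim mem[OF u]] .
        then have "u z \<le> ereal ((-1 + e) / (1/c))" by (rule ereal_cmult_less_imp_le[rotated]) (use c in simp)
        moreover have "(-1 + e) / (1/c) \<le> \<psi> z0 + \<epsilon>"
        proof -
          have "(-1 + e) / (1/c) = - p + e * (1 + p) - e * e" by (simp add: c_def algebra_simps)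
          also have "\<dots> \<le> - p + \<epsilon>" using e by (smt (verit) mult_pos_pos)
          finally show ?thesis by (simp add: p_def)
        qed
        ultimately show "u z \<le> ereal (\<psi> z0 + \<epsilon>)" by (meson ereal_less_eq(3) order_trans)
      qed
    qed
  qed
  then show "omega_alpha_star a z0 ?E D \<psi> = ereal (\<psi> z0)"
    using psi_le_omega_star[OF ext _ z0, of ?E] by (intro antisym) auto
qed

subsection \<open>Regularisation by the essential limsup\<close>

text \<open>For a sum of two \<open>\<alpha>\<close>-subharmonic functions only the inequality in strong upper semicontinuity
  is immediate, so the equality is dropped here and restored by passing to the essential limsup. The
  real representative \<open>f\<close> avoids arithmetic with \<open>-\<infinity>\<close> on the null set where \<open>w\<close> is infinite.\<close>

definition weakly_sh :: "(complex^'n \<Rightarrow> 'n \<Rightarrow> 'n \<Rightarrow> complex) \<Rightarrow> (complex^'n) set \<Rightarrow> (complex^'n \<Rightarrow> ereal) \<Rightarrow> (complex^'n \<Rightarrow> real) \<Rightarrow> bool" where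
  "weakly_sh a D w f \<longleftrightarrow> (\<forall>C. compact C \<and> C \<subseteq> D \<longrightarrow> set_integrable lborel C f) \<and>
     (AE z in lborel. z \<in> D \<longrightarrow> w z = ereal (f z)) \<and>
     (\<forall>z\<in>D. w z < \<infinity> \<and> (\<forall>c::real. w z < ereal c \<longrightarrow> eventually (\<lambda>y. w y < ereal c) (at z))) \<and>
     (\<forall>\<omega>. nonneg_test_fun D \<omega> \<longrightarrow> 0 \<le> (\<integral>z. f z * alpha_ddc a \<omega> z \<partial>lborel))"

lemma AE_open_of_compact:
  fixes D :: "'a::euclidean_space set"
  assumes "open D" "\<And>C. compact C \<Longrightarrow> C \<subseteq> D \<Longrightarrow> AE z in lborel. z \<in> C \<longrightarrow> P z"
  shows "AE z in lborel. z \<in> D \<longrightarrow> P z"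
proof -
  obtain C :: "nat \<Rightarrow> 'a set" where C: "\<And>n. compact (C n)" "\<And>n. C n \<subseteq> D" "\<Union> (range C) = D"
    using open_Union_compact_subsets[OF assms(1)] by metis
  have "AE z in lborel. \<forall>n. z \<in> C n \<longrightarrow> P z"
    unfolding AE_all_countable using assms(2) C by blast
  then show ?thesis by eventually_elim (use C(3) in blast)
qed

text \<open>A point where the value is not minus infinity rules out the degenerate case of
  \<open>alpha_sh\<close>. Then the values are finite almost everywhere, and
  \<open>real_of_ereal\<close> alters the function only on a null set, by its default 0.\<close>

lemma alpha_sh_imp_weakly_sh:
  assumes D: "open D" and u: "alpha_sh a D u" and z: "z \<in> D" "u z \<noteq> -\<infinity>"
  shows "weakly_sh a D u (\<lambda>z. real_of_ereal (u z))" "strongly_usc D u"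
proof -
  have L: "L1_loc D u" and us: "strongly_usc D u"
    and sub: "\<And>\<omega>. nonneg_test_fun D \<omega> \<Longrightarrow> 0 \<le> (\<integral>z. real_of_ereal (u z) * alpha_ddc a \<omega> z \<partial>lborel)"
    using u z by (auto simp: alpha_sh_def)
  have "AE z in lborel. z \<in> D \<longrightarrow> u z = ereal (real_of_ereal (u z))"
  proof (rule AE_open_of_compact[OF D])
    fix C assume "compact C" "C \<subseteq> D"
    then have "AE z in lborel. z \<in> C \<longrightarrow> \<bar>u z\<bar> \<noteq> \<infinity>" using L by (auto simp: L1_loc_def)
    then show "AE z in lborel. z \<in> C \<longrightarrow> u z = ereal (real_of_ereal (u z))"
      by eventually_elim (simp add: ereal_real')
  qed
  moreover have "eventually (\<lambda>y. u y < ereal c) (at z)" if "z \<in> D" "u z < ereal c" for z c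
  proof -
    have "Limsup (at z) u \<le> u z" using us that by (auto simp: strongly_usc_def)
    then show ?thesis using that by (intro Limsup_lessD) auto
  qed
  ultimately show "weakly_sh a D u (\<lambda>z. real_of_ereal (u z))"
    using L us sub by (auto simp: weakly_sh_def L1_loc_def strongly_usc_def)
  show "strongly_usc D u" by (rule us)
qed

lemma weakly_sh_integrable:
  assumes "admissible_form U a" "D \<subseteq> U" "weakly_sh a D w f" "nonneg_test_fun D \<omega>"
  shows "integrable lborel (\<lambda>z. f z * alpha_ddc a \<omega> z)"
  by (rule L1_loc_integrable_alpha_ddc[OF assms(1,2,4)]) (use assms(3) in \<open>auto simp: weakly_sh_def\<close>)

text \<open>Distributes a strict bound on a sum over the summands, so that upper semicontinuity of
  each can be used. A summand equal to minus infinity gets a bound low enough to make room for the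
  other.\<close>

lemma ereal_add_less_split:
  fixes a b :: ereal
  assumes "a + b < ereal c" "a < \<infinity>" "b < \<infinity>"
  obtains c1 c2 where "a < ereal c1" "b < ereal c2" "c1 + c2 \<le> c"
proof (cases a)
  case (real r)
  show ?thesis
  proof (cases b)
    case (real s)
    define d where "d = (c - r - s) / 2"
    have "d > 0" using assms real \<open>a = ereal r\<close> by (simp add: d_def)
    then show ?thesis using that[of "r + d" "s + d"] real \<open>a = ereal r\<close> by (simp add: d_def field_simps)
  next
    case MInf
    then show ?thesis using that[of "r + 1" "c - r - 1"] real by simp
  qed (use assms in auto)
next
  case MInf
  then show ?thesis
  proof (cases b)
    case (real s)
    then show ?thesis using that[of "c - s - 1" "s + 1"] MInf by simp
  next
    case MInf': MInf
    then show ?thesis using that[of 0 c] MInf by simp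
  qed (use assms in auto)
qed (use assms in auto)

lemma weakly_sh_add:
  assumes form: "admissible_form U a" and DU: "D \<subseteq> U"
    and w: "weakly_sh a D w f" and u: "weakly_sh a D u g"
  shows "weakly_sh a D (\<lambda>z. w z + u z) (\<lambda>z. f z + g z)"
  unfolding weakly_sh_def
proof (intro conjI allI impI ballI)
  show "set_integrable lborel C (\<lambda>z. f z + g z)" if "compact C \<and> C \<subseteq> D" for C
    using w u that by (intro set_integral_add) (auto simp: weakly_sh_def)
  have "AE z in lborel. z \<in> D \<longrightarrow> w z = ereal (f z)" "AE z in lborel. z \<in> D \<longrightarrow> u z = ereal (g z)"
    using w u by (auto simp: weakly_sh_def)
  then show "AE z in lborel. z \<in> D \<longrightarrow> w z + u z = ereal (f z + g z)" by eventually_elim auto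
  fix z assume z: "z \<in> D"
  have lt: "w z < \<infinity>" "u z < \<infinity>" using w u z by (auto simp: weakly_sh_def)
  then show "w z + u z < \<infinity>" by auto
  fix c :: real assume "w z + u z < ereal c"
  then obtain c1 c2 where c: "w z < ereal c1" "u z < ereal c2" "c1 + c2 \<le> c"
    using ereal_add_less_split[OF _ lt] by metis
  have "eventually (\<lambda>y. w y < ereal c1) (at z)" "eventually (\<lambda>y. u y < ereal c2) (at z)"
    using w u z c by (auto simp: weakly_sh_def)
  then show "eventually (\<lambda>y. w y + u y < ereal c) (at z)"
  proof eventually_elim
    case (elim y)
    then have "w y + u y < ereal c1 + ereal c2" by (rule ereal_add_strict_mono2)
    then show ?case using c(3) by (metis ereal_less_eq(3) less_le_trans plus_ereal.simps(1))
  qed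
next
  fix \<omega> assume \<omega>: "nonneg_test_fun D \<omega>"
  have "(\<integral>z. (f z + g z) * alpha_ddc a \<omega> z \<partial>lborel) = (\<integral>z. f z * alpha_ddc a \<omega> z \<partial>lborel) + (\<integral>z. g z * alpha_ddc a \<omega> z \<partial>lborel)"
    using weakly_sh_integrable[OF form DU w \<omega>] weakly_sh_integrable[OF form DU u \<omega>]
    by (simp add: distrib_right)
  then show "0 \<le> (\<integral>z. (f z + g z) * alpha_ddc a \<omega> z \<partial>lborel)"
    using w u \<omega> by (simp add: weakly_sh_def)
qed

lemma weakly_sh_affine:
  fixes l :: "complex^'n \<Rightarrow> real"
  assumes form: "admissible_form U a" and DU: "D \<subseteq> U" and l: "\<And>z. l z = c + inner p z"
  shows "weakly_sh a D (\<lambda>z. ereal (l z)) l"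
  unfolding weakly_sh_def
proof (intro conjI allI impI ballI)
  have cont: "continuous_on A l" for A unfolding l by (intro continuous_intros)
  show "set_integrable lborel C l" if "compact C \<and> C \<subseteq> D" for C
    unfolding set_integrable_def using that by (intro borel_integrable_compact cont) auto
  fix z c assume "ereal (l z) < ereal c"
  then have "eventually (\<lambda>y. l y < c) (at z)"
    using cont[of UNIV] by (intro order_tendstoD) (auto simp: continuous_on_def)
  then show "eventually (\<lambda>y. ereal (l y) < ereal c) (at z)" by simp
next
  fix \<omega> assume "nonneg_test_fun D \<omega>"
  then have "nonneg_test_fun U \<omega>" using DU by (auto simp: nonneg_test_fun_def)
  then show "0 \<le> (\<integral>z. l z * alpha_ddc a \<omega> z \<partial>lborel)"
    using integral_affine_alpha_ddc_eq_0(1)[OF form _ l] by simp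
qed auto

text \<open>The infimum of the levels that bound \<open>v\<close> almost everywhere on some ball
  around the point. The levels are real, so a function without such a bound gets the infimum of the
  empty set, infinity.\<close>

definition ess_limsup :: "('a::euclidean_space \<Rightarrow> ereal) \<Rightarrow> 'a \<Rightarrow> ereal" where
  "ess_limsup v z = Inf {ereal c |c. \<exists>r>0. AE y in lborel. y \<in> ball z r \<longrightarrow> v y \<le> ereal c}"

lemma ess_limsup_leI:
  "r > 0 \<Longrightarrow> AE y in lborel. y \<in> ball z r \<longrightarrow> v y \<le> ereal c \<Longrightarrow> ess_limsup v z \<le> ereal c"
  unfolding ess_limsup_def by (intro Inf_lower) auto

lemma ess_limsup_lessD:
  assumes "ess_limsup v z < C"
  obtains c r where "ereal c < C" "r > 0" "AE y in lborel. y \<in> ball z r \<longrightarrow> v y \<le> ereal c"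
  using assms unfolding ess_limsup_def Inf_less_iff by auto

lemma open_ess_limsup_less: "open {z. ess_limsup v z < C}"
  unfolding open_contains_ball
proof
  fix z assume "z \<in> {z. ess_limsup v z < C}"
  then obtain c r where cr: "ereal c < C" "r > 0" "AE y in lborel. y \<in> ball z r \<longrightarrow> v y \<le> ereal c"
    using ess_limsup_lessD by blast
  have "ball z r \<subseteq> {z. ess_limsup v z < C}"
  proof
    fix x assume x: "x \<in> ball z r"
    then obtain e where e: "e > 0" "ball x e \<subseteq> ball z r" by (rule openE[OF open_ball])
    have "AE y in lborel. y \<in> ball x e \<longrightarrow> v y \<le> ereal c"
      using cr(3) by eventually_elim (use e in blast)
    from ess_limsup_leI[OF e(1) this] show "x \<in> {z. ess_limsup v z < C}" using cr(1) by auto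
  qed
  then show "\<exists>e>0. ball z e \<subseteq> {z. ess_limsup v z < C}" using cr(2) by blast
qed

text \<open>The strict sublevel sets are open, so measurability holds for arbitrary
  \<open>v\<close>.\<close>

lemma borel_measurable_ess_limsup: "ess_limsup v \<in> borel_measurable borel"
  by (rule borel_measurableI_less) (simp add: open_ess_limsup_less)

text \<open>The exceptional set depends on a ball and a level. Shrinking the ball to a set of a
  countable basis and raising the level to a rational number leaves only countably many null
  sets.\<close>

lemma AE_le_ess_limsup: "AE z in lborel. v z \<le> ess_limsup v z"
proof -
  obtain \<B> :: "'a set set" where \<B>: "countable \<B>" "topological_basis \<B>"
    using ex_countable_basis by blast
  have "AE z in lborel. \<forall>(q, W)\<in>{(q, W) \<in> \<rat> \<times> \<B>. AE y in lborel. y \<in> W \<longrightarrow> v y \<le> ereal q}. z \<in> W \<longrightarrow> v z \<le> ereal q"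
    by (subst AE_ball_countable) (auto intro!: countable_subset[OF _ countable_SIGMA[OF countable_rat \<B>(1)]])
  then show ?thesis
  proof eventually_elim
    case (elim z)
    show ?case
    proof (rule ccontr)
      assume "\<not> v z \<le> ess_limsup v z"
      then have lt: "ess_limsup v z < v z" by simp
      then obtain c r where cr: "ereal c < v z" "r > 0" "AE y in lborel. y \<in> ball z r \<longrightarrow> v y \<le> ereal c"
        using ess_limsup_lessD by blast
      obtain c' :: real where c': "ereal c < ereal c'" "ereal c' < v z" using ereal_dense2[OF cr(1)] by auto
      obtain q where q: "q \<in> \<rat>" "c < q" "q < c'" using Rats_dense_in_real[of c c'] c'(1) by auto
      obtain W where W: "W \<in> \<B>" "z \<in> W" "W \<subseteq> ball z r"
        using topological_basisE[OF \<B>(2), of "ball z r" z] cr(2) by auto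
      have "AE y in lborel. y \<in> W \<longrightarrow> v y \<le> ereal q"
        using cr(3)
      proof eventually_elim
        case (elim y)
        then show ?case using W(3) q(2) by (meson ereal_less_eq(3) less_imp_le order_trans subsetD)
      qed
      then have "v z \<le> ereal q" using elim q(1) W by blast
      then show False using q(3) c'(2) by (meson ereal_less_eq(3) leD less_imp_le order_trans)
    qed
  qed
qed

lemma AE_lborel_neq: "AE y in lborel. y \<noteq> (z::'a::euclidean_space)"
  by (rule AE_I[of _ _ "{z}"]) auto

lemma ess_limsup_le:
  assumes "\<And>c::real. v z < ereal c \<Longrightarrow> eventually (\<lambda>y. v y < ereal c) (at z)"
  shows "ess_limsup v z \<le> v z"
proof (rule ereal_le_real)
  fix c assume "v z \<le> ereal c"
  show "ess_limsup v z \<le> ereal c"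
  proof (rule ereal_le_epsilon2)
    fix e :: real assume e: "0 < e"
    then have "v z < ereal (c + e)" using \<open>v z \<le> ereal c\<close> by (metis ereal_less(2) ereal_less_eq(3) le_less_trans less_add_same_cancel1 less_ereal.simps(1))
    from assms[OF this] obtain r where r: "r > 0" "\<And>y. y \<noteq> z \<Longrightarrow> dist y z < r \<Longrightarrow> v y < ereal (c + e)"
      unfolding eventually_at by auto
    have "AE y in lborel. y \<in> ball z r \<longrightarrow> v y \<le> ereal (c + e)"
      using AE_lborel_neq[of z] by eventually_elim (use r(2) in \<open>auto simp: dist_commute less_imp_le\<close>)
    from ess_limsup_leI[OF r(1) this] show "ess_limsup v z \<le> ereal c + ereal e" by simp
  qed
qed

text \<open>A level that bounds the function on a set of full measure near the point bounds
  \<open>v\<close> there almost everywhere, by \<open>AE_le_ess_limsup\<close>, and hence bounds the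
  essential limsup at the point. So discarding a null set cannot lower the limsup.\<close>

lemma strongly_usc_ess_limsup:
  assumes D: "open D" and fin: "\<And>z. z \<in> D \<Longrightarrow> ess_limsup v z < \<infinity>"
  shows "strongly_usc D (ess_limsup v)"
  unfolding strongly_usc_def
proof (intro ballI conjI allI impI)
  fix z assume z: "z \<in> D"
  show "ess_limsup v z < \<infinity>" using fin z .
  have up: "Limsup (at z within A) (ess_limsup v) \<le> ess_limsup v z" for A
    unfolding Limsup_le_iff
  proof (intro allI impI)
    fix C assume "ess_limsup v z < C"
    then have "eventually (\<lambda>y. ess_limsup v y < C) (nhds z)"
      using open_ess_limsup_less[of v C] by (auto simp: eventually_nhds)
    then show "\<forall>\<^sub>F y in at z within A. ess_limsup v y < C"
      unfolding eventually_at_filter by eventually_elim auto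
  qed
  from up[of UNIV] show "Limsup (at z) (ess_limsup v) \<le> ess_limsup v z" .
  fix A assume "\<exists>r>0. ball z r - A \<in> null_sets lborel"
  then obtain r where r: "r > 0" "ball z r - A \<in> null_sets lborel" by blast
  have "ess_limsup v z \<le> Limsup (at z within A) (ess_limsup v)"
  proof (rule ereal_le_real)
    fix c assume "Limsup (at z within A) (ess_limsup v) \<le> ereal c"
    show "ess_limsup v z \<le> ereal c"
    proof (rule ereal_le_epsilon2)
      fix e :: real assume e: "0 < e"
      then have "Limsup (at z within A) (ess_limsup v) < ereal (c + e)"
        using \<open>Limsup (at z within A) (ess_limsup v) \<le> ereal c\<close>
        by (metis ereal_less_eq(3) le_less_trans less_add_same_cancel1 less_ereal.simps(1))
      from Limsup_lessD[OF this] obtain s where s: "s > 0"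
        "\<And>y. y \<in> A \<Longrightarrow> y \<noteq> z \<Longrightarrow> dist y z < s \<Longrightarrow> ess_limsup v y < ereal (c + e)"
        unfolding eventually_at by auto
      have "AE y in lborel. y \<notin> ball z r - A" by (rule AE_not_in[OF r(2)])
      then have "AE y in lborel. y \<in> ball z (min r s) \<longrightarrow> v y \<le> ereal (c + e)"
        using AE_lborel_neq[of z] AE_le_ess_limsup[of v]
      proof eventually_elim
        case (elim y)
        show ?case
        proof
          assume "y \<in> ball z (min r s)"
          then have "y \<in> A" "dist y z < s" using elim(1) by (auto simp: dist_commute)
          from s(2)[OF this(1) elim(2) this(2)] show "v y \<le> ereal (c + e)" using elim(3) by order
        qed
      qed
      from ess_limsup_leI[OF _ this] r(1) s(1) show "ess_limsup v z \<le> ereal c + ereal e" by simp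
    qed
  qed
  then show "Limsup (at z within A) (ess_limsup v) = ess_limsup v z" using up by (rule antisym[rotated])
qed

text \<open>Upper semicontinuity puts the essential limsup below \<open>w\<close> at every point,
  and the opposite inequality holds almost everywhere. So integrals are unchanged, while pointwise
  upper bounds, including those on a null set such as a thin \<open>K\<close>, are
  inherited.\<close>

lemma weakly_sh_regularisation:
  assumes form: "admissible_form U a" and DU: "D \<subseteq> U" and D: "open D" and w: "weakly_sh a D w f"
  shows "alpha_sh a D (ess_limsup w)" "\<And>z. z \<in> D \<Longrightarrow> ess_limsup w z \<le> w z"
    "AE z in lborel. z \<in> D \<longrightarrow> ess_limsup w z = ereal (f z)"
proof -
  show le: "ess_limsup w z \<le> w z" if "z \<in> D" for z
    by (rule ess_limsup_le) (use w that in \<open>auto simp: weakly_sh_def\<close>)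
  have "AE z in lborel. z \<in> D \<longrightarrow> w z = ereal (f z)" using w by (auto simp: weakly_sh_def)
  then show ae: "AE z in lborel. z \<in> D \<longrightarrow> ess_limsup w z = ereal (f z)"
    using AE_le_ess_limsup[of w] by eventually_elim (metis antisym le)
  have fin: "ess_limsup w z < \<infinity>" if "z \<in> D" for z
    using le[OF that] w that by (auto simp: weakly_sh_def intro: le_less_trans)
  have "L1_loc D (ess_limsup w)"
    unfolding L1_loc_def
  proof (intro allI impI conjI)
    fix C assume C: "compact C \<and> C \<subseteq> D"
    show "AE z in lborel. z \<in> C \<longrightarrow> \<bar>ess_limsup w z\<bar> \<noteq> \<infinity>"
      using ae by eventually_elim (use C in auto)
    have "integrable lborel (\<lambda>z. indicator C z *\<^sub>R f z)" using w C by (auto simp: weakly_sh_def set_integrable_def)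
    then show "set_integrable lborel C (\<lambda>z. real_of_ereal (ess_limsup w z))"
      unfolding set_integrable_def
    proof (rule integrable_cong_AE_imp)
      have "C \<in> sets borel" using C borel_compact by blast
      then show "(\<lambda>z. indicator C z *\<^sub>R real_of_ereal (ess_limsup w z)) \<in> borel_measurable lborel"
        using borel_measurable_ess_limsup[of w] by measurable
      show "AE z in lborel. indicator C z *\<^sub>R f z = indicator C z *\<^sub>R real_of_ereal (ess_limsup w z)"
        using ae by eventually_elim (use C in \<open>auto simp: indicator_def\<close>)
    qed
  qed
  moreover have "0 \<le> (\<integral>z. real_of_ereal (ess_limsup w z) * alpha_ddc a \<omega> z \<partial>lborel)" if \<omega>: "nonneg_test_fun D \<omega>" for \<omega>
  proof -
    have \<omega>U: "nonneg_test_fun U \<omega>" using \<omega> DU by (auto simp: nonneg_test_fun_def)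
    obtain b where b: "alpha_ddc a \<omega> \<in> borel_measurable borel"
      "\<And>z. z \<notin> closure {z. \<omega> z \<noteq> 0} \<Longrightarrow> alpha_ddc a \<omega> z = 0"
      by (rule alpha_ddc_test_bounded[OF form \<omega>U]) blast
    have "(\<integral>z. real_of_ereal (ess_limsup w z) * alpha_ddc a \<omega> z \<partial>lborel) = (\<integral>z. f z * alpha_ddc a \<omega> z \<partial>lborel)"
    proof (rule integral_cong_AE)
      show "(\<lambda>z. real_of_ereal (ess_limsup w z) * alpha_ddc a \<omega> z) \<in> borel_measurable lborel"
        using borel_measurable_ess_limsup[of w] b(1) by measurable
      show "(\<lambda>z. f z * alpha_ddc a \<omega> z) \<in> borel_measurable lborel"
        using weakly_sh_integrable[OF form DU w \<omega>] by (rule borel_measurable_integrable)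
      show "AE z in lborel. real_of_ereal (ess_limsup w z) * alpha_ddc a \<omega> z = f z * alpha_ddc a \<omega> z"
        using ae
      proof eventually_elim
        case (elim z)
        then show ?case using b(2)[of z] \<omega> by (cases "z \<in> D") (auto simp: nonneg_test_fun_def)
      qed
    qed
    then show ?thesis using w \<omega> by (simp add: weakly_sh_def)
  qed
  ultimately show "alpha_sh a D (ess_limsup w)"
    using strongly_usc_ess_limsup[OF D fin] by (auto simp: alpha_sh_def)
qed

section \<open>Means of weakly subharmonic functions\<close>

context frozen_form begin

lemma mean_kernel_outside:
  assumes "admissible_radius r" "x \<in> cball z0 (R/2)" "y \<notin> cball z0 R"
  shows "mean_kernel r x y = 0"
proof -
  have r: "r > 0" "2 * r < sqrt \<kappa> * (R / 2)" using assms(1) by (auto simp: admissible_radius_def)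
  have "2 * r / sqrt \<kappa> \<le> R / 2" using r \<kappa>_pos by (simp add: field_simps)
  also have "R / 2 \<le> norm (y - x)"
    using assms(2,3) dist_triangle[of z0 y x] by (simp add: dist_norm norm_minus_commute)
  finally show ?thesis using assms(2) R_pos r(1) by (intro mean_kernel_eq_0) auto
qed

lemma integrable_mult_mean_kernel:
  assumes r: "admissible_radius r" and x: "x \<in> cball z0 (R/2)" and f: "set_integrable lborel (cball z0 R) f"
  shows "integrable lborel (\<lambda>y. f y * mean_kernel r x y)"
proof -
  have r0: "r > 0" using r by (simp add: admissible_radius_def)
  have xR: "x \<in> cball z0 R" using x R_pos by auto
  have "integrable lborel (\<lambda>y. (indicator (cball z0 R) y *\<^sub>R f y) * mean_kernel r x y)"
    using f unfolding set_integrable_def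
    by (rule integrable_mult_bounded[OF _ _ mean_kernel_le[OF r0]])
       (intro borel_measurable_continuous_onI continuous_mean_kernel xR r0)
  moreover have "(\<lambda>y. (indicator (cball z0 R) y *\<^sub>R f y) * mean_kernel r x y) = (\<lambda>y. f y * mean_kernel r x y)"
    using mean_kernel_outside[OF r x] by (auto simp: indicator_def fun_eq_iff)
  ultimately show ?thesis by simp
qed

text \<open>The kernel is bounded and continuous in its centre and vanishes off one fixed ball for
  all centres considered, so dominated convergence needs no more than integrability of
  \<open>f\<close> on that ball.\<close>

lemma continuous_mean_integral:
  assumes r: "admissible_radius r" and f: "set_integrable lborel (cball z0 R) f"
  shows "continuous_on (cball z0 (R/2)) (\<lambda>x. \<integral>y. f y * mean_kernel r x y \<partial>lborel)"
  unfolding continuous_on_sequentially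
proof (intro allI impI ballI, elim conjE)
  fix s x assume s: "\<forall>n::nat. s n \<in> cball z0 (R/2)" "s \<longlonglongrightarrow> x" and x: "x \<in> cball z0 (R/2)"
  have r0: "r > 0" using r by (simp add: admissible_radius_def)
  have sub: "cball z0 (R/2) \<subseteq> cball z0 R" using R_pos by auto
  define b where "b = 2 * M / r ^ (2 * CARD('n))"
  define g where "g y = indicator (cball z0 R) y * f y" for y
  have g: "integrable lborel g" using f by (simp add: set_integrable_def g_def[abs_def])
  have "(\<lambda>n. \<integral>y. f y * mean_kernel r (s n) y \<partial>lborel) \<longlonglongrightarrow> (\<integral>y. f y * mean_kernel r x y \<partial>lborel)"
  proof (rule integral_dominated_convergence[where w="\<lambda>y. \<bar>g y\<bar> * b"])
    show "(\<lambda>y. f y * mean_kernel r x y) \<in> borel_measurable lborel"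
      "(\<lambda>y. f y * mean_kernel r (s n) y) \<in> borel_measurable lborel" for n
      using integrable_mult_mean_kernel[OF r _ f] x s by auto
    show "integrable lborel (\<lambda>y. \<bar>g y\<bar> * b)" using g by simp
    show "AE y in lborel. (\<lambda>n. f y * mean_kernel r (s n) y) \<longlonglongrightarrow> f y * mean_kernel r x y"
    proof (rule AE_I2)
      fix y
      have "(\<lambda>n. mean_kernel r (s n) y) \<longlonglongrightarrow> mean_kernel r x y"
        by (rule continuous_on_tendsto_compose[OF continuous_mean_kernel_center[OF r0] s(2)])
           (use x s(1) sub in \<open>auto simp del: mem_cball intro!: always_eventually\<close>)
      then show "(\<lambda>n. f y * mean_kernel r (s n) y) \<longlonglongrightarrow> f y * mean_kernel r x y" by (intro tendsto_intros)
    qed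
    show "AE y in lborel. norm (f y * mean_kernel r (s n) y) \<le> \<bar>g y\<bar> * b" for n
    proof (rule AE_I2)
      fix y
      show "norm (f y * mean_kernel r (s n) y) \<le> \<bar>g y\<bar> * b"
      proof (cases "y \<in> cball z0 R")
        case True
        have "\<bar>f y\<bar> * \<bar>mean_kernel r (s n) y\<bar> \<le> \<bar>f y\<bar> * b"
          unfolding b_def by (intro mult_left_mono mean_kernel_le r0) simp
        then show ?thesis using True by (simp add: g_def abs_mult)
      next
        case False
        then have "mean_kernel r (s n) y = 0" using mean_kernel_outside[OF r] s(1) by blast
        then show ?thesis using M_pos r0 by (simp add: b_def)
      qed
    qed
  qed
  then show "((\<lambda>x. \<integral>y. f y * mean_kernel r x y \<partial>lborel) \<circ> s) \<longlonglongrightarrow> (\<integral>y. f y * mean_kernel r x y \<partial>lborel)"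
    by (simp add: o_def)
qed

lemma set_integrable_const: "set_integrable lborel (cball z0 R) (\<lambda>_. c::real)"
  unfolding set_integrable_def
  using emeasure_compact_finite[OF compact_cball, of z0 R]
  by (intro integrable_scaleR_left integrable_real_indicator) auto

lemma continuous_kernel_mass:
  assumes r: "admissible_radius r"
  shows "continuous_on (cball z0 (R/2)) kernel_mass"
proof -
  have r0: "r > 0" using r by (simp add: admissible_radius_def)
  have "kernel_mass x = (\<integral>y. 1 * mean_kernel r x y \<partial>lborel)" if "x \<in> cball z0 (R/2)" for x
    using integral_mean_kernel[OF _ r0, of x] that R_pos by auto
  then show ?thesis
    by (intro continuous_on_eq[OF continuous_mean_integral[OF r set_integrable_const[of 1]]]) (rule sym)
qed

lemma weakly_sh_submean:
  assumes r: "admissible_radius r" and w: "weakly_sh a V w f" and neg: "\<And>z. z \<in> V \<Longrightarrow> w z \<le> 0"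
  shows "AE x in lborel. x \<in> cball z0 (R/2) \<longrightarrow>
     kernel_mass x * f x \<le> kernel_factor r * (\<integral>y. f y * mean_kernel r x y \<partial>lborel)"
proof -
  \<comment> \<open>The representative \<open>f\<close> is nonpositive only almost everywhere,
    whereas the submean inequality asks for the sign at every point; truncation changes
    \<open>f\<close> on a null set only.\<close>
  define g where "g z = min (f z) 0" for z
  have f: "set_integrable lborel C f" if "compact C" "C \<subseteq> V" for C
    using w that by (auto simp: weakly_sh_def)
  have g: "set_integrable lborel C g" if "compact C" "C \<subseteq> V" for C
  proof -
    have "integrable lborel (\<lambda>z. min (indicator C z *\<^sub>R f z) 0)"
      using f[OF that] unfolding set_integrable_def by (intro integrable_min) auto
    moreover have "(\<lambda>z. min (indicator C z *\<^sub>R f z) 0) = (\<lambda>z. indicator C z *\<^sub>R g z)"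
      by (auto simp: g_def indicator_def fun_eq_iff)
    ultimately show ?thesis by (simp add: set_integrable_def)
  qed
  have "AE z in lborel. z \<in> V \<longrightarrow> w z = ereal (f z)" using w by (auto simp: weakly_sh_def)
  then have ae: "AE z in lborel. z \<in> V \<longrightarrow> g z = f z"
  proof eventually_elim
    case (elim z)
    then show ?case using neg[of z] by (auto simp: g_def)
  qed
  have fR: "set_integrable lborel (cball z0 R) f" "set_integrable lborel (cball z0 R) g"
    using f g cball_V by auto
  have "AE x in lborel. x \<in> cball z0 (R/2) \<longrightarrow>
     kernel_mass x * g x \<le> kernel_factor r * (\<integral>y. g y * mean_kernel r x y \<partial>lborel)"
  proof (rule submean_inequality_AE[OF r fR(2)])
    show "g y \<le> 0" for y by (simp add: g_def)
    fix \<omega> assume \<omega>: "nonneg_test_fun V \<omega>"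
    have "(\<integral>y. g y * alpha_ddc a \<omega> y \<partial>lborel) = (\<integral>y. f y * alpha_ddc a \<omega> y \<partial>lborel)"
    proof (rule integral_cong_AE)
      show "(\<lambda>y. g y * alpha_ddc a \<omega> y) \<in> borel_measurable lborel" "(\<lambda>y. f y * alpha_ddc a \<omega> y) \<in> borel_measurable lborel"
        using L1_loc_integrable_alpha_ddc[OF form VU \<omega>] f g by blast+
      have "nonneg_test_fun U \<omega>" using \<omega> VU by (auto simp: nonneg_test_fun_def)
      then obtain b :: real where b: "\<And>z. z \<notin> closure {z. \<omega> z \<noteq> 0} \<Longrightarrow> alpha_ddc a \<omega> z = 0"
        by (rule alpha_ddc_test_bounded[OF form]) blast
      show "AE y in lborel. g y * alpha_ddc a \<omega> y = f y * alpha_ddc a \<omega> y"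
        using ae
      proof eventually_elim
        case (elim y)
        then show ?case using b[of y] \<omega> by (cases "y \<in> V") (auto simp: nonneg_test_fun_def)
      qed
    qed
    then show "0 \<le> (\<integral>y. g y * alpha_ddc a \<omega> y \<partial>lborel)" using w \<omega> by (simp add: weakly_sh_def)
  qed
  then show ?thesis using ae
  proof eventually_elim
    case (elim x)
    show ?case
    proof
      assume x: "x \<in> cball z0 (R/2)"
      have "(\<integral>y. g y * mean_kernel r x y \<partial>lborel) = (\<integral>y. f y * mean_kernel r x y \<partial>lborel)"
      proof (rule integral_cong_AE)
        show "(\<lambda>y. g y * mean_kernel r x y) \<in> borel_measurable lborel" "(\<lambda>y. f y * mean_kernel r x y) \<in> borel_measurable lborel"
          using integrable_mult_mean_kernel[OF r x] fR by blast+
        show "AE y in lborel. g y * mean_kernel r x y = f y * mean_kernel r x y"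
          using ae
        proof eventually_elim
          case (elim y)
          then show ?case
            using mean_kernel_outside[OF r x, of y] subsetD[OF cball_V, of y] by (cases "y \<in> V") auto
        qed
      qed
      moreover have "x \<in> V" using x R_pos cball_V by auto
      ultimately show "kernel_mass x * f x \<le> kernel_factor r * (\<integral>y. f y * mean_kernel r x y \<partial>lborel)"
        using elim x by simp
    qed
  qed
qed

text \<open>The kernel reaches less than \<open>\<rho> / 2\<close> from a centre that is itself
  within \<open>\<rho> / 2\<close> of \<open>z0\<close>, so it sees only points where the bound
  \<open>k\<close> is available.\<close>

lemma kernel_integral_le:
  assumes r: "admissible_radius r" "2 * r / sqrt \<kappa> < \<rho> / 2" and f: "set_integrable lborel (cball z0 R) f"
    and k: "AE y in lborel. y \<in> ball z0 \<rho> \<inter> V \<longrightarrow> f y \<le> k"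
    and x: "x \<in> cball z0 (R/2)" "x \<in> ball z0 (\<rho>/2)"
  shows "(\<integral>y. f y * mean_kernel r x y \<partial>lborel) \<le> k * kernel_mass x"
proof -
  have r0: "r > 0" using r by (simp add: admissible_radius_def)
  have xR: "x \<in> cball z0 R" using x(1) R_pos by auto
  have "(\<integral>y. f y * mean_kernel r x y \<partial>lborel) \<le> (\<integral>y. k * mean_kernel r x y \<partial>lborel)"
  proof (rule integral_mono_AE)
    show "integrable lborel (\<lambda>y. f y * mean_kernel r x y)" "integrable lborel (\<lambda>y. k * mean_kernel r x y)"
      using integrable_mult_mean_kernel[OF r(1) x(1)] f set_integrable_const[of k] by blast+
    show "AE y in lborel. f y * mean_kernel r x y \<le> k * mean_kernel r x y"
      using k
    proof eventually_elim
      case (elim y)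
      show ?case
      proof (cases "mean_kernel r x y = 0")
        case False
        then have "y \<in> cball z0 R" using mean_kernel_outside[OF r(1) x(1)] by blast
        moreover have "norm (y - x) < 2 * r / sqrt \<kappa>" using mean_kernel_eq_0[OF xR r0, of y] False by force
        then have "y \<in> ball z0 \<rho>"
          using r(2) x(2) dist_triangle[of z0 y x] by (simp add: dist_norm norm_minus_commute)
        ultimately have "f y \<le> k" using elim cball_V by blast
        then show ?thesis by (intro mult_right_mono mean_kernel_nonneg xR)
      qed simp
    qed
  qed
  then show ?thesis using integral_mean_kernel[OF xR r0] by simp
qed

end

subsection \<open>From regularity to local regularity\<close>

text \<open>Passage to the limit when the inequality is known merely at some points arbitrarily
  close to \<open>z\<close>, possibly for a different reason at each of them.\<close>

lemma frequently_le_imp_le: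
  fixes F G :: "'a::metric_space \<Rightarrow> real"
  assumes "continuous_on S F" "continuous_on S G" "z \<in> S"
    and "\<And>e. e > 0 \<Longrightarrow> \<exists>x\<in>S. dist x z < e \<and> F x \<le> G x"
  shows "F z \<le> G z"
proof (rule ccontr)
  assume "\<not> ?thesis"
  then have d: "F z - G z > 0" by simp
  have "continuous_on S (\<lambda>x. F x - G x)" by (intro continuous_on_diff assms)
  then obtain e where e: "e > 0" "\<And>x. x \<in> S \<Longrightarrow> dist x z < e \<Longrightarrow> dist (F x - G x) (F z - G z) < F z - G z"
    using assms(3) d unfolding continuous_on_iff by metis
  obtain x where "x \<in> S" "dist x z < e" "F x \<le> G x" using assms(4)[OF e(1)] by blast
  with e(2)[of x] show False by (auto simp: dist_real_def)
qed

text \<open>This is how almost everywhere inequalities reach a given point: by the equality in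
  strong upper semicontinuity, a level exceeded at \<open>z\<close> is exceeded at points near
  \<open>z\<close> that avoid the null set.\<close>

lemma strongly_usc_near:
  assumes "strongly_usc D u" "z \<in> D" "ereal c < u z" "N \<in> null_sets lborel" "e > 0"
  obtains x where "x \<notin> N" "dist x z < e" "ereal c < u x"
proof -
  have "\<exists>r>0. ball z r - (- N) \<in> null_sets lborel"
  proof (intro exI[of _ 1] conjI)
    have "ball z 1 - (- N) = N \<inter> ball z 1" by auto
    then show "ball z 1 - (- N) \<in> null_sets lborel" using assms(4) by (auto intro: null_set_Int2)
  qed simp
  then have L: "Limsup (at z within - N) u = u z" using assms(1,2) by (simp add: strongly_usc_def)
  have "\<not> eventually (\<lambda>x. u x \<le> ereal c) (at z within - N)"
    using Limsup_bounded[of u "ereal c" "at z within - N"] L assms(3) by auto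
  then have "\<exists>x\<in>- N. x \<noteq> z \<and> dist x z < e \<and> \<not> u x \<le> ereal c"
    using assms(5) unfolding eventually_at by blast
  then show ?thesis using that by auto
qed

lemma psi_imp_loc_psi_regular:
  fixes a :: "complex^'n \<Rightarrow> 'n \<Rightarrow> 'n \<Rightarrow> complex" and \<psi> :: "complex^'n \<Rightarrow> real"
  assumes form: "admissible_form U a" and DU: "D \<subseteq> U" and D: "open D"
    and Kcpt: "compact K" and KD: "K \<subseteq> D"
    and psi_cont: "continuous_on K \<psi>" and psi_neg: "\<forall>z\<in>K. \<psi> z < 0"
    and ext: "alpha_sh a D \<psi>e" "\<forall>z\<in>D. \<psi>e z < 0" "\<forall>z\<in>K. \<psi>e z = ereal (\<psi> z)"
    and strict: "\<epsilon> > 0" "alpha_sh a D (\<lambda>z. \<psi>' z - ereal (\<epsilon> * (norm z)\<^sup>2))"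
      "\<forall>z\<in>K. \<psi>' z = ereal (\<psi> z)" "\<forall>z\<in>D. \<psi>' z < 0"
    and z0: "z0 \<in> K" and reg: "psi_regular_point a z0 K D \<psi>"
  shows "loc_psi_regular_point a z0 K D \<psi>"
  unfolding loc_psi_regular_point_def
proof (intro allI impI)
  fix B0 assume B0: "z0 \<in> interior B0"
  let ?E = "K \<inter> closure B0"
  have z0D: "z0 \<in> D" using z0 KD by blast
  have p0: "\<psi> z0 < 0" using psi_neg z0 by blast
  obtain r0 where r0: "r0 > 0" "ball z0 r0 \<subseteq> interior B0" using B0 by (metis openE open_interior)
  obtain m where m: "m > 0" "\<And>z. z \<in> K \<Longrightarrow> - \<psi> z \<le> m"
  proof -
    have "bounded (\<psi> ` K)" by (intro compact_imp_bounded compact_continuous_image psi_cont Kcpt)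
    then obtain b where "\<forall>z\<in>K. \<bar>\<psi> z\<bar> \<le> b" by (auto simp: bounded_iff)
    then show ?thesis using that[of "\<bar>b\<bar> + 1"] by force
  qed
  \<comment> \<open>This \<open>\<eta>\<close> gives \<open>w + \<eta> u \<le> (1 + \<eta>) \<psi>\<close> on \<open>K\<close>: inside \<open>B0\<close> because \<open>u \<le> \<psi>\<close>, and outside because
    there \<open>w \<le> \<psi> - \<epsilon> r0\<^sup>2\<close>.\<close>
  define \<eta> where "\<eta> = \<epsilon> * r0\<^sup>2 / m"
  have \<eta>: "\<eta> > 0" "\<eta> * m = \<epsilon> * r0\<^sup>2" using strict(1) r0 m by (auto simp: \<eta>_def)
  define W where "W z = \<psi>' z - ereal (\<epsilon> * (norm z)\<^sup>2)" for z
  \<comment> \<open>The affine function \<open>\<epsilon> * (|z|^2 - |z - z0|^2)\<close>; adding it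
    moves the peak of the subtracted paraboloid to \<open>z0\<close>, where \<open>w\<close> then
    agrees with \<open>\<psi>\<close>.\<close>
  define l where "l z = - \<epsilon> * (norm z0)\<^sup>2 + inner ((2 * \<epsilon>) *\<^sub>R z0) z" for z
  define w where "w z = W z + ereal (l z)" for z
  have l: "l z = \<epsilon> * (norm z)\<^sup>2 - \<epsilon> * (norm (z - z0))\<^sup>2" for z
    by (simp add: l_def power2_norm_eq_inner inner_diff_left inner_diff_right inner_commute algebra_simps)
  have w: "w z = \<psi>' z - ereal (\<epsilon> * (norm (z - z0))\<^sup>2)" if "z \<in> D" for z
  proof -
    have "\<psi>' z < 0" using strict(4) that by blast
    then show ?thesis unfolding w_def W_def l by (cases "\<psi>' z") auto
  qed
  have w_le: "w z \<le> \<psi>' z" if "z \<in> D" for z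
    unfolding w[OF that] using strict(1) by (cases "\<psi>' z") auto
  have wneg: "w z < 0" if "z \<in> D" for z using w_le[OF that] strict(4) that by (meson le_less_trans)
  have wz0: "w z0 = ereal (\<psi> z0)" using w[OF z0D] strict(3) z0 by simp
  have Wsh: "alpha_sh a D W" using strict(2) by (simp add: W_def[abs_def])
  have Wz0: "W z0 \<noteq> -\<infinity>" using strict(3) z0 by (simp add: W_def)
  note Wweak = alpha_sh_imp_weakly_sh[OF D Wsh z0D Wz0]
  define f where "f z = real_of_ereal (W z) + l z" for z
  have wf: "weakly_sh a D w f"
    unfolding w_def[abs_def] f_def[abs_def]
    by (rule weakly_sh_add[OF form DU Wweak(1) weakly_sh_affine[OF form DU]]) (rule l_def)

  have "omega_alpha_star a z0 ?E D \<psi> \<le> ereal (\<psi> z0)"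
  proof (rule omega_star_leI, rule ccontr)
    fix \<delta> :: real assume \<delta>: "\<delta> > 0"
      and not_ev: "\<not> (\<forall>\<^sub>F z in nhds z0. \<forall>u\<in>U_class a ?E D \<psi>. u z \<le> ereal (\<psi> z0 + \<delta>))"
    \<comment> \<open>A competitor exceeding the level by \<open>\<delta>\<close> contributes
      \<open>\<eta> * \<delta>\<close> to the sum. The first entry makes the slack from regularity,
      multiplied by \<open>1 + \<eta>\<close>, at most a quarter of this; the second keeps the level
      negative.\<close>
    define \<delta>' where "\<delta>' = min (\<eta> * \<delta> / (4 * (1 + \<eta>))) (- \<psi> z0 / 2)"
    have \<delta>': "\<delta>' > 0" "\<psi> z0 + \<delta>' < 0" "(1 + \<eta>) * \<delta>' \<le> \<eta> * \<delta> / 4"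
    proof -
      show "\<delta>' > 0" using \<delta> \<eta>(1) p0 by (simp add: \<delta>'_def)
      have "\<delta>' \<le> - \<psi> z0 / 2" by (simp add: \<delta>'_def)
      then show "\<psi> z0 + \<delta>' < 0" using p0 by linarith
      have "(1 + \<eta>) * \<delta>' \<le> (1 + \<eta>) * (\<eta> * \<delta> / (4 * (1 + \<eta>)))"
        using \<eta>(1) by (intro mult_left_mono) (auto simp: \<delta>'_def)
      also have "(1 + \<eta>) * (\<eta> * \<delta> / (4 * (1 + \<eta>))) = \<eta> * \<delta> / 4" using \<eta>(1) by (simp add: divide_simps)
      finally show "(1 + \<eta>) * \<delta>' \<le> \<eta> * \<delta> / 4" .
    qed
    \<comment> \<open>The bound that regularity will give for \<open>w + \<eta> * u\<close> before
      division by \<open>1 + \<eta>\<close>.\<close>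
    define k where "k = (1 + \<eta>) * (\<psi> z0 + \<delta>')"
    have "\<forall>\<^sub>F z in nhds z0. \<forall>u\<in>U_class a K D \<psi>. u z < ereal (\<psi> z0 + \<delta>')"
      by (rule omega_star_eventually_less[OF _ \<delta>'(1)]) (use reg in \<open>simp add: psi_regular_point_def\<close>)
    then obtain \<rho> where \<rho>: "\<rho> > 0" "\<And>z u. z \<in> ball z0 \<rho> \<Longrightarrow> u \<in> U_class a K D \<psi> \<Longrightarrow> u z < ereal (\<psi> z0 + \<delta>')"
      unfolding eventually_nhds_metric by (auto simp: dist_commute)
    obtain S S' M where step: "smooth_step S S' M" using smooth_step_locale_exists by blast
    obtain R C1 \<kappa> B where fr: "R > 0" "C1 > 0" "\<kappa> > 0" "cball z0 R \<subseteq> D"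
      "\<And>x. x \<in> cball z0 R \<Longrightarrow> self_adjoint (B x)"
      "\<And>x \<zeta>. x \<in> cball z0 R \<Longrightarrow> \<kappa> * (norm \<zeta>)\<^sup>2 \<le> quad_form (B x) \<zeta>"
      "\<And>x y. x \<in> cball z0 R \<Longrightarrow> y \<in> cball z0 R \<Longrightarrow>
       \<bar>inner (coeff_mat a y *v (B x *v (y - x))) (B x *v (y - x)) - quad_form (B x) (y - x)\<bar>
         \<le> C1 * quad_form (B x) (y - x) * sqrt (quad_form (B x) (y - x))"
      "\<And>x y. x \<in> cball z0 R \<Longrightarrow> y \<in> cball z0 R \<Longrightarrow>
       \<bar>Re (trace (coeff_mat a y ** B x)) - real CARD('n)\<bar> \<le> C1 * sqrt (quad_form (B x) (y - x))"
      "\<And>y. continuous_on (cball z0 R) (\<lambda>x. quad_form (B x) (y - x))"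
      by (rule frozen_inverse[OF form D z0D DU]) blast
    interpret frozen_form S S' M a U D z0 R C1 \<kappa> B
      by (intro frozen_form.intro frozen_form_axioms.intro step form DU fr)
    \<comment> \<open>The radius depends on \<open>\<rho>\<close>, \<open>k\<close>,
      \<open>\<eta>\<close> and \<open>\<delta>\<close> only, not on any competitor. The last
      condition spends another quarter of \<open>\<eta> * \<delta>\<close> on the factor not being
      1.\<close>
    have "\<forall>\<^sub>F r in at_right 0. admissible_radius r \<and> 2 * r / sqrt \<kappa> < \<rho> / 2 \<and> kernel_factor r > 0 \<and> (kernel_factor r - 1) * k < \<eta> * \<delta> / 4"
    proof -
      have "((\<lambda>r. C2 * sqrt 2 * r) \<longlongrightarrow> C2 * sqrt 2 * 0) (at_right 0)" by (intro tendsto_intros)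
      then have e1: "\<forall>\<^sub>F r in at_right 0. C2 * sqrt 2 * r < 1/2" by (rule order_tendstoD) simp
      have "((\<lambda>r. 2 * r) \<longlongrightarrow> 2 * 0) (at_right (0::real))" by (intro tendsto_intros)
      then have e2: "\<forall>\<^sub>F r in at_right 0. 2 * r < sqrt \<kappa> * (R / 2)" by (rule order_tendstoD) (use fr(1,3) in simp)
      have "((\<lambda>r. 2 * r / sqrt \<kappa>) \<longlongrightarrow> 2 * 0 / sqrt \<kappa>) (at_right 0)" by (intro tendsto_intros) (use fr(3) in simp)
      then have e3: "\<forall>\<^sub>F r in at_right 0. 2 * r / sqrt \<kappa> < \<rho> / 2" by (rule order_tendstoD) (use \<rho>(1) in simp)
      have kf: "(kernel_factor \<longlongrightarrow> (1 - C1 * sqrt 2 * 0) * (1 - C2 * sqrt 2 * 0)) (at_right 0)"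
        unfolding kernel_factor_def[abs_def] by (intro tendsto_intros)
      then have e4: "\<forall>\<^sub>F r in at_right 0. kernel_factor r > 0" by (rule order_tendstoD) simp
      have "((\<lambda>r. (kernel_factor r - 1) * k) \<longlongrightarrow> (((1 - C1 * sqrt 2 * 0) * (1 - C2 * sqrt 2 * 0)) - 1) * k) (at_right 0)"
        by (intro tendsto_intros kf)
      then have e5: "\<forall>\<^sub>F r in at_right 0. (kernel_factor r - 1) * k < \<eta> * \<delta> / 4" by (rule order_tendstoD) (use \<eta> \<delta> in simp)
      have e6: "\<forall>\<^sub>F r in at_right (0::real). r > 0" by (simp add: eventually_at_filter)
      show ?thesis using e1 e2 e3 e4 e5 e6 by eventually_elim (simp add: admissible_radius_def)
    qed
    then obtain r where r: "admissible_radius r" "2 * r / sqrt \<kappa> < \<rho> / 2" "kernel_factor r > 0"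
        "(kernel_factor r - 1) * k < \<eta> * \<delta> / 4"
      using eventually_happens'[OF trivial_limit_at_right_real] by blast
    define \<Lambda> where "\<Lambda> = kernel_factor r"
    define I where "I x = (\<integral>y. f y * mean_kernel r x y \<partial>lborel)" for x
    let ?S = "cball z0 (R/2)"
    have z0S: "z0 \<in> ?S" "z0 \<in> cball z0 R" using fr(1) by auto
    have fR: "set_integrable lborel (cball z0 R) f" using wf fr(4) by (auto simp: weakly_sh_def)
    have contI: "continuous_on ?S I" unfolding I_def by (rule continuous_mean_integral[OF r(1) fR])
    note contm = continuous_kernel_mass[OF r(1)]
    have cpos: "kernel_mass z0 > 0" by (rule kernel_mass_pos[OF z0S(2)])

    \<comment> \<open>The mean inequality for \<open>w\<close> at the point \<open>z0\<close>
      itself, obtained from nearby good points by strong upper semicontinuity and continuity of the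
      mean.\<close>
    have lower: "kernel_mass z0 * \<psi> z0 \<le> \<Lambda> * I z0"
    proof (rule field_le_epsilon)
      fix e :: real assume "e > 0"
      define d where "d = e / (2 * kernel_mass z0)"
      have d: "d > 0" using \<open>e > 0\<close> cpos by (simp add: d_def)
      have AE1: "AE x in lborel. x \<in> ?S \<longrightarrow> kernel_mass x * f x \<le> kernel_factor r * I x"
        unfolding I_def by (rule weakly_sh_submean[OF r(1) wf]) (use wneg in \<open>auto simp: less_imp_le\<close>)
      have AE2: "AE x in lborel. x \<in> D \<longrightarrow> w x = ereal (f x)" using wf by (auto simp: weakly_sh_def)
      have "AE x in lborel. (x \<in> ?S \<longrightarrow> kernel_mass x * f x \<le> kernel_factor r * I x) \<and> (x \<in> D \<longrightarrow> w x = ereal (f x))"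
        using AE1 AE2 by eventually_elim blast
      then obtain N where N: "\<And>x. x \<in> space lborel - N \<Longrightarrow> (x \<in> ?S \<longrightarrow> kernel_mass x * f x \<le> kernel_factor r * I x) \<and> (x \<in> D \<longrightarrow> w x = ereal (f x))"
        "N \<in> null_sets lborel" by (rule AE_E3) blast
      have "kernel_mass z0 * (\<psi> z0 - 2 * d) \<le> \<Lambda> * I z0"
      proof (rule frequently_le_imp_le[where S="?S" and F="\<lambda>x. kernel_mass x * (\<psi> z0 - 2 * d)" and G="\<lambda>x. \<Lambda> * I x"])
        fix e' :: real assume e': "e' > 0"
        have "continuous_on UNIV l" unfolding l_def by (intro continuous_intros)
        then obtain e2 where e2: "e2 > 0" "\<And>x. dist x z0 < e2 \<Longrightarrow> dist (l x) (l z0) < d"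
          using d unfolding continuous_on_iff by (metis UNIV_I)
        \<comment> \<open>Strong upper semicontinuity is available for \<open>W\<close>, and
          \<open>l\<close> is moved by continuity. Each costs \<open>d\<close>, hence
          \<open>2 * d\<close>.\<close>
        define q where "q = \<psi> z0 - l z0"
        have "W z0 = ereal q" using wz0 Wz0 unfolding w_def q_def by (cases "W z0") auto
        then have "ereal (q - d) < W z0" using d by simp
        from strongly_usc_near[OF Wweak(2) z0D this N(2), of "min (min e' e2) (R/2)"]
        obtain x where x: "x \<notin> N" "dist x z0 < min (min e' e2) (R/2)" "ereal (q - d) < W x"
          using e' e2 fr(1) by auto
        have xS: "x \<in> ?S" using x(2) by (simp add: dist_commute)
        have xD: "x \<in> D" using xS fr(1,4) by auto
        have fx: "w x = ereal (f x)" "kernel_mass x * f x \<le> \<Lambda> * I x" using N(1)[of x] x(1) xS xD by (auto simp: \<Lambda>_def)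
        have "ereal (q - d) + ereal (l x) < ereal (f x)"
          using x(3) fx(1) unfolding w_def by (cases "W x") auto
        then have "\<psi> z0 - 2 * d \<le> f x" using e2(2)[of x] x(2) by (auto simp: q_def dist_real_def)
        moreover have "kernel_mass x > 0" using kernel_mass_pos[of x] xS fr(1) by auto
        ultimately have "kernel_mass x * (\<psi> z0 - 2 * d) \<le> kernel_mass x * f x" by simp
        then have "kernel_mass x * (\<psi> z0 - 2 * d) \<le> \<Lambda> * I x" using fx(2) by simp
        then show "\<exists>x\<in>?S. dist x z0 < e' \<and> kernel_mass x * (\<psi> z0 - 2 * d) \<le> \<Lambda> * I x" using xS x(2) by auto
      qed (intro continuous_intros contm contI z0S)+
      moreover have "kernel_mass z0 * (2 * d) = e" using cpos by (simp add: d_def)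
      ultimately show "kernel_mass z0 * \<psi> z0 \<le> \<Lambda> * I z0 + e" by (simp only: right_diff_distrib diff_le_eq)
    qed

    \<comment> \<open>Both sides involve the centre only through \<open>I\<close> and
      \<open>kernel_mass\<close>. So it suffices to find points arbitrarily near \<open>z0\<close>
      where the inequality holds, each with a competitor of its own.\<close>
    have upper: "\<Lambda> * I z0 + \<eta> * kernel_mass z0 * (\<psi> z0 + \<delta>) \<le> \<Lambda> * k * kernel_mass z0"
    proof (rule frequently_le_imp_le[where S="?S" and F="\<lambda>x. \<Lambda> * I x + \<eta> * kernel_mass x * (\<psi> z0 + \<delta>)" and G="\<lambda>x. \<Lambda> * k * kernel_mass x"])
      fix e :: real assume e: "e > 0"
      \<comment> \<open>Halved because two steps are made: from \<open>z0\<close> to a point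
        \<open>z\<close> where some \<open>u\<close> is too large, and from there to a point
        \<open>x\<close> off the null set.\<close>
      define e' where "e' = min (min e (\<rho>/2)) (R/2) / 2"
      have e': "e' > 0" "2 * e' \<le> e" "2 * e' \<le> \<rho>/2" "2 * e' \<le> R/2" using e \<rho>(1) fr(1) by (auto simp: e'_def)
      have "\<exists>z. dist z z0 < e' \<and> \<not> (\<forall>u\<in>U_class a ?E D \<psi>. u z \<le> ereal (\<psi> z0 + \<delta>))"
        using not_ev e'(1) unfolding eventually_nhds_metric by blast
      then obtain z u where z: "dist z z0 < e'" and u: "u \<in> U_class a ?E D \<psi>" "ereal (\<psi> z0 + \<delta>) < u z"
        by (auto simp: not_le)
      have zD: "z \<in> D"
      proof -
        have "z \<in> cball z0 R" using z e' fr(1) by (simp add: dist_commute)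
        then show ?thesis using fr(4) by blast
      qed
      have ush: "alpha_sh a D u" and uneg: "\<And>x. x \<in> D \<Longrightarrow> u x < 0" and uE: "\<And>x. x \<in> ?E \<Longrightarrow> u x \<le> ereal (\<psi> x)"
        using u(1) by (auto simp: U_class_def)
      have uz: "u z \<noteq> -\<infinity>" using u(2) by auto
      note uweak = alpha_sh_imp_weakly_sh[OF D ush zD uz]
      define g where "g x = real_of_ereal (u x)" for x
      have "weakly_sh a D (\<lambda>x. ereal \<eta> * u x) (\<lambda>x. real_of_ereal (ereal \<eta> * u x))"
        by (rule alpha_sh_imp_weakly_sh(1)[OF D alpha_sh_cmult[OF \<eta>(1) ush] zD]) (use uz \<eta>(1) in \<open>cases "u z", auto\<close>)
      then have ug: "weakly_sh a D (\<lambda>x. ereal \<eta> * u x) (\<lambda>x. \<eta> * g x)" by (simp add: g_def)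
      define v where "v x = w x + ereal \<eta> * u x" for x
      have vweak: "weakly_sh a D v (\<lambda>x. f x + \<eta> * g x)"
        unfolding v_def[abs_def] by (rule weakly_sh_add[OF form DU wf ug])
      note vreg = weakly_sh_regularisation[OF form DU D vweak]
      have vneg: "v x < 0" if "x \<in> D" for x
        using wneg[OF that] uneg[OF that] \<eta>(1) unfolding v_def
        by (cases "w x"; cases "u x") (auto simp: zero_ereal_def add_neg_neg mult_pos_neg)
      have vK: "v x \<le> ereal ((1 + \<eta>) * \<psi> x)" if x: "x \<in> K" for x
      proof -
        have xD: "x \<in> D" using x KD by blast
        have wx: "w x = ereal (\<psi> x - \<epsilon> * (norm (x - z0))\<^sup>2)" using w[OF xD] strict(3) x by simp
        show ?thesis
        proof (cases "x \<in> closure B0")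
          case True
          then have ux: "u x \<le> ereal (\<psi> x)" using uE x by blast
          have "\<eta> * t - \<epsilon> * (norm (x - z0))\<^sup>2 \<le> \<eta> * \<psi> x" if "t \<le> \<psi> x" for t
          proof -
            have "\<eta> * t \<le> \<eta> * \<psi> x" using that \<eta>(1) by simp
            moreover have "0 \<le> \<epsilon> * (norm (x - z0))\<^sup>2" using strict(1) by simp
            ultimately show ?thesis by linarith
          qed
          then show ?thesis using ux \<eta>(1) unfolding v_def wx
            by (cases "u x") (auto simp: distrib_right)
        next
          case False
          have "r0 \<le> norm (x - z0)"
          proof (rule ccontr)
            assume "\<not> r0 \<le> norm (x - z0)"
            then have "x \<in> ball z0 r0" by (simp add: dist_norm norm_minus_commute)
            then show False using False r0(2) interior_subset closure_subset by blast
          qed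
          then have "r0\<^sup>2 \<le> (norm (x - z0))\<^sup>2" using r0(1) by (intro power_mono) auto
          then have "\<epsilon> * r0\<^sup>2 \<le> \<epsilon> * (norm (x - z0))\<^sup>2" using strict(1) by simp
          moreover have "\<eta> * (- \<psi> x) \<le> \<eta> * m" using m(2)[OF x] \<eta>(1) by (intro mult_left_mono) auto
          ultimately have "\<psi> x - \<epsilon> * (norm (x - z0))\<^sup>2 \<le> (1 + \<eta>) * \<psi> x"
            using \<eta>(2) by (simp add: algebra_simps)
          moreover have "v x \<le> w x" using uneg[OF xD] \<eta>(1) unfolding v_def wx
            by (cases "u x") (auto simp: zero_ereal_def mult_pos_neg less_imp_le)
          ultimately show ?thesis unfolding wx by (meson ereal_less_eq(3) order_trans)
        qed
      qed
      define c where "c = 1 / (1 + \<eta>)"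
      have c: "c > 0" "c * (1 + \<eta>) = 1" using \<eta>(1) by (auto simp: c_def)
      have member: "(\<lambda>x. ereal c * ess_limsup v x) \<in> U_class a K D \<psi>"
        unfolding U_class_def
      proof (intro CollectI conjI ballI)
        show "alpha_sh a D (\<lambda>x. ereal c * ess_limsup v x)" by (rule alpha_sh_cmult[OF c(1) vreg(1)])
        show "ereal c * ess_limsup v x < 0" if "x \<in> D" for x
          using le_less_trans[OF vreg(2)[OF that] vneg[OF that]] c(1)
          by (cases "ess_limsup v x") (auto simp: zero_ereal_def mult_pos_neg)
        fix x assume x: "x \<in> K"
        have "ess_limsup v x \<le> ereal ((1 + \<eta>) * \<psi> x)" using vreg(2)[of x] vK[OF x] x KD by (meson order_trans subsetD)
        then have "ereal c * ess_limsup v x \<le> ereal c * ereal ((1 + \<eta>) * \<psi> x)" using c by (intro ereal_mult_left_mono) auto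
        also have "\<dots> = ereal (\<psi> x)" using c(2) by (simp flip: mult.assoc)
        finally show "ereal c * ess_limsup v x \<le> ereal (\<psi> x)" .
      qed
      \<comment> \<open>Regularity applied to the regularised competitor; the values of
        \<open>\<rho>\<close> and \<open>k\<close> are the same for every \<open>u\<close>. Almost
        everywhere the regularisation equals the sum of the representatives.\<close>
      have ae_k: "AE y in lborel. y \<in> ball z0 \<rho> \<inter> D \<longrightarrow> f y + \<eta> * g y \<le> k"
        using vreg(3)
      proof eventually_elim
        case (elim y)
        show ?case
        proof
          assume y: "y \<in> ball z0 \<rho> \<inter> D"
          then have "ereal c * ess_limsup v y < ereal (\<psi> z0 + \<delta>')" using \<rho>(2)[OF _ member] by blast
          then have "ess_limsup v y \<le> ereal ((\<psi> z0 + \<delta>') / c)" by (rule ereal_cmult_less_imp_le[OF c(1)])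
          then show "f y + \<eta> * g y \<le> k" using elim y by (simp add: k_def c_def mult.commute)
        qed
      qed
      have gR: "set_integrable lborel (cball z0 R) g" using uweak(1) fr(4) by (auto simp: weakly_sh_def g_def[abs_def])
      have AE1: "AE x in lborel. x \<in> ?S \<longrightarrow> kernel_mass x * g x \<le> \<Lambda> * (\<integral>y. g y * mean_kernel r x y \<partial>lborel)"
        unfolding g_def \<Lambda>_def by (rule weakly_sh_submean[OF r(1) uweak(1)]) (use uneg in \<open>auto simp: less_imp_le\<close>)
      have AE2: "AE x in lborel. x \<in> D \<longrightarrow> u x = ereal (g x)" using uweak(1) by (auto simp: weakly_sh_def g_def)
      have "AE x in lborel. (x \<in> ?S \<longrightarrow> kernel_mass x * g x \<le> \<Lambda> * (\<integral>y. g y * mean_kernel r x y \<partial>lborel)) \<and> (x \<in> D \<longrightarrow> u x = ereal (g x))"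
        using AE1 AE2 by eventually_elim blast
      then obtain N where N: "\<And>x. x \<in> space lborel - N \<Longrightarrow> (x \<in> ?S \<longrightarrow> kernel_mass x * g x \<le> \<Lambda> * (\<integral>y. g y * mean_kernel r x y \<partial>lborel)) \<and> (x \<in> D \<longrightarrow> u x = ereal (g x))"
        "N \<in> null_sets lborel" by (rule AE_E3) blast
      obtain x where x: "x \<notin> N" "dist x z < e'" "ereal (\<psi> z0 + \<delta>) < u x"
        using strongly_usc_near[OF uweak(2) zD u(2) N(2) e'(1)] by blast
      have dx: "dist x z0 < 2 * e'" using x(2) z dist_triangle[of x z0 z] by simp
      have xS: "x \<in> ?S" "x \<in> ball z0 (\<rho>/2)" using dx e' by (auto simp: dist_commute)
      have xD: "x \<in> D" using xS fr(1,4) by auto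
      have gx: "\<psi> z0 + \<delta> < g x" "kernel_mass x * g x \<le> \<Lambda> * (\<integral>y. g y * mean_kernel r x y \<partial>lborel)"
        using N(1)[of x] x(1,3) xS xD by auto
      have mpos: "kernel_mass x > 0" using kernel_mass_pos[of x] xS fr(1) by auto
      have "kernel_mass x * (\<psi> z0 + \<delta>) \<le> kernel_mass x * g x" using gx(1) mpos by simp
      then have b1: "\<eta> * (kernel_mass x * (\<psi> z0 + \<delta>)) \<le> \<eta> * (\<Lambda> * (\<integral>y. g y * mean_kernel r x y \<partial>lborel))"
        using gx(2) \<eta>(1) by (intro mult_left_mono) auto
      have sumR: "set_integrable lborel (cball z0 R) (\<lambda>y. f y + \<eta> * g y)"
        using fR gR by (intro set_integral_add set_integrable_mult_right) auto
      \<comment> \<open>The same kernel and radius for both means: the integral of \<open>u\<close>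
        is absorbed here and never has to be estimated alone.\<close>
      have "I x + \<eta> * (\<integral>y. g y * mean_kernel r x y \<partial>lborel) = (\<integral>y. (f y + \<eta> * g y) * mean_kernel r x y \<partial>lborel)"
        using integrable_mult_mean_kernel[OF r(1) xS(1) fR] integrable_mult_mean_kernel[OF r(1) xS(1) gR]
        by (simp add: I_def distrib_right mult.assoc)
      also have "\<dots> \<le> k * kernel_mass x"
        by (rule kernel_integral_le[OF r(1,2) sumR ae_k xS])
      finally have b2: "\<Lambda> * (I x + \<eta> * (\<integral>y. g y * mean_kernel r x y \<partial>lborel)) \<le> \<Lambda> * (k * kernel_mass x)"
        using r(3) by (intro mult_left_mono) (auto simp: \<Lambda>_def)
      have "\<Lambda> * I x + \<eta> * kernel_mass x * (\<psi> z0 + \<delta>) \<le> \<Lambda> * k * kernel_mass x"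
        using b1 b2 by (simp add: algebra_simps)
      then show "\<exists>x\<in>?S. dist x z0 < e \<and> \<Lambda> * I x + \<eta> * kernel_mass x * (\<psi> z0 + \<delta>) \<le> \<Lambda> * k * kernel_mass x"
        using xS(1) dx e'(2) by (intro bexI[of _ x]) auto
    qed (intro continuous_intros contm contI z0S)+

    \<comment> \<open>The term \<open>\<Lambda> * I z0\<close> cancels between the two bounds. What
      is left says that the gain \<open>\<eta> * \<delta>\<close> is less than the two quarters
      spent on \<open>\<delta>'\<close> and on the factor.\<close>
    have "kernel_mass z0 * (\<psi> z0 + \<eta> * (\<psi> z0 + \<delta>)) \<le> kernel_mass z0 * (\<Lambda> * k)"
      using lower upper by (simp add: algebra_simps)
    then have "\<psi> z0 + \<eta> * (\<psi> z0 + \<delta>) \<le> \<Lambda> * k" using cpos by simp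
    also have "\<dots> = k + (\<Lambda> - 1) * k" by (simp add: algebra_simps)
    also have "\<dots> < k + \<eta> * \<delta> / 4" using r(4) by (simp add: \<Lambda>_def)
    also have "\<dots> \<le> (1 + \<eta>) * \<psi> z0 + \<eta> * \<delta> / 2" using \<delta>'(3) by (simp add: k_def algebra_simps)
    finally have "\<eta> * \<delta> < \<eta> * \<delta> / 2" by (simp add: algebra_simps)
    then show False using mult_pos_pos[OF \<eta>(1) \<delta>] by linarith
  qed
  then show "omega_alpha_star a z0 ?E D \<psi> = ereal (\<psi> z0)"
    using psi_le_omega_star[OF ext _ z0, of ?E] by (intro antisym) auto
qed

lemma loc_psi_imp_psi_regular:
  assumes "loc_psi_regular_point a z0 K D \<psi>"
  shows "psi_regular_point a z0 K D \<psi>"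
  using assms[unfolded loc_psi_regular_point_def, rule_format, of UNIV] by (simp add: psi_regular_point_def)

theorem theorem1p2:
  fixes U D K :: "(complex^'n) set"
    and a :: "complex^'n \<Rightarrow> 'n \<Rightarrow> 'n \<Rightarrow> complex"
    and \<psi> :: "complex^'n \<Rightarrow> real"
  assumes form: "admissible_form U a"
    and DU: "closure D \<subseteq> U"
    and Dreg: "alpha_regular_domain a D"
    and Kcpt: "compact K" and KD: "K \<subseteq> D"
    and psi_cont: "continuous_on K \<psi>" and psi_neg: "\<forall>z\<in>K. \<psi> z < 0"
    and ext: "\<exists>\<psi>'. alpha_sh a D \<psi>' \<and> (\<forall>z\<in>D. \<psi>' z < 0) \<and> (\<forall>z\<in>K. \<psi>' z = ereal (\<psi> z))"
  shows "(\<forall>z0\<in>K. loc_psi_regular_point a z0 K D \<psi> \<longleftrightarrow> loc_alpha_regular_point a z0 K D)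
    \<and> ((\<exists>Dp \<psi>'. open Dp \<and> closure D \<subseteq> Dp \<and> Dp \<subseteq> U \<and> strictly_alpha_sh a Dp \<psi>'
           \<and> (\<forall>z\<in>K. \<psi>' z = ereal (\<psi> z)) \<and> (\<forall>z\<in>D. \<psi>' z < 0))
       \<longrightarrow> (\<forall>z0\<in>K. loc_psi_regular_point a z0 K D \<psi> \<longleftrightarrow> psi_regular_point a z0 K D \<psi>))"
proof (intro conjI ballI impI)
  have D: "open D" "connected D" "D \<noteq> {}" "compact (closure D)" and DU': "D \<subseteq> U"
    using Dreg DU closure_subset[of D] by (auto simp: alpha_regular_domain_def)
  obtain \<psi>e where e: "alpha_sh a D \<psi>e" "\<forall>z\<in>D. \<psi>e z < 0" "\<forall>z\<in>K. \<psi>e z = ereal (\<psi> z)"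
    using ext by blast
  show "loc_psi_regular_point a z0 K D \<psi> \<longleftrightarrow> loc_alpha_regular_point a z0 K D" if "z0 \<in> K" for z0
    using loc_psi_imp_loc_alpha_regular[OF form DU' D(1) that psi_cont psi_neg]
      loc_alpha_imp_loc_psi_regular[OF D(1) KD that psi_cont psi_neg e] by blast
  fix z0
  assume "\<exists>Dp \<psi>'. open Dp \<and> closure D \<subseteq> Dp \<and> Dp \<subseteq> U \<and> strictly_alpha_sh a Dp \<psi>'
           \<and> (\<forall>z\<in>K. \<psi>' z = ereal (\<psi> z)) \<and> (\<forall>z\<in>D. \<psi>' z < 0)"
    and z0: "z0 \<in> K"
  then obtain Dp \<psi>' where Dp: "closure D \<subseteq> Dp" "strictly_alpha_sh a Dp \<psi>'"
    "\<forall>z\<in>K. \<psi>' z = ereal (\<psi> z)" "\<forall>z\<in>D. \<psi>' z < 0" by blast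
  \<comment> \<open>Strictness is used with \<open>D\<close> itself as the relatively compact
    subdomain of \<open>Dp\<close>.\<close>
  obtain \<epsilon> where "\<epsilon> > 0" "alpha_sh a D (\<lambda>z. \<psi>' z - ereal (\<epsilon> * (norm z)\<^sup>2))"
    using Dp(1,2) D unfolding strictly_alpha_sh_def by blast
  from psi_imp_loc_psi_regular[OF form DU' D(1) Kcpt KD psi_cont psi_neg e this Dp(3,4) z0]
  show "loc_psi_regular_point a z0 K D \<psi> \<longleftrightarrow> psi_regular_point a z0 K D \<psi>"
    using loc_psi_imp_psi_regular by blast
qed

end
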